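(* Let $\mathcal C\subseteq \mathbb{P}^1\times\mathbb{P}^1\times\mathbb{P}^1$ be a complete intersection of points of type $(a,b,c)$, and let $X_{\mathcal C}$ be the grid of lines arising from $\mathcal C$. Then $X_{\mathcal C}$ is arithmetically Cohen–Macaulay and a trigraded minimal free resolution of $I_{X_{\mathcal C}}$ is $$0 \rightarrow R^2(-a,-b,-c) \rightarrow R(-a,-b,0) \oplus R(-a,0,-c) \oplus R(0,-b,-c) \rightarrow I_{X_{\mathcal C}} \rightarrow 0.$$
   Context: $R=K[x_{1,0},x_{1,1},x_{2,0},x_{2,1},x_{3,0},x_{3,1}]$ ($K$ algebraically closed, characteristic zero) trigraded by $\deg x_{i,j}=\mathbf e_i$, coordinate ring of $\mathbb{P}^1\times\mathbb{P}^1\times\mathbb{P}^1$. A finite set of points $\mathcal C$ is a complete intersection of points of type $(a_1,a_2,a_3)$ if its (trihomogeneous) defining ideal is $I_{\mathcal C}=(F_1,F_2,F_3)$ with $F_1,F_2,F_3$ a regular sequence and $\deg F_i=a_i\mathbf e_i$. A line is the zero locus $\mathcal L(F,G)$ of $(F,G)$ with $F,G$ linear forms of two different degrees among $\mathbf e_1,\mathbf e_2,\mathbf e_3$; through each point $P$ pass exactly three lines, one of each type. The grid of lines $X_{\mathcal C}$ is the union of all lines of $\mathbb{P}^1\times\mathbb{P}^1\times\mathbb{P}^1$ passing through some point of $\mathcal C$; $I_{X_{\mathcal C}}$ is the intersection of the ideals of these lines, and $X_{\mathcal C}$ is arithmetically Cohen–Macaulay if $R/I_{X_{\mathcal C}}$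 is Cohen–Macaulay. $R(-\mathbf d)$ denotes $R$ with shifted trigrading. *)

theory Defs
  imports "HOL-Library.Poly_Mapping" "HOL-Computational_Algebra.Polynomial"
begin

text \<open>The three factors of P^1 x P^1 x P^1.\<close>
datatype fac = F1 | F2 | F3

text \<open>Variables: x_{i,0} is (i, False), x_{i,1} is (i, True).\<close>
type_synonym var = "fac \<times> bool"

type_synonym 'k mpoly = "(var \<Rightarrow>\<^sub>0 nat) \<Rightarrow>\<^sub>0 'k"

definition Var :: "var \<Rightarrow> 'k::comm_ring_1 mpoly" where
  "Var v = Poly_Mapping.single (Poly_Mapping.single v 1) 1"

definition tdeg :: "(var \<Rightarrow>\<^sub>0 nat) \<Rightarrow> fac \<Rightarrow> nat" where
  "tdeg m i = Poly_Mapping.lookup m (i, False) + Poly_Mapping.lookup m (i, True)"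

text \<open>f is trihomogeneous of degree d (the zero polynomial is of every degree).\<close>
definition trihom :: "(fac \<Rightarrow> nat) \<Rightarrow> 'k::comm_ring_1 mpoly \<Rightarrow> bool" where
  "trihom d f \<longleftrightarrow> (\<forall>m \<in> Poly_Mapping.keys f. tdeg m = d)"

definition deg3 :: "nat \<Rightarrow> nat \<Rightarrow> nat \<Rightarrow> fac \<Rightarrow> nat" where
  "deg3 a b c i = (case i of F1 \<Rightarrow> a | F2 \<Rightarrow> b | F3 \<Rightarrow> c)"

definition is_ideal :: "'a::comm_ring_1 set \<Rightarrow> bool" where
  "is_ideal I \<longleftrightarrow> 0 \<in> I \<and> (\<forall>x\<in>I. \<forall>y\<in>I. x + y \<in> I) \<and> (\<forall>r. \<forall>x\<in>I. r * x \<in> I)"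

definition gen_ideal :: "'a::comm_ring_1 set \<Rightarrow> 'a set" where
  "gen_ideal S = \<Inter> {J. is_ideal J \<and> S \<subseteq> J}"

definition prime_ideal :: "'a::comm_ring_1 set \<Rightarrow> bool" where
  "prime_ideal P \<longleftrightarrow> is_ideal P \<and> 1 \<notin> P \<and> (\<forall>x y. x * y \<in> P \<longrightarrow> x \<in> P \<or> y \<in> P)"

definition maximal_ideal :: "'a::comm_ring_1 set \<Rightarrow> bool" where
  "maximal_ideal M \<longleftrightarrow> is_ideal M \<and> 1 \<notin> M \<and>
     (\<forall>J. is_ideal J \<and> 1 \<notin> J \<and> M \<subseteq> J \<longrightarrow> J = M)"

definition regular_seq_mod :: "'a::comm_ring_1 set \<Rightarrow> 'a list \<Rightarrow> bool" where
  "regular_seq_mod I fs \<longleftrightarrow>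
     1 \<notin> gen_ideal (I \<union> set fs) \<and>
     (\<forall>k < length fs. \<forall>g. fs ! k * g \<in> gen_ideal (I \<union> set (take k fs))
                              \<longrightarrow> g \<in> gen_ideal (I \<union> set (take k fs)))"

definition grade :: "'a::comm_ring_1 set \<Rightarrow> 'a set \<Rightarrow> nat" where
  "grade M I = Sup {length fs | fs. set fs \<subseteq> M \<and> regular_seq_mod I fs}"

text \<open>Height of the prime M/I in R/I: maximal length n of a chain of primes
  I \<subseteq> P_0 \<subset> P_1 \<subset> ... \<subset> P_n = M of R.\<close>
definition height_over :: "'a::comm_ring_1 set \<Rightarrow> 'a set \<Rightarrow> nat" where
  "height_over M I = Sup {n. \<exists>P :: nat \<Rightarrow> 'a set.
      (\<forall>i\<le>n. prime_ideal (P i) \<and> I \<subseteq> P i) \<and>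
      (\<forall>i<n. P i \<subset> P (Suc i)) \<and> P n = M}"

text \<open>R/I is Cohen--Macaulay: for every maximal ideal M of R/I (i.e. maximal ideal of R
  containing I), depth (R/I)_M = dim (R/I)_M; here depth (R/I)_M = grade(M, R/I) and
  dim (R/I)_M = height of M/I.\<close>
definition cohen_macaulay_quot :: "'a::comm_ring_1 set \<Rightarrow> bool" where
  "cohen_macaulay_quot I \<longleftrightarrow>
     (\<forall>M. maximal_ideal M \<and> I \<subseteq> M \<longrightarrow> grade M I = height_over M I)"

text \<open>A point is given by representatives: for each factor i a nonzero vector
  (p_{i,0}, p_{i,1}) in K^2.\<close>
type_synonym 'k pt = "fac \<Rightarrow> 'k \<times> 'k"

definition valid_pt :: "'k::zero pt \<Rightarrow> bool" where
  "valid_pt p \<longleftrightarrow> (\<forall>i. p i \<noteq> (0, 0))"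

definition coord :: "'k pt \<Rightarrow> var \<Rightarrow> 'k" where
  "coord p v = (if snd v then snd (p (fst v)) else fst (p (fst v)))"

definition eval :: "'k::comm_ring_1 mpoly \<Rightarrow> 'k pt \<Rightarrow> 'k" where
  "eval f p = (\<Sum>m \<in> Poly_Mapping.keys f.
      Poly_Mapping.lookup f m * (\<Prod>v \<in> Poly_Mapping.keys m. coord p v ^ Poly_Mapping.lookup m v))"

definition vanishing_ideal :: "'k::comm_ring_1 pt set \<Rightarrow> 'k mpoly set" where
  "vanishing_ideal S = gen_ideal {f. (\<exists>d. trihom d f) \<and> (\<forall>p\<in>S. eval f p = 0)}"

text \<open>The line through p along factor k: all points agreeing with p in the two
  factors different from k (zero locus of the two linear forms of degrees e_i, e_j,
  i,j \<noteq> k, vanishing at p).\<close>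
definition line_through :: "'k::zero pt \<Rightarrow> fac \<Rightarrow> 'k pt set" where
  "line_through p k = {q. valid_pt q \<and> (\<forall>i. i \<noteq> k \<longrightarrow> q i = p i)}"

definition grid_ideal :: "'k::comm_ring_1 pt set \<Rightarrow> 'k mpoly set" where
  "grid_ideal C = \<Inter> {vanishing_ideal (line_through p k) | p k. p \<in> C}"

definition complete_intersection :: "'k::comm_ring_1 pt set \<Rightarrow> nat \<Rightarrow> nat \<Rightarrow> nat \<Rightarrow> bool" where
  "complete_intersection C a b c \<longleftrightarrow>
     finite C \<and> (\<forall>p\<in>C. valid_pt p) \<and>
     (\<exists>F1' F2' F3'. trihom (deg3 a 0 0) F1' \<and> trihom (deg3 0 b 0) F2' \<and>
        trihom (deg3 0 0 c) F3' \<and> regular_seq_mod {0} [F1', F2', F3'] \<and>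
        vanishing_ideal C = gen_ideal {F1', F2', F3'})"

definition alg_closed :: "'k::field itself \<Rightarrow> bool" where
  "alg_closed _ \<longleftrightarrow> (\<forall>p :: 'k poly. degree p > 0 \<longrightarrow> (\<exists>x. poly p x = 0))"

text \<open>Shift of the summand indexed by k: (a,b,c) with the k-th entry set to 0; so
  k = F3, F2, F1 give R(-a,-b,0), R(-a,0,-c), R(0,-b,-c).\<close>
definition sdeg :: "nat \<Rightarrow> nat \<Rightarrow> nat \<Rightarrow> fac \<Rightarrow> fac \<Rightarrow> nat" where
  "sdeg a b c k i = (if i = k then 0 else deg3 a b c i)"

text \<open>A trigraded minimal free resolution
  0 -> R(-a,-b,-c)^2 --phi--> (+)_k R(-sdeg k) --psi--> I -> 0 :
  psi sends the k-th basis vector to g k (trihomogeneous of degree sdeg k);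
  phi is the 3x2 matrix m (row k, column l), each entry trihomogeneous of degree
  (a,b,c) - sdeg k; exactness at each spot; minimality: all matrix entries
  lie in the homogeneous maximal ideal (zero constant term).\<close>
definition has_min_resolution :: "'k::comm_ring_1 mpoly set \<Rightarrow> nat \<Rightarrow> nat \<Rightarrow> nat \<Rightarrow> bool" where
  "has_min_resolution I a b c \<longleftrightarrow>
    (\<exists>(g :: fac \<Rightarrow> 'k mpoly) (m :: fac \<Rightarrow> nat \<Rightarrow> 'k mpoly).
       (\<forall>k. trihom (sdeg a b c k) (g k)) \<and>
       (\<forall>k. \<forall>l<2. trihom (\<lambda>i. deg3 a b c i - sdeg a b c k i) (m k l)) \<and>
       (\<forall>k. \<forall>l<2. Poly_Mapping.lookup (m k l) 0 = 0) \<and>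
       gen_ideal (Set.range g) = I \<and>
       (\<forall>u :: fac \<Rightarrow> 'k mpoly. (\<Sum>k\<in>UNIV. u k * g k) = 0 \<longleftrightarrow>
           (\<exists>v :: nat \<Rightarrow> 'k mpoly. \<forall>k. u k = (\<Sum>l<2. m k l * v l))) \<and>
       (\<forall>v :: nat \<Rightarrow> 'k mpoly. (\<forall>k. (\<Sum>l<2. m k l * v l) = 0) \<longrightarrow> (\<forall>l<2. v l = 0)))"

end

theory Submission
  imports Defs "HOL-Library.FuncSet"
begin

text \<open>The normalised coordinates of the points of \<open>C\<close> form finite sets \<open>B\<^sub>1, B\<^sub>2, B\<^sub>3\<close>; a form separating a
  hypothetical missing point of \<open>B\<^sub>1 \<times> B\<^sub>2 \<times> B\<^sub>3\<close> from \<open>C\<close> would lie in the ideal of \<open>C\<close>, whose generators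
  vanish on the whole product, so \<open>C\<close> is this product and \<open>|B\<^sub>i|\<close> is the degree of the \<open>i\<close>-th generator.
  With \<open>F\<^sub>i\<close> the product of the linear forms of the points of \<open>B\<^sub>i\<close>, the ideal of the grid is
  \<open>(F\<^sub>1, F\<^sub>2) \<inter> (F\<^sub>1, F\<^sub>3) \<inter> (F\<^sub>2, F\<^sub>3) = (F\<^sub>1F\<^sub>2, F\<^sub>1F\<^sub>3, F\<^sub>2F\<^sub>3)\<close>, and its syzygies are the Hilbert--Burch ones because
  the \<open>F\<^sub>i\<close> are pairwise coprime.

  For Cohen--Macaulayness, every maximal ideal over the grid ideal contains the regular sequence
  \<open>t\<^sub>1 - \<tau>\<^sub>1, t\<^sub>2 - \<tau>\<^sub>2, t\<^sub>3 - \<tau>\<^sub>3, w - c\<close>, where \<open>t\<^sub>i\<close> is a linear form in the \<open>i\<close>-th factor vanishing at no point of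
  \<open>B\<^sub>i\<close>, \<open>w = x\<^sub>1\<^sub>,\<^sub>1 + x\<^sub>2\<^sub>,\<^sub>1 + x\<^sub>3\<^sub>,\<^sub>1\<close>, and the constants exist by the Nullstellensatz. The same intersection
  formula holds modulo the \<open>t\<^sub>i - \<tau>\<^sub>i\<close>, which reduces regularity to primes generated by affine linear
  polynomials. A regular sequence yields a chain of primes of the same length, and no chain over the
  grid ideal is longer than four, so grade and height are both four.\<close>

section \<open>Ideals and elements regular modulo an ideal\<close>

text \<open>Cohen--Macaulayness is tested at every maximal ideal, not only at the homogeneous one.
  The sections therefore have to pass through arbitrary affine points, which forces inhomogeneous
  linear polynomials whose constants depend on \<open>M\<close>.

  Quotient rings are never formed; all statements are congruences modulo an ideal. Regularity is
  proved by exhibiting points: once products are split into linear factors, every ideal that occurs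
  is the kernel of a substitution, hence prime, and one zero of the ideal at which \<open>f\<close>
  does not vanish makes \<open>f\<close> regular. For this the sections must stay linear. That is
  why \<open>t\<^sub>i\<close> vanishes at no point of \<open>B\<^sub>i\<close>: the line spanned by
  such a point then meets \<open>t\<^sub>i = \<tau>\<^sub>i\<close> exactly once.

  Elements of \<open>C\<close> are representatives, so several of them may describe one point;
  counting needs the normalised coordinates. Characteristic zero enters through the infinity of the
  field, which provides the \<open>t\<^sub>i\<close> and detects nonzero polynomials by their
  values.\<close>

lemma is_ideal_gen_ideal: "is_ideal (gen_ideal S)"
  by (auto simp: is_ideal_def gen_ideal_def)

lemma gen_ideal_superset: "S \<subseteq> gen_ideal S"
  by (auto simp: gen_ideal_def)

lemma gen_ideal_least: "is_ideal J \<Longrightarrow> S \<subseteq> J \<Longrightarrow> gen_ideal S \<subseteq> J"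
  by (auto simp: gen_ideal_def)

lemma gen_ideal_mono: "S \<subseteq> T \<Longrightarrow> gen_ideal S \<subseteq> gen_ideal T"
  by (auto simp: gen_ideal_def)

lemma gen_ideal_eqI: "S \<subseteq> gen_ideal T \<Longrightarrow> T \<subseteq> gen_ideal S \<Longrightarrow> gen_ideal S = gen_ideal T"
  by (simp add: gen_ideal_least is_ideal_gen_ideal subset_antisym)

lemma gen_ideal_ideal: "is_ideal I \<Longrightarrow> gen_ideal I = I"
  by (simp add: gen_ideal_least gen_ideal_superset subset_antisym)

lemma gen_ideal_Un_gen_ideal: "gen_ideal (gen_ideal S \<union> T) = gen_ideal (S \<union> T)"
proof (rule gen_ideal_eqI)
  have "gen_ideal S \<subseteq> gen_ideal (S \<union> T)" by (rule gen_ideal_mono) simp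
  then show "gen_ideal S \<union> T \<subseteq> gen_ideal (S \<union> T)" using gen_ideal_superset[of "S \<union> T"] by auto
  show "S \<union> T \<subseteq> gen_ideal (gen_ideal S \<union> T)"
    using gen_ideal_superset[of "gen_ideal S \<union> T"] gen_ideal_superset[of S] by auto
qed

lemma ideal_zero: "is_ideal I \<Longrightarrow> 0 \<in> I"
  and ideal_add: "is_ideal I \<Longrightarrow> x \<in> I \<Longrightarrow> y \<in> I \<Longrightarrow> x + y \<in> I"
  and ideal_mult: "is_ideal I \<Longrightarrow> x \<in> I \<Longrightarrow> r * x \<in> I"
  and ideal_mult2: "is_ideal I \<Longrightarrow> x \<in> I \<Longrightarrow> x * r \<in> I"
  by (auto simp: is_ideal_def mult.commute[of x r])

lemma ideal_uminus: "is_ideal I \<Longrightarrow> x \<in> I \<Longrightarrow> - x \<in> I"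
  using ideal_mult[of I x "-1"] by simp

lemma ideal_diff: "is_ideal I \<Longrightarrow> x \<in> I \<Longrightarrow> y \<in> I \<Longrightarrow> x - y \<in> I"
  using ideal_add[of I x "-y"] ideal_uminus[of I y] by simp

lemma ideal_sum: "is_ideal I \<Longrightarrow> (\<And>i. i \<in> A \<Longrightarrow> f i \<in> I) \<Longrightarrow> sum f A \<in> I"
  by (induction A rule: infinite_finite_induct) (auto simp: ideal_zero ideal_add)

lemma ideal_cong: "is_ideal I \<Longrightarrow> x - y \<in> I \<Longrightarrow> x \<in> I \<longleftrightarrow> y \<in> I"
  using ideal_add[of I "x - y" y] ideal_diff[of I x "x - y"] by auto

lemma ideal_diff_mult:
  assumes "is_ideal I" "x - x' \<in> I" "y - y' \<in> I"
  shows "x * y - x' * y' \<in> I"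
proof -
  have "x * y - x' * y' = (x - x') * y + x' * (y - y')" by (simp add: algebra_simps)
  then show ?thesis using assms by (simp add: ideal_add ideal_mult ideal_mult2)
qed

lemma ideal_diff_prod:
  assumes "is_ideal I" "\<And>a. a \<in> A \<Longrightarrow> f a - g a \<in> I"
  shows "prod f A - prod g A \<in> I"
  using assms(2)
  by (induction A rule: infinite_finite_induct)
    (auto simp: ideal_zero[OF assms(1)] intro!: ideal_diff_mult[OF assms(1)])

lemma ideal_diff_power: "is_ideal I \<Longrightarrow> x - y \<in> I \<Longrightarrow> x ^ n - y ^ n \<in> I"
  using ideal_diff_prod[of I "{..<n}" "\<lambda>_. x" "\<lambda>_. y"] by simp

lemma gen_ideal_insert:
  "x \<in> gen_ideal (insert p G) \<longleftrightarrow> (\<exists>r. x - r * p \<in> gen_ideal G)"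
proof
  let ?J = "{x. \<exists>r. x - r * p \<in> gen_ideal G}"
  note I = is_ideal_gen_ideal[of G]
  have "is_ideal ?J"
    unfolding is_ideal_def
  proof (intro conjI ballI allI)
    show "0 \<in> ?J" using ideal_zero[OF I] by (auto intro: exI[of _ 0])
  next
    fix x y assume "x \<in> ?J" "y \<in> ?J"
    then obtain r s where "x - r * p \<in> gen_ideal G" "y - s * p \<in> gen_ideal G" by auto
    from ideal_add[OF I this] show "x + y \<in> ?J"
      by (auto intro!: exI[of _ "r + s"] simp: algebra_simps)
  next
    fix t x assume "x \<in> ?J"
    then obtain r where "x - r * p \<in> gen_ideal G" by auto
    from ideal_mult[OF I this, of t] show "t * x \<in> ?J"
      by (auto intro!: exI[of _ "t * r"] simp: algebra_simps)
  qed
  moreover have "p - 1 * p \<in> gen_ideal G" using ideal_zero[OF I] by simp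
  moreover have "x - 0 * p \<in> gen_ideal G" if "x \<in> G" for x
    using gen_ideal_superset[of G] that by auto
  ultimately have "is_ideal ?J" "insert p G \<subseteq> ?J" by blast+
  then have "gen_ideal (insert p G) \<subseteq> ?J" by (rule gen_ideal_least)
  then show "x \<in> gen_ideal (insert p G) \<Longrightarrow> \<exists>r. x - r * p \<in> gen_ideal G" by auto
next
  assume "\<exists>r. x - r * p \<in> gen_ideal G"
  then obtain r where "x - r * p \<in> gen_ideal (insert p G)"
    using gen_ideal_mono[of G "insert p G"] by auto
  moreover have "r * p \<in> gen_ideal (insert p G)"
    using gen_ideal_superset[of "insert p G"] by (simp add: ideal_mult is_ideal_gen_ideal)
  ultimately show "x \<in> gen_ideal (insert p G)"
    using ideal_cong[OF is_ideal_gen_ideal] by blast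
qed

lemma gen_ideal_empty [simp]: "gen_ideal {} = {0}"
  using gen_ideal_ideal[of "{0}"] gen_ideal_eqI[of "{}" "{0}"] ideal_zero[OF is_ideal_gen_ideal]
  by (auto simp: is_ideal_def)

lemma gen_ideal_insert_0 [simp]: "gen_ideal (insert 0 G) = gen_ideal G"
  by (auto simp: gen_ideal_insert)

lemma in_gen_ideal: "x \<in> S \<Longrightarrow> x \<in> gen_ideal S"
  using gen_ideal_superset by blast

section \<open>Nonzerodivisors modulo an ideal, and ideals generated by products\<close>

definition nzd_mod :: "'a::comm_ring_1 set \<Rightarrow> 'a \<Rightarrow> bool" where
  "nzd_mod J p \<longleftrightarrow> (\<forall>h. p * h \<in> J \<longrightarrow> h \<in> J)"

lemma nzd_mod_mult: "nzd_mod J p \<Longrightarrow> nzd_mod J q \<Longrightarrow> nzd_mod J (p * q)"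
  unfolding nzd_mod_def by (metis mult.assoc)

lemma nzd_modD: "nzd_mod J p \<Longrightarrow> p * h \<in> J \<Longrightarrow> h \<in> J"
  by (simp add: nzd_mod_def)

lemma nzd_mod_prod: "(\<And>s. s \<in> S \<Longrightarrow> nzd_mod J (l s)) \<Longrightarrow> nzd_mod J (prod l S)"
  by (induction S rule: infinite_finite_induct)
    (simp_all add: nzd_mod_mult, simp_all add: nzd_mod_def)

text \<open>As \<open>l\<close> is regular modulo \<open>G\<close>, multiplication by
  \<open>l\<close> embeds R/(m, G) into R/(l m, G) with cokernel R/(l, G). An element regular on
  both ends of a short exact sequence is regular in the middle.\<close>

lemma nzd_mod_insert_mult:
  assumes "nzd_mod (gen_ideal (insert l G)) p" "nzd_mod (gen_ideal (insert m G)) p"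
    and l: "nzd_mod (gen_ideal G) l"
  shows "nzd_mod (gen_ideal (insert (l * m) G)) p"
  unfolding nzd_mod_def
proof (intro allI impI)
  note I = is_ideal_gen_ideal[of G]
  fix h assume "p * h \<in> gen_ideal (insert (l * m) G)"
  then obtain k where k: "p * h - k * (l * m) \<in> gen_ideal G" by (auto simp: gen_ideal_insert)
  then have "p * h - (k * m) * l \<in> gen_ideal G" by (simp add: algebra_simps)
  then have "p * h \<in> gen_ideal (insert l G)" by (auto simp: gen_ideal_insert)
  then have "h \<in> gen_ideal (insert l G)" using nzd_modD[OF assms(1)] by blast
  then obtain h' where h': "h - h' * l \<in> gen_ideal G" by (auto simp: gen_ideal_insert)
  have "(p * h - k * (l * m)) - p * (h - h' * l) \<in> gen_ideal G"
    using k h' I by (simp add: ideal_diff ideal_mult)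
  then have "l * (p * h' - k * m) \<in> gen_ideal G" by (simp add: algebra_simps)
  then have "p * h' - k * m \<in> gen_ideal G" using nzd_modD[OF l] by blast
  then have "p * h' \<in> gen_ideal (insert m G)" by (auto simp: gen_ideal_insert)
  then have "h' \<in> gen_ideal (insert m G)" using nzd_modD[OF assms(2)] by blast
  then obtain s where "h' - s * m \<in> gen_ideal G" by (auto simp: gen_ideal_insert)
  then have "(h - h' * l) + l * (h' - s * m) \<in> gen_ideal G"
    using h' I by (simp add: ideal_add ideal_mult)
  then have "h - s * (l * m) \<in> gen_ideal G" by (simp add: algebra_simps)
  then show "h \<in> gen_ideal (insert (l * m) G)" by (auto simp: gen_ideal_insert)
qed

lemma gen_ideal_insert_1: "gen_ideal (insert 1 G) = UNIV"
proof -
  have "x - x * 1 \<in> gen_ideal G" for x by (simp add: ideal_zero is_ideal_gen_ideal)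
  then show ?thesis unfolding gen_ideal_insert[abs_def] set_eq_iff by blast
qed

lemma nzd_mod_insert_prod:
  assumes "\<And>s. s \<in> S \<Longrightarrow> nzd_mod (gen_ideal (insert (l s) G)) p"
    and "\<And>s. s \<in> S \<Longrightarrow> nzd_mod (gen_ideal G) (l s)"
  shows "nzd_mod (gen_ideal (insert (prod l S) G)) p"
  using assms
proof (induction S rule: infinite_finite_induct)
  case (insert s S)
  then show ?case by (simp add: nzd_mod_insert_mult)
qed (auto simp: gen_ideal_insert_1 nzd_mod_def)

text \<open>If \<open>x = r * prod l S\<close> modulo \<open>G\<close> and \<open>x\<close> also
  lies in \<open>(l s, G)\<close>, the factors in \<open>S\<close> are regular modulo
  \<open>(l s, G)\<close> and cancel, so \<open>l s\<close> divides \<open>r\<close> modulo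
  \<open>G\<close>.\<close>

lemma in_gen_ideal_insert_prod:
  assumes "finite S" "\<And>s t. s \<in> S \<Longrightarrow> t \<in> S \<Longrightarrow> s \<noteq> t \<Longrightarrow> nzd_mod (gen_ideal (insert (l s) G)) (l t)"
    and "\<And>s. s \<in> S \<Longrightarrow> x \<in> gen_ideal (insert (l s) G)"
  shows "x \<in> gen_ideal (insert (prod l S) G)"
  using assms
proof (induction S)
  case empty
  then show ?case by (simp add: gen_ideal_insert_1)
next
  case (insert s S)
  note I = is_ideal_gen_ideal
  have "x \<in> gen_ideal (insert (prod l S) G)" using insert by auto
  then obtain r where r: "x - r * prod l S \<in> gen_ideal G" by (auto simp: gen_ideal_insert)
  moreover have "x \<in> gen_ideal (insert (l s) G)" using insert by auto
  ultimately have "prod l S * r \<in> gen_ideal (insert (l s) G)"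
    using gen_ideal_mono[of G "insert (l s) G"] ideal_cong[OF I] by (auto simp: mult.commute)
  moreover have "nzd_mod (gen_ideal (insert (l s) G)) (prod l S)"
    using insert.prems insert.hyps by (intro nzd_mod_prod) auto
  ultimately have "r \<in> gen_ideal (insert (l s) G)" using nzd_modD by blast
  then obtain t where "r - t * l s \<in> gen_ideal G" by (auto simp: gen_ideal_insert)
  then have "(x - r * prod l S) + prod l S * (r - t * l s) \<in> gen_ideal G"
    using r by (simp add: ideal_add ideal_mult is_ideal_gen_ideal)
  then have "x - t * (l s * prod l S) \<in> gen_ideal G" by (simp add: algebra_simps)
  then show ?case using insert.hyps by (auto simp: gen_ideal_insert)
qed

text \<open>The inclusion from right to left carries the content. Modulo \<open>G\<close>, write
  \<open>x = a f + b g\<close>; since \<open>x\<close> is in \<open>(f, h)\<close> and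
  \<open>g\<close> is regular there, \<open>b\<close> is in \<open>(f, h)\<close>. This turns
  \<open>b g\<close> into a multiple of \<open>g h\<close> up to multiples of \<open>f\<close>, and
  the same argument modulo \<open>(g, h)\<close> treats the new coefficient of
  \<open>f\<close>.\<close>

lemma gen_ideal_pairs_inter:
  assumes "nzd_mod (gen_ideal ({f, h} \<union> G)) g" "nzd_mod (gen_ideal ({g, h} \<union> G)) f"
  shows "gen_ideal ({f * g, f * h, g * h} \<union> G) =
    gen_ideal ({f, g} \<union> G) \<inter> gen_ideal ({f, h} \<union> G) \<inter> gen_ideal ({g, h} \<union> G)" (is "?L = ?R")
proof
  note I = is_ideal_gen_ideal
  have *: "p * q \<in> gen_ideal S \<and> q * p \<in> gen_ideal S" if "p \<in> S" for p q and S :: "'a set"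
    using that by (simp add: in_gen_ideal ideal_mult ideal_mult2 is_ideal_gen_ideal)
  have "{f * g, f * h, g * h} \<union> G \<subseteq> ?R"
    using * gen_ideal_superset[of "{f, g} \<union> G"] gen_ideal_superset[of "{f, h} \<union> G"]
      gen_ideal_superset[of "{g, h} \<union> G"] by auto
  moreover have "is_ideal ?R" using I[of "{f, g} \<union> G"] I[of "{f, h} \<union> G"] I[of "{g, h} \<union> G"]
    unfolding is_ideal_def by blast
  ultimately show "?L \<subseteq> ?R" by (rule gen_ideal_least[rotated])
  show "?R \<subseteq> ?L"
  proof
    fix x assume x: "x \<in> ?R"
    then obtain a b where ab: "x - a * f - b * g \<in> gen_ideal G"
      by (auto simp: gen_ideal_insert)
    have sub: "gen_ideal G \<subseteq> gen_ideal ({p, q} \<union> G)" for p q by (rule gen_ideal_mono) auto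
    have "x - (x - a * f - b * g) - a * f \<in> gen_ideal ({f, h} \<union> G)"
      by (rule ideal_diff[OF I ideal_diff[OF I] ideal_mult[OF I]])
        (use x subsetD[OF sub ab] in \<open>simp_all add: in_gen_ideal\<close>)
    then have "g * b \<in> gen_ideal ({f, h} \<union> G)" by (simp add: algebra_simps)
    then have "b \<in> gen_ideal ({f, h} \<union> G)" using nzd_modD[OF assms(1)] by blast
    then obtain c d where cd: "b - c * f - d * h \<in> gen_ideal G" by (auto simp: gen_ideal_insert)
    have "(x - a * f - b * g) + g * (b - c * f - d * h) \<in> gen_ideal G"
      using ab cd by (intro ideal_add[OF I] ideal_mult[OF I])
    then have e: "x - (a + c * g) * f - d * (g * h) \<in> gen_ideal G" by (simp add: algebra_simps)
    have "x - (x - (a + c * g) * f - d * (g * h)) - (d * g) * h \<in> gen_ideal ({g, h} \<union> G)"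
      by (rule ideal_diff[OF I ideal_diff[OF I] ideal_mult[OF I]])
        (use x subsetD[OF sub e] in \<open>simp_all add: in_gen_ideal\<close>)
    then have "f * (a + c * g) \<in> gen_ideal ({g, h} \<union> G)" by (simp add: algebra_simps)
    then have "a + c * g \<in> gen_ideal ({g, h} \<union> G)" using nzd_modD[OF assms(2)] by blast
    then obtain k l where kl: "a + c * g - k * g - l * h \<in> gen_ideal G" by (auto simp: gen_ideal_insert)
    have "(x - (a + c * g) * f - d * (g * h)) + f * (a + c * g - k * g - l * h) \<in> gen_ideal G"
      using e kl by (intro ideal_add[OF I] ideal_mult[OF I])
    then have "x - k * (f * g) - l * (f * h) - d * (g * h) \<in> gen_ideal G" by (simp add: algebra_simps)
    then show "x \<in> ?L" by (auto simp: gen_ideal_insert)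
  qed
qed

section \<open>Primes, chains of primes and regular sequences\<close>

text \<open>Zorn's lemma gives an ideal maximal among those containing \<open>I\<close> and missing
  the multiplicative set \<open>S\<close>; maximality makes it prime.\<close>

lemma prime_ideal_avoiding:
  assumes "is_ideal I" "I \<inter> S = {}" "1 \<in> S" "\<And>x y. x \<in> S \<Longrightarrow> y \<in> S \<Longrightarrow> x * y \<in> S"
  obtains P where "prime_ideal P" "I \<subseteq> P" "P \<inter> S = {}"
proof -
  let ?A = "{J. is_ideal J \<and> I \<subseteq> J \<and> J \<inter> S = {}}"
  have "\<exists>M\<in>?A. \<forall>X\<in>?A. M \<subseteq> X \<longrightarrow> X = M"
  proof (rule subset_Zorn_nonempty)
    show "?A \<noteq> {}" using assms by auto
  next
    fix C assume C: "C \<noteq> {}" "subset.chain ?A C"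
    have CA: "C \<subseteq> ?A" and tot: "\<And>X Y. X \<in> C \<Longrightarrow> Y \<in> C \<Longrightarrow> X \<subseteq> Y \<or> Y \<subseteq> X"
      using C(2) by (auto simp: subset_chain_def)
    have id: "is_ideal X" if "X \<in> C" for X using CA that by auto
    have "is_ideal (\<Union> C)"
      unfolding is_ideal_def
    proof (intro conjI ballI allI)
      show "0 \<in> \<Union> C" using C(1) id ideal_zero by blast
    next
      fix x y assume "x \<in> \<Union> C" "y \<in> \<Union> C"
      then obtain X Y where XY: "X \<in> C" "Y \<in> C" "x \<in> X" "y \<in> Y" by auto
      with tot[of X Y] show "x + y \<in> \<Union> C" using id ideal_add by blast
    next
      fix r x assume "x \<in> \<Union> C"
      then show "r * x \<in> \<Union> C" using id ideal_mult by blast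
    qed
    then show "\<Union> C \<in> ?A" using CA C(1) by blast
  qed
  then obtain M where M: "is_ideal M" "I \<subseteq> M" "M \<inter> S = {}"
    and max: "\<And>X. is_ideal X \<Longrightarrow> X \<inter> S = {} \<Longrightarrow> M \<subseteq> X \<Longrightarrow> X = M"
    by (smt (verit) mem_Collect_eq order_trans)
  \<comment> \<open>Enlarging \<open>M\<close> by \<open>x\<close> must hit \<open>S\<close>. If
    \<open>x * y\<close> were in \<open>M\<close> with both factors outside, the product of the two
    hits would lie in \<open>S\<close> and in \<open>M\<close>.\<close>
  have meets: "\<exists>s\<in>S. \<exists>r. s - r * x \<in> M" if "x \<notin> M" for x
  proof -
    have "M \<subseteq> gen_ideal (insert x M)" "x \<in> gen_ideal (insert x M)"
      using gen_ideal_superset[of "insert x M"] by auto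
    then have "gen_ideal (insert x M) \<inter> S \<noteq> {}"
      using max[of "gen_ideal (insert x M)"] that is_ideal_gen_ideal[of "insert x M"] by auto
    then show ?thesis using M(1) by (auto simp: gen_ideal_insert gen_ideal_ideal)
  qed
  have "prime_ideal M"
    unfolding prime_ideal_def
  proof (intro conjI allI impI)
    show "is_ideal M" "1 \<notin> M" using M assms(3) by auto
    fix x y assume xy: "x * y \<in> M"
    show "x \<in> M \<or> y \<in> M"
    proof (rule ccontr)
      assume "\<not> (x \<in> M \<or> y \<in> M)"
      then obtain s r s' r' where s: "s \<in> S" "s - r * x \<in> M" "s' \<in> S" "s' - r' * y \<in> M"
        using meets by meson
      then have "s * s' - (r * x) * (r' * y) \<in> M" using ideal_diff_mult[OF M(1)] by blast
      moreover have "(r * x) * (r' * y) = (r * r') * (x * y)" by (simp add: algebra_simps)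
      ultimately have "s * s' \<in> M" using xy ideal_cong[OF M(1)] ideal_mult[OF M(1)] by metis
      then show False using s assms(4) M(3) by auto
    qed
  qed
  then show ?thesis using that M by blast
qed

lemma maximal_imp_prime_ideal:
  assumes "maximal_ideal M"
  shows "prime_ideal M"
proof -
  have "is_ideal M" "M \<inter> {1} = {}" using assms by (auto simp: maximal_ideal_def)
  then obtain P where P: "prime_ideal P" "M \<subseteq> P" "P \<inter> {1} = {}"
    using prime_ideal_avoiding[of M "{1}"] by auto
  then have "P = M" using assms by (auto simp: maximal_ideal_def prime_ideal_def)
  then show ?thesis using P by simp
qed

lemma maximal_ideal_inverse:
  assumes "maximal_ideal M" "x \<notin> M"
  obtains r where "x * r - 1 \<in> M"
proof -
  have M: "is_ideal M" using assms by (auto simp: maximal_ideal_def)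
  have "M \<subseteq> gen_ideal (insert x M)" "x \<in> gen_ideal (insert x M)"
    using gen_ideal_superset[of "insert x M"] by auto
  then have "1 \<in> gen_ideal (insert x M)"
    using assms is_ideal_gen_ideal[of "insert x M"] by (auto simp: maximal_ideal_def)
  then obtain r where "1 - r * x \<in> M" using M by (auto simp: gen_ideal_insert gen_ideal_ideal)
  then have "x * r - 1 \<in> M" using ideal_uminus[OF M] by (fastforce simp: mult.commute)
  then show ?thesis using that by blast
qed

text \<open>A nonzerodivisor modulo \<open>I\<close> avoids every
  prime minimal over \<open>I\<close>, so each element of a regular sequence makes room for one more prime
  below the chain obtained for the rest of the sequence.\<close>

lemma regular_sequence_imp_prime_chain:
  assumes "prime_ideal M" "is_ideal I" "I \<subseteq> M" "set fs \<subseteq> M"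
    and "\<And>k. k < length fs \<Longrightarrow> nzd_mod (gen_ideal (I \<union> set (take k fs))) (fs ! k)"
  shows "\<exists>P :: nat \<Rightarrow> 'a::comm_ring_1 set.
      (\<forall>i\<le>length fs. prime_ideal (P i) \<and> I \<subseteq> P i) \<and>
      (\<forall>i<length fs. P i \<subset> P (Suc i)) \<and> P (length fs) = M"
  using assms(2-)
proof (induction fs arbitrary: I)
  case Nil
  then show ?case using assms(1) by (intro exI[of _ "\<lambda>_. M"]) auto
next
  case (Cons f fs)
  let ?J = "gen_ideal (insert f I)"
  have M: "is_ideal M" using assms(1) by (auto simp: prime_ideal_def)
  have "?J \<subseteq> M" using Cons.prems by (intro gen_ideal_least M) auto
  moreover have "nzd_mod (gen_ideal (?J \<union> set (take k fs))) (fs ! k)" if "k < length fs" for k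
    using Cons.prems(4)[of "Suc k"] that by (simp add: gen_ideal_Un_gen_ideal)
  ultimately obtain P where P: "\<And>i. i \<le> length fs \<Longrightarrow> prime_ideal (P i) \<and> ?J \<subseteq> P i"
    "\<And>i. i < length fs \<Longrightarrow> P i \<subset> P (Suc i)" "P (length fs) = M"
    using Cons.IH[of ?J] Cons.prems is_ideal_gen_ideal by force
  have P0: "is_ideal (P 0)" "\<And>x y. x * y \<in> P 0 \<Longrightarrow> x \<in> P 0 \<or> y \<in> P 0" "1 \<notin> P 0" "?J \<subseteq> P 0"
    using P(1)[of 0] by (auto simp: prime_ideal_def)
  have IJ: "I \<subseteq> ?J" "f \<in> ?J" using gen_ideal_superset[of "insert f I"] by auto
  \<comment> \<open>This multiplicative set contains \<open>f\<close> and the complement of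
    \<open>P 0\<close>, so a prime avoiding it lies inside \<open>P 0\<close> and misses
    \<open>f\<close>, hence is strictly smaller. The set misses \<open>I\<close> because powers of
    \<open>f\<close> cancel modulo \<open>I\<close>, and \<open>I\<close> lies in
    \<open>P 0\<close>.\<close>
  let ?S = "{s * f ^ n | s n. s \<notin> P 0}"
  have f: "nzd_mod I f" using Cons.prems(4)[of 0] Cons.prems(1) by (simp add: gen_ideal_ideal)
  have "s \<in> I" if "s * f ^ n \<in> I" for s n
    using that by (induction n) (simp, metis nzd_modD[OF f] mult.left_commute power_Suc)
  then have disj: "I \<inter> ?S = {}" using P0(4) IJ by blast
  have "1 = 1 * f ^ 0" "f = 1 * f ^ 1" by simp_all
  then have one: "1 \<in> ?S" and f_in: "f \<in> ?S" using P0(3) by blast+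
  have "x * y \<in> ?S" if xy: "x \<in> ?S" "y \<in> ?S" for x y
  proof -
    from xy obtain s n t m where "x = s * f ^ n" "y = t * f ^ m" "s \<notin> P 0" "t \<notin> P 0" by auto
    then have "x * y = (s * t) * f ^ (n + m)" "s * t \<notin> P 0"
      using P0(2) by (auto simp: power_add algebra_simps)
    then show ?thesis by blast
  qed
  with disj one obtain Q where Q: "prime_ideal Q" "I \<subseteq> Q" "Q \<inter> ?S = {}"
    using prime_ideal_avoiding[OF Cons.prems(1), of ?S] by blast
  have "x \<in> P 0" if "x \<in> Q" for x
  proof (rule ccontr)
    assume "x \<notin> P 0"
    moreover have "x = x * f ^ 0" by simp
    ultimately have "x \<in> ?S" by blast
    then show False using that Q(3) by blast
  qed
  then have QP: "Q \<subset> P 0" using Q(3) f_in IJ P0(4) by blast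
  show ?case
  proof (intro exI[of _ "case_nat Q P"] conjI allI impI)
    fix i
    show "prime_ideal (case_nat Q P i)" "I \<subseteq> case_nat Q P i" if "i \<le> length (f # fs)"
      using that Q P(1) IJ(1) by (cases i; force)+
    show "case_nat Q P i \<subset> case_nat Q P (Suc i)" if "i < length (f # fs)"
      using that QP P(2) by (auto split: nat.split)
    show "case_nat Q P (length (f # fs)) = M" using P(3) by simp
  qed
qed

section \<open>Zariski's lemma\<close>

text \<open>Subrings are sets inside one ambient ring, because the variables are adjoined one by one
  in a fold.\<close>

definition polys_over :: "'a::comm_ring_1 set \<Rightarrow> 'a poly set" where
  "polys_over A = {p. \<forall>i. coeff p i \<in> A}"

definition adjoin :: "'a::comm_ring_1 set \<Rightarrow> 'a \<Rightarrow> 'a set" where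
  "adjoin A y = (\<lambda>p. poly p y) ` polys_over A"

definition is_subring :: "'a::comm_ring_1 set \<Rightarrow> bool" where
  "is_subring A \<longleftrightarrow> 1 \<in> A \<and> (\<forall>x\<in>A. \<forall>y\<in>A. x - y \<in> A \<and> x * y \<in> A)"

text \<open>The image of \<open>A\<close> in the domain \<open>R/M\<close> is a G-domain: it becomes a field after inverting one
  nonzero element.\<close>

definition g_domain_mod :: "'a::comm_ring_1 set \<Rightarrow> 'a set \<Rightarrow> bool" where
  "g_domain_mod M A \<longleftrightarrow>
     (\<exists>u\<in>A. u \<notin> M \<and> (\<forall>f\<in>A. f \<notin> M \<longrightarrow> (\<exists>g\<in>A. \<exists>n. f * g - u ^ n \<in> M)))"

context
  fixes A :: "'a::comm_ring_1 set"
  assumes A: "is_subring A"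
begin

lemma subring_1: "1 \<in> A"
  and subring_diff: "x \<in> A \<Longrightarrow> y \<in> A \<Longrightarrow> x - y \<in> A"
  and subring_mult: "x \<in> A \<Longrightarrow> y \<in> A \<Longrightarrow> x * y \<in> A"
  using A by (auto simp: is_subring_def)

lemma subring_0: "0 \<in> A"
  using subring_diff[OF subring_1 subring_1] by simp

lemma subring_add: "x \<in> A \<Longrightarrow> y \<in> A \<Longrightarrow> x + y \<in> A"
  using subring_diff[of x "0 - y"] subring_diff[OF subring_0, of y] by simp

lemma subring_sum: "(\<And>i. i \<in> S \<Longrightarrow> f i \<in> A) \<Longrightarrow> sum f S \<in> A"
  by (induction S rule: infinite_finite_induct) (auto simp: subring_0 subring_add)

lemma subring_power: "x \<in> A \<Longrightarrow> x ^ n \<in> A"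
  by (induction n) (auto simp: subring_1 subring_mult)

lemma polys_over_diff: "p \<in> polys_over A \<Longrightarrow> q \<in> polys_over A \<Longrightarrow> p - q \<in> polys_over A"
  and polys_over_add: "p \<in> polys_over A \<Longrightarrow> q \<in> polys_over A \<Longrightarrow> p + q \<in> polys_over A"
  and polys_over_mult: "p \<in> polys_over A \<Longrightarrow> q \<in> polys_over A \<Longrightarrow> p * q \<in> polys_over A"
  and polys_over_smult: "a \<in> A \<Longrightarrow> p \<in> polys_over A \<Longrightarrow> smult a p \<in> polys_over A"
  and polys_over_monom: "a \<in> A \<Longrightarrow> monom a n \<in> polys_over A"
  and polys_over_0: "0 \<in> polys_over A"
  and polys_over_1: "1 \<in> polys_over A"
  by (auto simp: polys_over_def subring_diff subring_add subring_mult subring_0 subring_1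
      coeff_mult subring_sum)

lemma polys_over_const: "a \<in> A \<Longrightarrow> [:a:] \<in> polys_over A"
  using polys_over_monom[of a 0] by (simp add: monom_0)

lemma is_subring_adjoin: "is_subring (adjoin A y)"
  unfolding is_subring_def adjoin_def
proof (intro conjI ballI)
  show "1 \<in> (\<lambda>p. poly p y) ` polys_over A" using polys_over_1 by (auto intro!: image_eqI[of _ _ 1])
  fix a b assume "a \<in> (\<lambda>p. poly p y) ` polys_over A" "b \<in> (\<lambda>p. poly p y) ` polys_over A"
  then obtain p q where "a = poly p y" "b = poly q y" "p \<in> polys_over A" "q \<in> polys_over A" by auto
  then show "a - b \<in> (\<lambda>p. poly p y) ` polys_over A" "a * b \<in> (\<lambda>p. poly p y) ` polys_over A"
    using polys_over_diff[of p q] polys_over_mult[of p q]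
    by (metis image_eqI poly_diff, metis image_eqI poly_mult)
qed

lemma subring_subset_adjoin: "A \<subseteq> adjoin A y"
  using polys_over_const by (auto simp: adjoin_def intro!: image_eqI[of _ _ "[:_:]"])

lemma generator_in_adjoin: "y \<in> adjoin A y"
  using polys_over_monom[OF subring_1, of 1]
  by (auto simp: adjoin_def poly_monom intro!: image_eqI[of _ _ "monom 1 1"])

text \<open>The leading coefficient is not a unit, hence the power \<open>N\<close>; the ring need
  not be a domain, hence inequalities between degrees. The bound on \<open>degree q\<close> later
  keeps a quotient below the least degree of an algebraic relation.\<close>

lemma pseudo_division_over:
  assumes g: "g \<in> polys_over A" "degree g = e" "e > 0" and f: "f \<in> polys_over A" "degree f \<le> n"
  shows "\<exists>N q r. q \<in> polys_over A \<and> r \<in> polys_over A \<and>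
    smult (lead_coeff g ^ N) f = q * g + r \<and> degree r < e \<and> degree q \<le> n - e"
  using f
proof (induction n arbitrary: f)
  case 0
  then show ?case using g(3) polys_over_0
    by (intro exI[of _ 0] exI[of _ 0] exI[of _ f]) auto
next
  case (Suc n)
  show ?case
  proof (cases "degree f < e")
    case True
    then show ?thesis using Suc.prems polys_over_0
      by (intro exI[of _ 0] exI[of _ 0] exI[of _ f]) auto
  next
    case False
    let ?l = "lead_coeff g"
    have l: "?l \<in> A" and a: "coeff f (Suc n) \<in> A" using g(1) Suc.prems(1) by (auto simp: polys_over_def)
    show ?thesis
    proof (cases "e \<le> Suc n")
      case eS: True
      let ?m = "monom (coeff f (Suc n)) (Suc n - e)"
      let ?h = "smult ?l f - ?m * g"
      have hA: "?h \<in> polys_over A"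
        using l a Suc.prems(1) g(1) by (intro polys_over_diff polys_over_smult polys_over_mult polys_over_monom)
      have "degree ?h \<le> Suc n"
      proof (rule degree_diff_le)
        show "degree (smult ?l f) \<le> Suc n" using Suc.prems(2) degree_smult_le order_trans by blast
        show "degree (?m * g) \<le> Suc n"
          using degree_mult_le[of ?m g] degree_monom_le[of "coeff f (Suc n)" "Suc n - e"] g(2) eS by linarith
      qed
      moreover have "coeff ?h (Suc n) = 0"
        using eS g(2) by (simp add: coeff_monom_mult)
      ultimately have "degree ?h \<le> n"
        by (metis degree_0 le_Suc_eq leading_coeff_0_iff zero_le)
      then obtain N q r where q: "q \<in> polys_over A" "r \<in> polys_over A" "smult (?l ^ N) ?h = q * g + r"
        "degree r < e" "degree q \<le> n - e" using Suc.IH[OF hA] by blast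
      have "smult (?l ^ Suc N) f = smult (?l ^ N) ?h + smult (?l ^ N) (?m * g)"
        by (simp add: smult_diff_right mult.commute)
      also have "\<dots> = (q + smult (?l ^ N) ?m) * g + r" using q(3) by (simp add: algebra_simps)
      finally have "smult (?l ^ Suc N) f = (q + smult (?l ^ N) ?m) * g + r" .
      moreover have "q + smult (?l ^ N) ?m \<in> polys_over A"
        using q(1) l a by (intro polys_over_add polys_over_smult polys_over_monom subring_power)
      moreover have "degree (q + smult (?l ^ N) ?m) \<le> Suc n - e"
      proof (rule degree_add_le)
        show "degree q \<le> Suc n - e" using q(5) by linarith
        show "degree (smult (?l ^ N) ?m) \<le> Suc n - e"
          using degree_smult_le[of "?l ^ N" ?m] degree_monom_le[of "coeff f (Suc n)" "Suc n - e"] by linarith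
      qed
      ultimately show ?thesis using q(2,4) by blast
    next
      case False
      then show ?thesis using Suc.prems \<open>\<not> degree f < e\<close> by linarith
    qed
  qed
qed

section \<open>Descent of the G-domain property from \<open>A[y]\<close> to \<open>A\<close>\<close>

context
  fixes M :: "'a set"
  assumes M: "prime_ideal M"
begin

lemma prime_is_ideal: "is_ideal M"
  and prime_mult: "x * y \<in> M \<Longrightarrow> x \<in> M \<or> y \<in> M"
  and prime_1: "1 \<notin> M"
  using M by (auto simp: prime_ideal_def)

lemma prime_power: "x ^ n \<in> M \<Longrightarrow> x \<in> M"
  by (induction n) (auto simp: prime_1 dest: prime_mult)

lemma poly_in_ideal: "(\<And>i. coeff p i \<in> M) \<Longrightarrow> poly p y \<in> M"
  by (auto simp: poly_altdef intro!: ideal_sum[OF prime_is_ideal] ideal_mult2[OF prime_is_ideal])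

lemma coeff_mult_in_ideal: "(\<And>i. coeff p i \<in> M) \<Longrightarrow> coeff (p * q) i \<in> M"
  by (auto simp: coeff_mult intro!: ideal_sum[OF prime_is_ideal] ideal_mult2[OF prime_is_ideal])

text \<open>If no nonzero polynomial over \<open>A\<close> vanished at \<open>y\<close>, then \<open>A[y]\<close> would be a polynomial ring, and
  \<open>1 + y u\<close>, being prime to \<open>u\<close>, would be a nonconstant unit.\<close>

lemma g_domain_adjoin_imp_algebraic:
  assumes "g_domain_mod M (adjoin A y)"
  shows "\<exists>p \<in> polys_over A. poly p y \<in> M \<and> (\<exists>i. coeff p i \<notin> M)"
proof (rule ccontr)
  note I = prime_is_ideal
  assume "\<not> ?thesis"
  then have tr: "coeff p i \<in> M" if "p \<in> polys_over A" "poly p y \<in> M" for p i using that by blast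
  obtain u where u: "u \<in> adjoin A y" "u \<notin> M"
    and inv: "\<And>f. f \<in> adjoin A y \<Longrightarrow> f \<notin> M \<Longrightarrow> \<exists>g\<in>adjoin A y. \<exists>n. f * g - u ^ n \<in> M"
    using assms by (auto simp: g_domain_mod_def)
  obtain U where U: "U \<in> polys_over A" "u = poly U y" using u by (auto simp: adjoin_def)
  \<comment> \<open>Modulo \<open>F\<close> the product of the variable and \<open>U\<close> is -1,
    so \<open>u\<close> is a unit modulo \<open>poly F y\<close>.\<close>
  define F where "F = 1 + monom 1 1 * U"
  have F: "F \<in> polys_over A"
    using U unfolding F_def by (intro polys_over_add polys_over_1 polys_over_mult polys_over_monom subring_1)
  have "coeff F 0 = 1" by (simp add: F_def coeff_monom_mult)
  then have "poly F y \<notin> M" using tr[OF F] prime_1 by metis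
  then obtain g n where g: "g \<in> adjoin A y" "poly F y * g - u ^ n \<in> M"
    using inv[of "poly F y"] F by (auto simp: adjoin_def)
  then obtain G where G: "G \<in> polys_over A" "g = poly G y" by (auto simp: adjoin_def)
  have yA: "monom 1 1 ^ k \<in> polys_over A" "U ^ k \<in> polys_over A" "F ^ k \<in> polys_over A" for k
    by (induction k) (auto simp: polys_over_1 polys_over_mult polys_over_monom subring_1 U F)
  \<comment> \<open>\<open>F - 1\<close> is -1 modulo \<open>F\<close>. Multiplying the relation
    \<open>F g = u ^ n\<close> by \<open>y ^ n\<close> then turns it into one of the form
    \<open>F K = (-1) ^ n\<close>.\<close>
  have "\<exists>H. H \<in> polys_over A \<and> (F - 1) ^ k = F * H + (-1) ^ k" for k
  proof (induction k)
    case 0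
    then show ?case using polys_over_0 by (intro exI[of _ 0]) auto
  next
    case (Suc k)
    then obtain H where H: "H \<in> polys_over A" "(F - 1) ^ k = F * H + (-1) ^ k" by blast
    have m: "(- 1 :: 'a poly) ^ j \<in> polys_over A" for j
      by (induction j) (auto simp: polys_over_1 intro!: polys_over_diff[OF polys_over_0, simplified])
    have "(F - 1) ^ Suc k = F * ((F - 1) * H + (-1) ^ k) + (-1) ^ Suc k"
      using H(2) by (simp add: algebra_simps)
    then show ?case using H(1) m F by (intro exI[of _ "(F - 1) * H + (-1) ^ k"])
        (auto intro!: polys_over_add polys_over_mult polys_over_diff polys_over_1)
  qed
  then obtain H where H: "H \<in> polys_over A" "(F - 1) ^ n = F * H + (-1) ^ n" by blast
  have "F - 1 = monom 1 1 * U" by (simp add: F_def)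
  then have eq: "(monom 1 1 * U) ^ n = F * H + (-1) ^ n" using H(2) by simp
  define K where "K = monom 1 1 ^ n * G - H"
  have K: "K \<in> polys_over A"
    using yA G H unfolding K_def by (intro polys_over_diff polys_over_mult)
  have "y ^ n * (poly F y * g - u ^ n) \<in> M" using g(2) ideal_mult[OF I] by blast
  moreover have "poly (F * K - [:(-1) ^ n:]) y = y ^ n * (poly F y * g - u ^ n)"
  proof -
    have "y ^ n * u ^ n = poly F y * poly H y + (-1) ^ n"
      using arg_cong[OF eq, of "\<lambda>p. poly p y"] U(2) by (simp add: poly_monom power_mult_distrib)
    then show ?thesis using G(2) by (simp add: K_def poly_monom algebra_simps)
  qed
  ultimately have "poly (F * K - [:(-1) ^ n:]) y \<in> M" by simp
  moreover have "(-1) ^ n \<in> A" by (rule subring_power) (use subring_diff[OF subring_0 subring_1] in simp)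
  ultimately have FK: "coeff (F * K - [:(-1) ^ n:]) i \<in> M" for i
    using tr F K by (intro tr polys_over_diff polys_over_mult polys_over_const) auto
  obtain i0 where "coeff U i0 \<notin> M" using poly_in_ideal[of U y] u U by blast
  then have "coeff F (Suc i0) \<notin> M" by (simp add: F_def coeff_monom_mult)
  moreover have "\<exists>j. coeff K j \<notin> M"
  proof (rule ccontr)
    assume "\<nexists>j. coeff K j \<notin> M"
    then have "coeff (K * F) 0 \<in> M" using coeff_mult_in_ideal by blast
    then have FK0: "coeff (F * K) 0 \<in> M" by (simp add: mult.commute)
    have "(-1) ^ n \<in> M" using ideal_diff[OF I FK0 FK[of 0]] by simp
    then show False using prime_power[of "-1" n] ideal_uminus[OF I, of "-1"] prime_1 by simp
  qed
  \<comment> \<open>Degrees are taken modulo \<open>M\<close>: \<open>Suc a\<close> and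
    \<open>b\<close> are the last positions at which \<open>F\<close> and \<open>K\<close> have a
    coefficient outside \<open>M\<close>. Position \<open>Suc a + b\<close> is positive, so the
    constant \<open>(-1) ^ n\<close> contributes nothing there, while primality keeps the leading
    product outside \<open>M\<close>.\<close>
  ultimately obtain a b where ab: "coeff F (Suc a) \<notin> M" "\<And>i. i > Suc a \<Longrightarrow> coeff F i \<in> M"
    "coeff K b \<notin> M" "\<And>i. i > b \<Longrightarrow> coeff K i \<in> M"
  proof -
    assume h: thesis if "coeff F (Suc a) \<notin> M" "\<And>i. i > Suc a \<Longrightarrow> coeff F i \<in> M"
      "coeff K b \<notin> M" "\<And>i. i > b \<Longrightarrow> coeff K i \<in> M" for a b
    assume F0: "coeff F (Suc i0) \<notin> M" and K0: "\<exists>j. coeff K j \<notin> M"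
    have bd: "\<forall>y. coeff P y \<notin> M \<longrightarrow> y \<le> degree P" for P
      using le_degree ideal_zero[OF I] by metis
    define m where "m = (GREATEST i. coeff F i \<notin> M)"
    define b where "b = (GREATEST i. coeff K i \<notin> M)"
    have m: "coeff F m \<notin> M" "Suc i0 \<le> m" "\<And>i. coeff F i \<notin> M \<Longrightarrow> i \<le> m"
      using GreatestI_nat[where P = "\<lambda>i. coeff F i \<notin> M", OF F0]
        Greatest_le_nat[where P = "\<lambda>i. coeff F i \<notin> M"] F0 bd[of F] unfolding m_def by blast+
    have b: "coeff K b \<notin> M" "\<And>i. coeff K i \<notin> M \<Longrightarrow> i \<le> b"
      using GreatestI_ex_nat[where P = "\<lambda>i. coeff K i \<notin> M", OF K0]
        Greatest_le_nat[where P = "\<lambda>i. coeff K i \<notin> M"] bd[of K] unfolding b_def by blast+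
    obtain a where "m = Suc a" using m(2) by (cases m) auto
    then show thesis using h[of a b] m b by (metis not_le)
  qed
  have "coeff (F * K) (Suc a + b) = coeff F (Suc a) * coeff K b +
      (\<Sum>i\<in>{..Suc a + b} - {Suc a}. coeff F i * coeff K (Suc a + b - i))"
    by (subst coeff_mult, subst sum.remove[of _ "Suc a"]) auto
  moreover have "(\<Sum>i\<in>{..Suc a + b} - {Suc a}. coeff F i * coeff K (Suc a + b - i)) \<in> M"
  proof (rule ideal_sum[OF I])
    fix i assume i: "i \<in> {..Suc a + b} - {Suc a}"
    show "coeff F i * coeff K (Suc a + b - i) \<in> M"
    proof (cases "i > Suc a")
      case True
      then show ?thesis using ab(2) ideal_mult2[OF I] by blast
    next
      case False
      then have "Suc a + b - i > b" using i by auto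
      then show ?thesis using ab(4) ideal_mult[OF I] by blast
    qed
  qed
  moreover have "coeff (F * K) (Suc a + b) \<in> M" using FK[of "Suc a + b"] by simp
  ultimately have "coeff F (Suc a) * coeff K b \<in> M"
    using ideal_diff[OF I] by (metis add_diff_cancel_right')
  then show False using ab prime_mult by blast
qed

text \<open>Take a relation \<open>p\<close> for \<open>y\<close> of least degree \<open>d\<close>
  with leading coefficient outside \<open>M\<close>. Up to powers of this coefficient every element
  of \<open>A[y]\<close> is a polynomial in \<open>y\<close> of degree below \<open>d\<close>, and
  such polynomials vanish modulo \<open>M\<close> only coefficientwise. If \<open>u\<close> is a
  witness for \<open>A[y]\<close>, it divides some \<open>b\<close> of \<open>A\<close> outside
  \<open>M\<close>, and \<open>lead_coeff p * b\<close> is a witness for \<open>A\<close>.\<close>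

lemma g_domain_adjoin_imp_g_domain:
  assumes "g_domain_mod M (adjoin A y)"
  shows "g_domain_mod M A"
proof -
  note I = prime_is_ideal
  let ?R = "\<lambda>p d. p \<in> polys_over A \<and> poly p y \<in> M \<and> degree p = d \<and> lead_coeff p \<notin> M"
  have strip: "\<exists>q. q \<in> polys_over A \<and> poly p y - poly q y \<in> M \<and> degree q \<le> degree p \<and> lead_coeff q \<notin> M"
    if "p \<in> polys_over A" "coeff p i \<notin> M" for p i
    using that
  proof (induction "degree p" arbitrary: p rule: less_induct)
    case less
    show ?case
    proof (cases "lead_coeff p \<in> M")
      case False
      then show ?thesis using less ideal_zero[OF I] by auto
    next
      case True
      let ?m = "monom (lead_coeff p) (degree p)"
      have pA: "lead_coeff p \<in> A" using less by (auto simp: polys_over_def)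
      have i: "i \<noteq> degree p" using True less by auto
      moreover have "i \<le> degree p" using less ideal_zero[OF I] le_degree by metis
      ultimately have "degree p > 0" by auto
      have "degree (p - ?m) \<le> degree p"
        by (rule degree_diff_le) (auto simp: degree_monom_le)
      moreover have "coeff (p - ?m) (degree p) = 0" by simp
      ultimately have lt: "degree (p - ?m) < degree p"
        using \<open>degree p > 0\<close> by (metis degree_0 le_neq_implies_less leading_coeff_0_iff)
      moreover have "p - ?m \<in> polys_over A" using less pA by (intro polys_over_diff polys_over_monom) auto
      moreover have "coeff (p - ?m) i \<notin> M" using i less by simp
      ultimately obtain q where q: "q \<in> polys_over A" "poly (p - ?m) y - poly q y \<in> M"
        "degree q \<le> degree (p - ?m)" "lead_coeff q \<notin> M" using less.hyps by blast
      have "poly ?m y \<in> M" using True by (simp add: poly_monom ideal_mult2[OF I])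
      then have "(poly (p - ?m) y - poly q y) + poly ?m y \<in> M" using q(2) ideal_add[OF I] by blast
      then have "poly p y - poly q y \<in> M" by simp
      then show ?thesis using q lt by (meson less_imp_le order_trans)
    qed
  qed
  obtain p0 i0 where p0: "p0 \<in> polys_over A" "poly p0 y \<in> M" "coeff p0 i0 \<notin> M"
    using g_domain_adjoin_imp_algebraic[OF assms] by blast
  from strip[OF p0(1,3)]
  obtain q0 where q0: "q0 \<in> polys_over A" "poly p0 y - poly q0 y \<in> M" "lead_coeff q0 \<notin> M"
    by blast
  have "?R q0 (degree q0)" using q0 p0(2) ideal_cong[OF I q0(2)] by simp
  then obtain d where ex: "\<exists>p. ?R p d" and dmin: "\<And>e p. e < d \<Longrightarrow> \<not> ?R p e"
    using exists_least_iff[of "\<lambda>d. \<exists>p. ?R p d"] by blast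
  from ex obtain p where p: "p \<in> polys_over A" "poly p y \<in> M" "degree p = d" "lead_coeff p \<notin> M" by blast
  let ?c = "lead_coeff p"
  have c: "?c \<in> A" using p(1) by (auto simp: polys_over_def)
  have small: "coeff r i \<in> M" if r: "r \<in> polys_over A" "poly r y \<in> M" "degree r < d" for r i
  proof (rule ccontr)
    assume "coeff r i \<notin> M"
    with strip[OF r(1)] obtain q where q: "q \<in> polys_over A" "poly r y - poly q y \<in> M"
      "degree q \<le> degree r" "lead_coeff q \<notin> M" by blast
    then have "poly q y \<in> M" using r(2) ideal_cong[OF I q(2)] by simp
    then show False using q dmin[of "degree q" q] r(3) by simp
  qed
  have "d > 0"
  proof (rule ccontr)
    assume "\<not> d > 0"
    then obtain c where "p = [:c:]" using p(3) degree_eq_zeroE by blast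
    then show False using p by simp
  qed
  have reduce: "\<exists>N r. r \<in> polys_over A \<and> degree r < d \<and> ?c ^ N * poly f y - poly r y \<in> M"
    if f: "f \<in> polys_over A" for f
  proof -
    obtain N q r where q: "q \<in> polys_over A" "r \<in> polys_over A" "smult (?c ^ N) f = q * p + r" "degree r < d"
      using pseudo_division_over[OF p(1,3) \<open>d > 0\<close> f order_refl] by blast
    have "?c ^ N * poly f y - poly r y = poly q y * poly p y"
      using arg_cong[OF q(3), of "\<lambda>p. poly p y"] by simp
    then have "?c ^ N * poly f y - poly r y \<in> M" using p(2) ideal_mult[OF I] by simp
    then show ?thesis using q by blast
  qed
  \<comment> \<open>Euclid's algorithm: pseudo-dividing \<open>p\<close> by \<open>g\<close> leaves
    a remainder of smaller degree whose value is, modulo \<open>M\<close>, a multiple of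
    \<open>poly g y\<close>. A divisor relation for the remainder therefore yields one for
    \<open>g\<close>.\<close>
  have small_div: "\<exists>v\<in>adjoin A y. \<exists>b\<in>A. b \<notin> M \<and> poly f y * v - b \<in> M"
    if "f \<in> polys_over A" "poly f y \<notin> M" "degree f < d" for f
    using that
  proof (induction "degree f" arbitrary: f rule: less_induct)
    case less
    obtain i where "coeff f i \<notin> M" using poly_in_ideal less.prems by blast
    then obtain g where g: "g \<in> polys_over A" "poly f y - poly g y \<in> M" "degree g \<le> degree f" "lead_coeff g \<notin> M"
      using strip[OF less.prems(1) \<open>coeff f i \<notin> M\<close>] by blast
    have gM: "poly g y \<notin> M" using less.prems(2) ideal_cong[OF I g(2)] by simp
    let ?l = "lead_coeff g"
    have l: "?l \<in> A" using g(1) by (auto simp: polys_over_def)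
    have "\<exists>v\<in>adjoin A y. \<exists>b\<in>A. b \<notin> M \<and> poly g y * v - b \<in> M"
    proof (cases "degree g = 0")
      case True
      then obtain c where "g = [:c:]" using degree_eq_zeroE by blast
      then show ?thesis using l g(4) is_subring_adjoin[of y] ideal_zero[OF I]
        by (intro bexI[of _ 1] bexI[of _ c]) (auto simp: is_subring_def)
    next
      case False
      then obtain N q r where q: "q \<in> polys_over A" "r \<in> polys_over A" "smult (?l ^ N) p = q * g + r"
        "degree r < degree g" "degree q \<le> d - degree g"
        using pseudo_division_over[OF g(1) refl _ p(1) order_refl] p(3) by auto
      have e: "poly q y * poly g y + poly r y = ?l ^ N * poly p y"
        using arg_cong[OF q(3), of "\<lambda>p. poly p y"] by simp
      then have qg: "poly q y * poly g y + poly r y \<in> M" using p(2) ideal_mult[OF I] by simp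
      \<comment> \<open>Otherwise \<open>q\<close> would be a relation of degree below
        \<open>d\<close>, so all its coefficients would lie in \<open>M\<close>, and with them the
        coefficient of degree \<open>d\<close> in \<open>?l ^ N\<close> times
        \<open>p\<close>.\<close>
      have rM: "poly r y \<notin> M"
      proof
        assume "poly r y \<in> M"
        then have "poly q y * poly g y \<in> M" using qg ideal_diff[OF I] by (metis add_diff_cancel_right')
        then have "poly q y \<in> M" using gM prime_mult by blast
        then have "coeff q i \<in> M" for i using small[OF q(1)] q(5) False \<open>d > 0\<close> by simp
        then have "coeff (q * g) d \<in> M" using coeff_mult_in_ideal by blast
        moreover have "coeff r d = 0" using q(4) g(3) less.prems(3) by (intro coeff_eq_0) linarith
        ultimately have "?l ^ N * ?c \<in> M" using arg_cong[OF q(3), of "\<lambda>p. coeff p d"] p(3) by simp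
        then show False using p(4) g(4) prime_mult prime_power by blast
      qed
      obtain v b where v: "v \<in> adjoin A y" "b \<in> A" "b \<notin> M" "poly r y * v - b \<in> M"
        using less.hyps[OF _ q(2) rM] q(4) g(3) less.prems(3) by force
      have eq: "poly g y * (- poly q y * v) - b = (poly r y * v - b) - v * (poly q y * poly g y + poly r y)"
        by (simp add: algebra_simps)
      have "poly g y * (- poly q y * v) - b \<in> M"
        using ideal_diff[OF I v(4) ideal_mult[OF I qg, of v]] by (simp only: eq)
      moreover have "- poly q y * v \<in> adjoin A y"
      proof -
        obtain V where "V \<in> polys_over A" "v = poly V y" using v(1) by (auto simp: adjoin_def)
        then show ?thesis using polys_over_mult[OF polys_over_diff[OF polys_over_0 q(1)]]
          by (auto simp: adjoin_def intro!: image_eqI[of _ _ "- q * V"])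
      qed
      ultimately show ?thesis using v by blast
    qed
    then obtain v b where v: "v \<in> adjoin A y" "b \<in> A" "b \<notin> M" "poly g y * v - b \<in> M" by blast
    have "(poly f y - poly g y) * v + (poly g y * v - b) \<in> M"
      using g(2) v(4) ideal_add[OF I] ideal_mult2[OF I] by blast
    then have "poly f y * v - b \<in> M" by (simp add: algebra_simps)
    then show ?case using v by blast
  qed
  obtain u where u: "u \<in> adjoin A y" "u \<notin> M"
    and inv: "\<And>f. f \<in> adjoin A y \<Longrightarrow> f \<notin> M \<Longrightarrow> \<exists>g\<in>adjoin A y. \<exists>n. f * g - u ^ n \<in> M"
    using assms by (auto simp: g_domain_mod_def)
  note B = is_subring_adjoin[of y, unfolded is_subring_def]
  obtain w b where w: "w \<in> adjoin A y" "b \<in> A" "b \<notin> M" "u * w - b \<in> M"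
  proof -
    obtain f where f: "f \<in> polys_over A" "u = poly f y" using u(1) by (auto simp: adjoin_def)
    then obtain N r where r: "r \<in> polys_over A" "degree r < d" "?c ^ N * u - poly r y \<in> M"
      using reduce by blast
    have "?c ^ N * u \<notin> M" using u(2) p(4) prime_mult prime_power by blast
    then have "poly r y \<notin> M" using ideal_cong[OF I r(3)] by simp
    then obtain v b where v: "v \<in> adjoin A y" "b \<in> A" "b \<notin> M" "poly r y * v - b \<in> M"
      using small_div r by blast
    have "(?c ^ N * u - poly r y) * v + (poly r y * v - b) \<in> M"
      using r(3) v(4) ideal_add[OF I] ideal_mult2[OF I] by blast
    then have "u * (?c ^ N * v) - b \<in> M" by (simp add: algebra_simps)
    moreover have "?c ^ N * v \<in> adjoin A y"
      using v(1) subring_power[OF c] subring_subset_adjoin B by blast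
    ultimately show thesis using that v by blast
  qed
  show ?thesis
    unfolding g_domain_mod_def
  proof (rule bexI[of _ "?c * b"], intro conjI ballI impI)
    show "?c * b \<in> A" "?c * b \<notin> M" using c w p(4) subring_mult prime_mult by blast+
  next
    fix a assume a: "a \<in> A" "a \<notin> M"
    then obtain g n where g: "g \<in> adjoin A y" "a * g - u ^ n \<in> M"
      using inv subring_subset_adjoin by blast
    have "w ^ n \<in> adjoin A y" using w(1) B by (induction n) auto
    then have "g * w ^ n \<in> adjoin A y" using g(1) B by blast
    then obtain f where f: "f \<in> polys_over A" "g * w ^ n = poly f y" by (auto simp: adjoin_def)
    obtain N r where r: "r \<in> polys_over A" "degree r < d" "?c ^ N * poly f y - poly r y \<in> M"
      using reduce[OF f(1)] by blast
    have "w ^ n * (a * g - u ^ n) + ((u * w) ^ n - b ^ n) \<in> M"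
      using g(2) ideal_diff_power[OF I w(4), of n] ideal_add[OF I] ideal_mult[OF I] by blast
    then have "a * poly f y - b ^ n \<in> M" unfolding f(2)[symmetric] by (simp add: algebra_simps power_mult_distrib)
    then have "?c ^ N * (a * poly f y - b ^ n) - a * (?c ^ N * poly f y - poly r y) \<in> M"
      using r(3) ideal_diff[OF I] ideal_mult[OF I] by blast
    then have rel: "poly (smult a r - [:?c ^ N * b ^ n:]) y \<in> M" by (simp add: algebra_simps)
    have "smult a r - [:?c ^ N * b ^ n:] \<in> polys_over A"
      using a r c w by (intro polys_over_diff polys_over_smult polys_over_const subring_mult subring_power)
    moreover have "degree (smult a r - [:?c ^ N * b ^ n:]) < d"
      using r(2) degree_smult_le[of a r] by (intro degree_diff_less) (auto simp: \<open>d > 0\<close>)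
    \<comment> \<open>Below degree \<open>d\<close> a relation has all its coefficients in
      \<open>M\<close>; the constant one expresses an inverse of \<open>a\<close>, up to powers of
      \<open>?c\<close> and \<open>b\<close>, inside \<open>A\<close>.\<close>
    ultimately have "coeff (smult a r - [:?c ^ N * b ^ n:]) 0 \<in> M" using small rel by blast
    \<comment> \<open>The factor brings both exponents to \<open>n + N\<close>, so that a power of
      the single witness \<open>?c * b\<close> appears.\<close>
    then have "?c ^ n * b ^ N * (a * coeff r 0 - ?c ^ N * b ^ n) \<in> M" using ideal_mult[OF I] by simp
    then have "a * (?c ^ n * b ^ N * coeff r 0) - (?c * b) ^ (n + N) \<in> M"
      by (simp add: algebra_simps power_add power_mult_distrib)
    moreover have "?c ^ n * b ^ N * coeff r 0 \<in> A"
      using c w r(1) by (intro subring_mult subring_power) (auto simp: polys_over_def)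
    ultimately show "\<exists>g\<in>A. \<exists>n. a * g - (?c * b) ^ n \<in> M" by blast
  qed
qed

end

end

section \<open>Substitution homomorphisms\<close>

locale ring_map =
  fixes g :: "'a::comm_ring_1 \<Rightarrow> 'b::comm_ring_1"
  assumes map_add: "g (x + y) = g x + g y"
    and map_mult: "g (x * y) = g x * g y"
    and map_one: "g 1 = 1"
begin

lemma map_zero: "g 0 = 0"
  using map_add[of 0 0] by simp

lemma map_uminus: "g (- x) = - g x"
  using map_add[of x "- x"] by (simp add: map_zero eq_neg_iff_add_eq_0 add.commute)

lemma map_diff: "g (x - y) = g x - g y"
  using map_add[of x "- y"] by (simp add: map_uminus)

lemma map_sum: "g (sum f A) = (\<Sum>a\<in>A. g (f a))"
  by (induction A rule: infinite_finite_induct) (auto simp: map_zero map_add)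

lemma map_prod: "g (prod f A) = (\<Prod>a\<in>A. g (f a))"
  by (induction A rule: infinite_finite_induct) (auto simp: map_one map_mult)

lemma map_power: "g (x ^ n) = g x ^ n"
  by (induction n) (auto simp: map_one map_mult)

lemma is_ideal_kernel: "is_ideal {x. g x = 0}"
  by (auto simp: is_ideal_def map_zero map_add map_mult)

lemma gen_ideal_kernel: "(\<And>x. x \<in> G \<Longrightarrow> g x = 0) \<Longrightarrow> x \<in> gen_ideal G \<Longrightarrow> g x = 0"
  using gen_ideal_least[OF is_ideal_kernel, of G] by blast

end

instance fac :: finite
proof
  have "(UNIV :: fac set) = {F1, F2, F3}" using fac.exhaust by auto
  then show "finite (UNIV :: fac set)" by (metis finite.emptyI finite_insert)
qed

lemma UNIV_fac: "UNIV = {F1, F2, F3}"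
  using fac.exhaust by auto

lemma UNIV_var: "(UNIV :: var set) = UNIV \<times> {False, True}"
  by auto

lemma sum_fac: "(\<Sum>i\<in>UNIV. f i) = f F1 + f F2 + (f F3 :: 'a::comm_monoid_add)"
  by (simp add: UNIV_fac add.assoc)

lemma prod_var: "(\<Prod>v::var\<in>UNIV. f v) = (\<Prod>i\<in>UNIV. f (i, False) * (f (i, True) :: 'a::comm_monoid_mult))"
proof -
  have "(\<Prod>v\<in>UNIV. f v) = (\<Prod>i\<in>UNIV. \<Prod>b\<in>{False, True}. f (i, b))"
    unfolding UNIV_var by (simp only: prod.cartesian_product case_prod_eta)
  then show ?thesis by simp
qed

definition mon_eval :: "(var \<Rightarrow> 'b::comm_ring_1) \<Rightarrow> (var \<Rightarrow>\<^sub>0 nat) \<Rightarrow> 'b" where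
  "mon_eval s m = (\<Prod>v\<in>UNIV. s v ^ Poly_Mapping.lookup m v)"

text \<open>The coefficient map makes one construction serve three purposes: \<open>id\<close> for
  evaluation, \<open>Const\<close> for endomorphisms, and constant polynomials for maps into
  univariate polynomials.\<close>

definition subst :: "('k::comm_ring_1 \<Rightarrow> 'b::comm_ring_1) \<Rightarrow> (var \<Rightarrow> 'b) \<Rightarrow> 'k mpoly \<Rightarrow> 'b" where
  "subst h s f = (\<Sum>m\<in>Poly_Mapping.keys f. h (Poly_Mapping.lookup f m) * mon_eval s m)"

abbreviation Const :: "'k::comm_ring_1 \<Rightarrow> 'k mpoly" where
  "Const c \<equiv> Poly_Mapping.single 0 c"

lemma mon_eval_0 [simp]: "mon_eval s 0 = 1"
  by (simp add: mon_eval_def)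

lemma mon_eval_add: "mon_eval s (m + n) = mon_eval s m * mon_eval s n"
  by (simp add: mon_eval_def lookup_add power_add prod.distrib)

lemma mon_eval_single [simp]: "mon_eval s (Poly_Mapping.single v n) = s v ^ n"
proof -
  have "mon_eval s (Poly_Mapping.single v n) = (\<Prod>w\<in>UNIV. if w = v then s v ^ n else 1)"
    unfolding mon_eval_def by (intro prod.cong) (auto simp: lookup_single when_def)
  then show ?thesis by simp
qed

lemma mpoly_induct [case_names single add]:
  assumes "\<And>m c. P (Poly_Mapping.single m c)" "\<And>f g. P f \<Longrightarrow> P g \<Longrightarrow> P (f + g)"
  shows "P (f :: 'k::comm_ring_1 mpoly)"
proof -
  have "P (\<Sum>m\<in>A. Poly_Mapping.single m (Poly_Mapping.lookup f m))" if "finite A" for A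
    using that assms assms(1)[of 0 0] by induction auto
  moreover have "f = (\<Sum>m\<in>Poly_Mapping.keys f. Poly_Mapping.single m (Poly_Mapping.lookup f m))"
    by (rule poly_mapping_eqI)
      (auto simp: lookup_sum lookup_single when_def sum.delta in_keys_iff)
  ultimately show ?thesis by (metis finite_keys)
qed

lemma ring_map_Const: "ring_map (Const :: 'k::comm_ring_1 \<Rightarrow> _)"
  by unfold_locales (auto simp: single_add mult_single)

lemma ring_map_id: "ring_map (id :: 'k::comm_ring_1 \<Rightarrow> _)"
  by unfold_locales auto

lemma ring_map_pCons: "ring_map (\<lambda>c :: 'k::comm_ring_1. [:c:])"
  by unfold_locales auto

context ring_map
begin

lemma subst_single: "subst g s (Poly_Mapping.single m c) = g c * mon_eval s m"
  by (simp add: subst_def map_zero)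

lemma subst_add: "subst g s (p + q) = subst g s p + subst g s q"
  unfolding subst_def by (rule setsum_keys_plus_distrib) (auto simp: map_zero map_add distrib_right)

lemma ring_map_subst: "ring_map (subst g s)"
proof
  show "subst g s (p + q) = subst g s p + subst g s q" for p q by (rule subst_add)
  show "subst g s 1 = 1"
    using subst_single[of s 0 1] by (simp add: map_one)
  show "subst g s (p * q) = subst g s p * subst g s q" for p q
  proof (induction p rule: mpoly_induct)
    case (single m c)
    show ?case
      by (induction q rule: mpoly_induct)
        (simp_all add: mult_single subst_single map_mult mon_eval_add mult_ac subst_add distrib_left distrib_right)
  qed (simp add: subst_add distrib_right)
qed

lemma subst_Var [simp]: "subst g s (Var v) = s v"
  by (simp add: Var_def subst_single map_one)

lemma subst_Const [simp]: "subst g s (Const c) = g c"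
  by (simp add: subst_single)

lemma subst_comp:
  assumes "ring_map g'"
  shows "g' (subst g s f) = subst (\<lambda>c. g' (g c)) (\<lambda>v. g' (s v)) f"
proof -
  interpret g': ring_map g' by fact
  show ?thesis unfolding subst_def mon_eval_def
    by (simp add: g'.map_sum g'.map_mult g'.map_prod g'.map_power)
qed

end

lemma subst_Const_Var: "subst Const Var f = f"
proof (induction f rule: mpoly_induct)
  case (single m c)
  have "Var v ^ n = Poly_Mapping.single (Poly_Mapping.single v n) (1 :: 'a)" for v n
    by (induction n) (simp_all add: Var_def mult_single single_add[symmetric])
  moreover have "(\<Prod>v\<in>A. Poly_Mapping.single (e v) (1 :: 'a)) = Poly_Mapping.single (\<Sum>v\<in>A. e v) 1"
    if "finite A" for A :: "var set" and e :: "var \<Rightarrow> (var \<Rightarrow>\<^sub>0 nat)"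
    using that by induction (simp_all add: mult_single)
  moreover have "(\<Sum>v\<in>UNIV. Poly_Mapping.single v (Poly_Mapping.lookup m v)) = m"
    by (rule poly_mapping_eqI) (simp add: lookup_sum lookup_single when_def)
  ultimately have "mon_eval Var m = Poly_Mapping.single m (1 :: 'a)"
    unfolding mon_eval_def by simp
  then show ?case by (simp add: ring_map.subst_single[OF ring_map_Const] mult_single)
qed (simp add: ring_map.subst_add[OF ring_map_Const])

lemma mpoly_ring_induct [case_names Const Var add mult]:
  assumes "\<And>c. P (Const c)" "\<And>v. P (Var v)"
    "\<And>f g. P f \<Longrightarrow> P g \<Longrightarrow> P (f + g)" "\<And>f g. P f \<Longrightarrow> P g \<Longrightarrow> P (f * g)"
  shows "P (f :: 'k::comm_ring_1 mpoly)"
proof -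
  have one: "P 1" using assms(1)[of 1] by simp
  have "P (x ^ n)" if "P x" for x n using that one assms(4) by (induction n) auto
  then have "P (\<Prod>v\<in>A. Var v ^ Poly_Mapping.lookup m v)" for A m
    by (induction A rule: infinite_finite_induct) (auto simp: one assms(2,4))
  then have "P (mon_eval Var m)" for m by (simp add: mon_eval_def)
  moreover have "P 0" using assms(1)[of 0] by simp
  ultimately have *: "P (\<Sum>m\<in>A. Const (Poly_Mapping.lookup f m) * mon_eval Var m)" for A
    by (induction A rule: infinite_finite_induct) (auto simp: assms)
  show ?thesis using *[of "Poly_Mapping.keys f"] subst_Const_Var[of f] by (simp add: subst_def)
qed

section \<open>Evaluation at points of affine six-space, zero vectors in a factor included\<close>

definition pt_of :: "(var \<Rightarrow> 'k) \<Rightarrow> 'k pt" where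
  "pt_of x i = (x (i, False), x (i, True))"

lemma coord_pt_of [simp]: "coord (pt_of x) = x"
  by (auto simp: coord_def pt_of_def)

lemma coord_simps [simp]: "coord p (i, False) = fst (p i)" "coord p (i, True) = snd (p i)"
  by (simp_all add: coord_def)

lemma eval_subst: "eval f p = subst id (coord p) f"
proof -
  have "(\<Prod>v\<in>Poly_Mapping.keys m. coord p v ^ Poly_Mapping.lookup m v) = mon_eval (coord p) m" for m
    unfolding mon_eval_def by (rule prod.mono_neutral_left) (auto simp: in_keys_iff)
  then show ?thesis by (simp add: eval_def subst_def)
qed

lemma ring_map_eval: "ring_map (\<lambda>f. eval f p)"
  unfolding eval_subst using ring_map.ring_map_subst[OF ring_map_id] .

lemma eval_Var [simp]: "eval (Var v) p = coord p v"
  by (simp add: eval_subst ring_map.subst_Var[OF ring_map_id])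

lemma eval_Const [simp]: "eval (Const c) p = c"
  by (simp add: eval_subst ring_map.subst_Const[OF ring_map_id])

lemmas eval_simps = ring_map.map_add[OF ring_map_eval] ring_map.map_diff[OF ring_map_eval]
  ring_map.map_mult[OF ring_map_eval] ring_map.map_sum[OF ring_map_eval]
  ring_map.map_prod[OF ring_map_eval] ring_map.map_zero[OF ring_map_eval]
  ring_map.map_one[OF ring_map_eval] ring_map.map_power[OF ring_map_eval]
  ring_map.map_uminus[OF ring_map_eval]

lemmas ring_map_substC = ring_map.ring_map_subst[OF ring_map_Const]

lemmas substC_simps = ring_map.map_add[OF ring_map_substC] ring_map.map_diff[OF ring_map_substC]
  ring_map.map_mult[OF ring_map_substC] ring_map.map_sum[OF ring_map_substC]
  ring_map.map_prod[OF ring_map_substC] ring_map.map_zero[OF ring_map_substC]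
  ring_map.map_one[OF ring_map_substC] ring_map.map_power[OF ring_map_substC]
  ring_map.map_uminus[OF ring_map_substC]
  ring_map.subst_Var[OF ring_map_Const] ring_map.subst_Const[OF ring_map_Const]

lemma eval_substC: "eval (subst Const s f) p = eval f (pt_of (\<lambda>v. eval (s v) p))"
  unfolding ring_map.subst_comp[OF ring_map_Const ring_map_eval] eval_subst[of f]
  by (simp add: id_def)

lemma eval_gen_ideal_zero:
  "(\<And>g. g \<in> G \<Longrightarrow> eval g p = 0) \<Longrightarrow> f \<in> gen_ideal G \<Longrightarrow> eval f p = 0"
  by (rule ring_map.gen_ideal_kernel[OF ring_map_eval])

section \<open>Kronecker substitution\<close>

lemma base_digits_inj:
  fixes d e :: "nat \<Rightarrow> nat"
  assumes "\<And>i. i < n \<Longrightarrow> d i < N \<and> e i < N" "(\<Sum>i<n. d i * N ^ i) = (\<Sum>i<n. e i * N ^ i)" "i < n"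
  shows "d i = e i"
  using assms
proof (induction n arbitrary: d e i)
  case (Suc n)
  have shift: "(\<Sum>i<Suc n. x i * N ^ i) = x 0 + N * (\<Sum>i<n. x (Suc i) * N ^ i)" for x :: "nat \<Rightarrow> nat"
    by (subst sum.lessThan_Suc_shift) (simp add: sum_distrib_left algebra_simps)
  have eq: "d 0 + N * (\<Sum>i<n. d (Suc i) * N ^ i) = e 0 + N * (\<Sum>i<n. e (Suc i) * N ^ i)"
    using Suc.prems(2) by (simp only: shift)
  have N: "d 0 < N" "e 0 < N" using Suc.prems(1)[of 0] by auto
  have 0: "d 0 = e 0" using arg_cong[OF eq, of "\<lambda>x. x mod N"] N by simp
  then have "(\<Sum>i<n. d (Suc i) * N ^ i) = (\<Sum>i<n. e (Suc i) * N ^ i)" using eq N by simp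
  then have "d (Suc j) = e (Suc j)" if "j < n" for j
    using Suc.IH[of "d \<circ> Suc" "e \<circ> Suc" j] Suc.prems(1) that by auto
  then show ?case using 0 Suc.prems(3) by (cases i) auto
qed simp

text \<open>The weights are powers of an \<open>N\<close> above all exponents in \<open>S\<close>,
  so the weighted degree reads an exponent vector as a number in base \<open>N\<close>.\<close>

lemma separating_weight:
  fixes S :: "(var \<Rightarrow>\<^sub>0 nat) set"
  assumes "finite S"
  obtains w :: "var \<Rightarrow> nat" where "inj_on (\<lambda>m. \<Sum>v\<in>UNIV. w v * Poly_Mapping.lookup m v) S"
proof -
  define N where "N = Suc (\<Sum>m\<in>S. \<Sum>v\<in>UNIV. Poly_Mapping.lookup m v)"
  have N: "Poly_Mapping.lookup m v < N" if "m \<in> S" for m v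
  proof -
    have "Poly_Mapping.lookup m v \<le> (\<Sum>v\<in>UNIV. Poly_Mapping.lookup m v)"
      by (rule member_le_sum) auto
    also have "\<dots> \<le> (\<Sum>m\<in>S. \<Sum>v\<in>UNIV. Poly_Mapping.lookup m v)"
      using that assms by (intro member_le_sum) auto
    finally show ?thesis by (simp add: N_def)
  qed
  obtain c :: "nat \<Rightarrow> var" where c: "bij_betw c {0..<card (UNIV :: var set)} UNIV"
    using ex_bij_betw_nat_finite[OF finite] by blast
  let ?n = "card (UNIV :: var set)"
  let ?i = "inv_into {0..<?n} c"
  have ci: "c (?i v) = v" "?i v < ?n" for v
    using c by (simp_all add: bij_betw_inv_into_right bij_betw_imp_surj_on f_inv_into_f)
      (metis UNIV_I atLeastLessThan_iff bij_betw_imp_surj_on inv_into_into)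
  have wt: "(\<Sum>v\<in>UNIV. N ^ ?i v * Poly_Mapping.lookup m v) = (\<Sum>k<?n. Poly_Mapping.lookup m (c k) * N ^ k)" for m
    using c by (subst sum.reindex_bij_betw[symmetric, OF c])
      (auto simp: bij_betw_inv_into_left lessThan_atLeast0 mult.commute intro!: sum.cong)
  have "inj_on (\<lambda>m. \<Sum>v\<in>UNIV. N ^ ?i v * Poly_Mapping.lookup m v) S"
    unfolding wt
  proof (intro inj_onI poly_mapping_eqI)
    fix m m' v assume m: "m \<in> S" "m' \<in> S"
      "(\<Sum>k<?n. Poly_Mapping.lookup m (c k) * N ^ k) = (\<Sum>k<?n. Poly_Mapping.lookup m' (c k) * N ^ k)"
    have "Poly_Mapping.lookup m (c (?i v)) = Poly_Mapping.lookup m' (c (?i v))"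
      using N m by (intro base_digits_inj[OF _ m(3) ci(2)]) auto
    then show "Poly_Mapping.lookup m v = Poly_Mapping.lookup m' v" using ci by simp
  qed
  then show thesis by (rule that)
qed

definition kronecker :: "(var \<Rightarrow> nat) \<Rightarrow> 'k::comm_ring_1 mpoly \<Rightarrow> 'k poly" where
  "kronecker w = subst (\<lambda>c. [:c:]) (\<lambda>v. monom 1 (w v))"

lemma kronecker_nonzero:
  assumes "inj_on (\<lambda>m. \<Sum>v\<in>UNIV. w v * Poly_Mapping.lookup m v) (Poly_Mapping.keys f)" "f \<noteq> 0"
  shows "kronecker w f \<noteq> 0"
proof -
  let ?w = "\<lambda>m. \<Sum>v\<in>UNIV. w v * Poly_Mapping.lookup m v"
  have mon: "mon_eval (\<lambda>v. monom 1 (w v)) m = monom (1 :: 'a) (?w m)" for m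
  proof -
    have "(\<Prod>v\<in>A. monom 1 (w v) ^ Poly_Mapping.lookup m v) =
        monom (1 :: 'a) (\<Sum>v\<in>A. w v * Poly_Mapping.lookup m v)" if "finite A" for A
      using that by induction (simp_all add: monom_power mult_monom mult.commute)
    then show ?thesis by (simp add: mon_eval_def)
  qed
  obtain m where m: "m \<in> Poly_Mapping.keys f"
    using assms(2) by (metis in_keys_iff lookup_zero poly_mapping_eqI)
  have "coeff (kronecker w f) (?w m) =
      (\<Sum>m'\<in>Poly_Mapping.keys f. if m' = m then Poly_Mapping.lookup f m else 0)"
    unfolding kronecker_def subst_def mon coeff_sum
    using assms(1) m by (intro sum.cong) (auto simp: inj_on_def)
  also have "\<dots> \<noteq> 0" using m by (simp add: in_keys_iff)
  finally show ?thesis by force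
qed

text \<open>One weight separating the monomials of both factors keeps both Kronecker images nonzero,
  and univariate polynomials over a domain have no zero divisors.\<close>

lemma mpoly_mult_eq_0:
  fixes f g :: "'k::idom mpoly"
  assumes "f * g = 0"
  shows "f = 0 \<or> g = 0"
proof (rule ccontr)
  assume "\<not> ?thesis"
  then have fg: "f \<noteq> 0" "g \<noteq> 0" by auto
  obtain w where w: "inj_on (\<lambda>m. \<Sum>v\<in>UNIV. w v * Poly_Mapping.lookup m v)
      (Poly_Mapping.keys f \<union> Poly_Mapping.keys g)"
    using separating_weight[of "Poly_Mapping.keys f \<union> Poly_Mapping.keys g"] by auto
  have "kronecker w f \<noteq> 0" "kronecker w g \<noteq> 0"
    by (rule kronecker_nonzero[OF inj_on_subset[OF w]]; simp add: fg)+
  moreover have "kronecker w f * kronecker w g = kronecker w (f * g)"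
    unfolding kronecker_def by (simp only: ring_map.map_mult[OF ring_map.ring_map_subst[OF ring_map_pCons]])
  moreover have "kronecker w (f * g) = 0" using assms by (simp add: kronecker_def subst_def)
  ultimately show False by simp
qed

lemma poly_nonzero_value:
  fixes p :: "'k::field_char_0 poly"
  assumes "p \<noteq> 0"
  obtains x where "poly p x \<noteq> 0"
proof -
  have "infinite (UNIV :: 'k set)" by (rule infinite_UNIV_char_0)
  then have "{x. poly p x = 0} \<noteq> UNIV" using poly_roots_finite[OF assms] by auto
  then show ?thesis using that by blast
qed

lemma mpoly_nonzero_value:
  fixes f :: "'k::field_char_0 mpoly"
  assumes "f \<noteq> 0"
  obtains p where "eval f p \<noteq> 0"
proof -
  obtain w where "inj_on (\<lambda>m. \<Sum>v\<in>UNIV. w v * Poly_Mapping.lookup m v) (Poly_Mapping.keys f)"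
    using separating_weight[of "Poly_Mapping.keys f"] by auto
  then obtain x where x: "poly (kronecker w f) x \<noteq> 0"
    using kronecker_nonzero assms poly_nonzero_value by blast
  have "ring_map (\<lambda>p :: 'k poly. poly p x)" by unfold_locales auto
  then have "poly (kronecker w f) x = eval f (pt_of (\<lambda>v. x ^ w v))"
    unfolding kronecker_def eval_subst
    by (subst ring_map.subst_comp[OF ring_map_pCons]) (auto simp: poly_monom id_def)
  then show ?thesis using that x by metis
qed

section \<open>Trihomogeneous polynomials\<close>

lemma tdeg_add: "tdeg (m + n) = (\<lambda>i. tdeg m i + tdeg n i)"
  by (auto simp: tdeg_def lookup_add)

lemma trihom_mult: "trihom d f \<Longrightarrow> trihom e g \<Longrightarrow> trihom (\<lambda>i. d i + e i) (f * g)"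
  using keys_mult[of f g] by (fastforce simp: trihom_def tdeg_add)

lemma trihom_add: "trihom d f \<Longrightarrow> trihom d g \<Longrightarrow> trihom d (f + g)"
  using keys_add[of f g] by (auto simp: trihom_def)

lemma trihom_Const: "trihom (\<lambda>_. 0) (Const c)"
  by (auto simp: trihom_def tdeg_def)

lemma trihom_1: "trihom (\<lambda>_. 0) 1"
  using trihom_Const[of 1] by simp

lemma trihom_0: "trihom d 0"
  by (simp add: trihom_def)

lemma trihom_uminus: "trihom d f \<Longrightarrow> trihom d (- f)"
  using trihom_mult[OF trihom_Const[of "-1"], of d f] by (simp add: single_uminus)

lemma trihom_Var: "trihom (\<lambda>j. if j = i then 1 else 0) (Var (i, b))"
  by (auto simp: trihom_def tdeg_def Var_def lookup_single when_def)

lemma trihom_prod: "(\<And>s. s \<in> S \<Longrightarrow> trihom (d s) (f s)) \<Longrightarrow> trihom (\<lambda>i. \<Sum>s\<in>S. d s i) (prod f S)"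
  by (induction S rule: infinite_finite_induct) (auto simp: trihom_1 trihom_mult)

text \<open>The alternative \<open>d i = 0\<close> lets the coordinates of a factor in which
  \<open>f\<close> has degree zero change arbitrarily, and \<open>r i\<close> may be zero; both
  freedoms are exploited below.\<close>

lemma trihom_eval_scale:
  assumes "trihom d f"
    and "\<And>i. d i = 0 \<or> q i = (r i * fst (p i), r i * snd (p i))"
  shows "eval f q = (\<Prod>i\<in>UNIV. r i ^ d i) * eval f p"
proof -
  have "mon_eval (coord q) m = (\<Prod>i\<in>UNIV. r i ^ d i) * mon_eval (coord p) m" if "m \<in> Poly_Mapping.keys f" for m
  proof -
    have td: "tdeg m = d" using assms(1) that by (auto simp: trihom_def)
    show ?thesis
      unfolding mon_eval_def prod_var prod.distrib[symmetric]
    proof (rule prod.cong[OF refl])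
      fix i
      show "coord q (i, False) ^ Poly_Mapping.lookup m (i, False) * coord q (i, True) ^ Poly_Mapping.lookup m (i, True) =
        r i ^ d i * (coord p (i, False) ^ Poly_Mapping.lookup m (i, False) * coord p (i, True) ^ Poly_Mapping.lookup m (i, True))"
        using assms(2)[of i] fun_cong[OF td, of i]
        by (auto simp: tdeg_def power_mult_distrib power_add mult_ac simp flip: fun_cong[OF td])
    qed
  qed
  then show ?thesis unfolding eval_subst subst_def by (auto simp: sum_distrib_left mult_ac intro!: sum.cong)
qed

section \<open>Maximal ideals over an algebraically closed field\<close>

lemma g_domain_mod_foldl_adjoin:
  "prime_ideal M \<Longrightarrow> is_subring A \<Longrightarrow> g_domain_mod M (foldl adjoin A xs) \<Longrightarrow> g_domain_mod M A"
proof (induction xs arbitrary: A)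
  case (Cons x xs)
  then have "g_domain_mod M (adjoin A x)" using is_subring_adjoin[of A x] by simp
  then show ?case using Cons.prems g_domain_adjoin_imp_g_domain by blast
qed simp

lemma foldl_adjoin_subring:
  "is_subring A \<Longrightarrow> is_subring (foldl adjoin A xs) \<and> A \<subseteq> foldl adjoin A xs \<and> set xs \<subseteq> foldl adjoin A xs"
proof (induction xs arbitrary: A)
  case (Cons x xs)
  from Cons.IH[OF is_subring_adjoin[OF Cons.prems, of x]]
  show ?case using subring_subset_adjoin[OF Cons.prems, of x] generator_in_adjoin[OF Cons.prems, of x]
    by auto
qed simp

lemma Const_in_ideal: "is_ideal J \<Longrightarrow> 1 \<notin> J \<Longrightarrow> Const (c :: 'k::field) \<in> J \<Longrightarrow> c = 0"
  using ideal_mult[of J "Const c" "Const (inverse c)"] by (cases "c = 0") (auto simp: mult_single)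

lemma algebraic_imp_root:
  fixes P :: "'k::field poly" and z :: "'k mpoly"
  assumes "alg_closed TYPE('k)" "prime_ideal M" "P \<noteq> 0" "poly (map_poly Const P) z \<in> M"
  shows "\<exists>c. z - Const c \<in> M"
  using assms(3,4)
proof (induction "degree P" arbitrary: P rule: less_induct)
  case less
  have M: "is_ideal M" "1 \<notin> M" using assms(2) by (auto simp: prime_ideal_def)
  show ?case
  proof (cases "degree P = 0")
    case True
    then obtain c where "P = [:c:]" "c \<noteq> 0" using less.prems degree_eq_zeroE by (metis pCons_0_0)
    then show ?thesis using less.prems Const_in_ideal[OF M, of c] by (simp add: map_poly_pCons)
  next
    case False
    then obtain x where "poly P x = 0" using assms(1) by (auto simp: alg_closed_def)
    then obtain Q where Q: "P = [:-x, 1:] * Q" by (metis dvd_def poly_eq_0_iff_dvd)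
    have "map_poly Const P = smult (Const (-x)) (map_poly Const Q) + pCons 0 (map_poly Const Q)"
      unfolding Q by (rule poly_eqI)
        (auto simp: coeff_map_poly single_add mult_single coeff_pCons single_diff single_uminus split: nat.split)
    from arg_cong[OF this, of "\<lambda>p. poly p z"]
    have "poly (map_poly Const P) z = Const (-x) * poly (map_poly Const Q) z + z * poly (map_poly Const Q) z"
      by simp
    then have "poly (map_poly Const P) z = (z - Const x) * poly (map_poly Const Q) z"
      by (simp add: single_uminus left_diff_distrib)
    then have "z - Const x \<in> M \<or> poly (map_poly Const Q) z \<in> M"
      using less.prems(2) assms(2) unfolding prime_ideal_def by metis
    moreover have "Q \<noteq> 0" using less.prems(1) Q by auto
    moreover have "degree Q < degree P"
      using degree_mult_eq[of "[:-x, 1:]" Q] \<open>Q \<noteq> 0\<close> unfolding Q by simp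
    ultimately show ?thesis using less.hyps by blast
  qed
qed

text \<open>The weak Nullstellensatz. R/M is a field, hence a G-domain; this descends to K[z], where
  it makes \<open>z\<close> algebraic modulo \<open>M\<close>, hence congruent to a root of its
  relation.\<close>

lemma maximal_ideal_residue:
  fixes z :: "'k::field mpoly"
  assumes "alg_closed TYPE('k)" "maximal_ideal M"
  obtains c where "z - Const c \<in> M"
proof -
  have M: "prime_ideal M" using assms(2) by (rule maximal_imp_prime_ideal)
  then have I: "is_ideal M" "1 \<notin> M" by (auto simp: prime_ideal_def)
  let ?K = "range (Const :: 'k \<Rightarrow> 'k mpoly)"
  have K: "is_subring ?K"
    unfolding is_subring_def
  proof (intro conjI ballI)
    show "1 \<in> ?K" by (rule range_eqI[of _ _ 1]) simp
    fix x y assume "x \<in> ?K" "y \<in> ?K"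
    then obtain a b where "x = Const a" "y = Const b" by blast
    then have "x - y = Const (a - b)" "x * y = Const (a * b)" by (simp_all add: single_diff mult_single)
    then show "x - y \<in> ?K" "x * y \<in> ?K" by blast+
  qed
  obtain vs :: "var list" where vs: "set vs = UNIV" using finite_list[of "UNIV :: var set"] by auto
  \<comment> \<open>\<open>z\<close> is adjoined first, so that the descent from the whole ring ends
    at K[z].\<close>
  let ?L = "foldl adjoin ?K (z # map Var vs)"
  have L: "is_subring ?L" "?K \<subseteq> ?L" "set (map Var vs) \<subseteq> ?L"
    using foldl_adjoin_subring[OF K, of "z # map Var vs"] by auto
  have "f \<in> ?L" for f
  proof (induction f rule: mpoly_ring_induct)
    case (Const c)
    then show ?case using L(2) by blast
  next
    case (Var v)
    have "Var v \<in> set (map Var vs)" using vs by auto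
    then show ?case using L(3) by blast
  next
    case (add f g)
    then show ?case using subring_add[OF L(1)] by blast
  next
    case (mult f g)
    then show ?case using subring_mult[OF L(1)] by blast
  qed
  then have L: "?L = UNIV" by blast
  have "g_domain_mod M UNIV"
    unfolding g_domain_mod_def using I maximal_ideal_inverse[OF assms(2)]
    by (metis UNIV_I power_one)
  then have "g_domain_mod M (foldl adjoin (adjoin ?K z) (map Var vs))" using L by simp
  then have "g_domain_mod M (adjoin ?K z)"
    using g_domain_mod_foldl_adjoin[OF M is_subring_adjoin[OF K]] by blast
  then obtain p i where p: "p \<in> polys_over ?K" "poly p z \<in> M" "coeff p i \<notin> M"
    using g_domain_adjoin_imp_algebraic[OF K M] by blast
  let ?P = "map_poly (\<lambda>f. Poly_Mapping.lookup f 0) p"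
  have "map_poly Const ?P = p"
  proof (rule poly_eqI)
    fix i
    obtain c where "coeff p i = Const c" using p(1) by (auto simp: polys_over_def)
    then show "coeff (map_poly Const ?P) i = coeff p i" by (simp add: coeff_map_poly)
  qed
  moreover have "?P \<noteq> 0"
  proof
    assume "?P = 0"
    then have "p = 0" using \<open>map_poly Const ?P = p\<close> by simp
    then show False using p(3) ideal_zero[OF I(1)] by simp
  qed
  ultimately show ?thesis using algebraic_imp_root[OF assms(1) M, of ?P z] p(2) that by auto
qed

section \<open>A bound on the length of chains of primes\<close>

lemma homogeneous_system_nontrivial:
  fixes a :: "'i \<Rightarrow> 'j \<Rightarrow> 'k::field"
  assumes "finite Y" "finite X" "card Y < card X"
  shows "\<exists>c. (\<exists>x\<in>X. c x \<noteq> 0) \<and> (\<forall>y\<in>Y. (\<Sum>x\<in>X. c x * a x y) = 0)"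
  using assms
proof (induction Y arbitrary: X a)
  case empty
  then have "X \<noteq> {}" by auto
  then show ?case by (intro exI[of _ "\<lambda>_. 1"]) auto
next
  case (insert y Y)
  show ?case
  proof (cases "\<forall>x\<in>X. a x y = 0")
    case True
    have "card Y < card X" using insert by auto
    from insert.IH[OF insert.prems(1) this, of a] show ?thesis using True by auto
  next
    case False
    then obtain x0 where x0: "x0 \<in> X" "a x0 y \<noteq> 0" by auto
    let ?X = "X - {x0}" and ?a = "\<lambda>x z. a x z - a x y / a x0 y * a x0 z"
    have "card Y < card ?X" using insert x0 by simp
    from insert.IH[OF _ this, of ?a] obtain c where c: "\<exists>x\<in>?X. c x \<noteq> 0"
      "\<And>z. z \<in> Y \<Longrightarrow> (\<Sum>x\<in>?X. c x * ?a x z) = 0" using insert.prems(1) by auto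
    \<comment> \<open>The value at the pivot \<open>x0\<close> solves equation \<open>y\<close>;
      \<open>?a\<close> subtracts from each other equation the multiple of it that removes
      \<open>x0\<close>.\<close>
    let ?c = "c(x0 := - (\<Sum>x\<in>?X. c x * a x y) / a x0 y)"
    have split: "(\<Sum>x\<in>X. ?c x * a x z) = (\<Sum>x\<in>?X. c x * a x z) - (\<Sum>x\<in>?X. c x * a x y) / a x0 y * a x0 z" for z
      using insert.prems(1) x0(1) by (subst sum.remove[of _ x0]) auto
    have "(\<Sum>x\<in>X. ?c x * a x z) = 0" if "z \<in> Y" for z
    proof -
      have "(\<Sum>x\<in>?X. c x * ?a x z) = (\<Sum>x\<in>?X. c x * a x z) - (\<Sum>x\<in>?X. c x * a x y) / a x0 y * a x0 z"
        by (simp add: algebra_simps sum_subtractf sum_distrib_left sum_divide_distrib)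
      then show ?thesis using c(2)[OF that] split by simp
    qed
    moreover have "(\<Sum>x\<in>X. ?c x * a x y) = 0" using x0(2) by (simp only: split) simp
    moreover have "\<exists>x\<in>X. ?c x \<noteq> 0" using c(1) by auto
    ultimately show ?thesis by (intro exI[of _ ?c]) blast
  qed
qed

section \<open>Linear independence over the field modulo a prime\<close>

definition indep_mod :: "'k::field mpoly set \<Rightarrow> 'i set \<Rightarrow> ('i \<Rightarrow> 'k mpoly) \<Rightarrow> bool" where
  "indep_mod P X g \<longleftrightarrow> (\<forall>c. (\<Sum>x\<in>X. Const (c x) * g x) \<in> P \<longrightarrow> (\<forall>x\<in>X. c x = 0))"

text \<open>Modulo \<open>Q\<close> only the terms with exponent zero survive, so their coefficients
  vanish. The rest is divisible by \<open>f\<close>, which cancels because \<open>P\<close> is prime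
  and misses \<open>f\<close>; then the argument repeats.\<close>

lemma indep_mod_powers:
  assumes "prime_ideal P" "is_ideal Q" "P \<subseteq> Q" "f \<in> Q" "f \<notin> P" "indep_mod Q X g"
  shows "indep_mod P ({..<n} \<times> X) (\<lambda>(e, x). f ^ e * g x)"
proof (induction n)
  case 0
  then show ?case by (simp add: indep_mod_def)
next
  case (Suc n)
  show ?case
    unfolding indep_mod_def
  proof (intro allI impI)
    fix c assume mem: "(\<Sum>z\<in>{..<Suc n} \<times> X. Const (c z) * (case z of (e, x) \<Rightarrow> f ^ e * g x)) \<in> P"
    let ?s0 = "\<Sum>x\<in>X. Const (c (0, x)) * g x"
    let ?s1 = "\<Sum>e<n. \<Sum>x\<in>X. Const (c (Suc e, x)) * (f ^ e * g x)"
    have "(\<Sum>z\<in>{..<Suc n} \<times> X. Const (c z) * (case z of (e, x) \<Rightarrow> f ^ e * g x)) =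
        (\<Sum>e<Suc n. \<Sum>x\<in>X. Const (c (e, x)) * (f ^ e * g x))"
      by (subst sum.cartesian_product) (auto intro!: sum.cong)
    also have "\<dots> = ?s0 + f * ?s1"
      by (subst sum.lessThan_Suc_shift) (simp add: sum_distrib_left mult_ac)
    finally have s: "?s0 + f * ?s1 \<in> P" using mem by simp
    then have "?s0 + f * ?s1 - f * ?s1 \<in> Q"
      using assms(2-4) by (intro ideal_diff ideal_mult2) auto
    then have "?s0 \<in> Q" by simp
    then have c0: "c (0, x) = 0" if "x \<in> X" for x
      using assms(6)[unfolded indep_mod_def, rule_format, of "\<lambda>x. c (0, x)"] that by blast
    then have "?s0 = 0" by simp
    then have "f * ?s1 \<in> P" using s by simp
    then have s1: "?s1 \<in> P" using assms(1,5) unfolding prime_ideal_def by blast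
    have "?s1 = (\<Sum>z\<in>{..<n} \<times> X. Const (c (Suc (fst z), snd z)) * (case z of (e, x) \<Rightarrow> f ^ e * g x))"
      by (subst sum.cartesian_product) (auto intro!: sum.cong)
    with s1 have "(\<Sum>z\<in>{..<n} \<times> X. Const (c (Suc (fst z), snd z)) * (case z of (e, x) \<Rightarrow> f ^ e * g x)) \<in> P"
      by simp
    then have c1: "c (Suc e, x) = 0" if "e < n" "x \<in> X" for e x
      using Suc[unfolded indep_mod_def, rule_format, of "\<lambda>z. c (Suc (fst z), snd z)" "(e, x)"] that by auto
    show "\<forall>z\<in>{..<Suc n} \<times> X. c z = 0"
    proof
      fix z assume "z \<in> {..<Suc n} \<times> X"
      then obtain e x where "z = (e, x)" "e < Suc n" "x \<in> X" by auto
      then show "c z = 0" using c0 c1 by (cases e) auto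
    qed
  qed
qed

lemma indep_mod_reindex:
  assumes "inj_on h X" "indep_mod P X (\<lambda>x. g (h x))"
  shows "indep_mod P (h ` X) g"
  unfolding indep_mod_def
proof (intro allI impI)
  fix c assume "(\<Sum>x\<in>h ` X. Const (c x) * g x) \<in> P"
  then have "(\<Sum>x\<in>X. Const (c (h x)) * g (h x)) \<in> P" by (simp add: sum.reindex[OF assms(1)])
  then show "\<forall>x\<in>h ` X. c x = 0" using assms(2)[unfolded indep_mod_def, rule_format, of "c \<circ> h"] by auto
qed

definition degree_le :: "nat \<Rightarrow> 'k::comm_ring_1 mpoly \<Rightarrow> bool" where
  "degree_le D f \<longleftrightarrow> (\<forall>m\<in>Poly_Mapping.keys f. (\<Sum>v\<in>UNIV. Poly_Mapping.lookup m v) \<le> D)"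

lemma degree_le_mult: "degree_le D f \<Longrightarrow> degree_le E g \<Longrightarrow> degree_le (D + E) (f * g)"
  using keys_mult[of f g] by (fastforce simp: degree_le_def lookup_add sum.distrib add_mono)

lemma degree_le_1: "degree_le 0 1"
  by (simp add: degree_le_def)

lemma degree_le_power: "degree_le D f \<Longrightarrow> degree_le (n * D) (f ^ n)"
  by (induction n) (auto simp: degree_le_1 degree_le_mult)

lemma degree_le_mono: "degree_le D f \<Longrightarrow> D \<le> E \<Longrightarrow> degree_le E f"
  by (auto simp: degree_le_def)

lemma degree_le_exists: "\<exists>D. degree_le D f"
proof
  show "degree_le (\<Sum>m\<in>Poly_Mapping.keys f. \<Sum>v\<in>UNIV. Poly_Mapping.lookup m v) f"
    unfolding degree_le_def by (intro ballI member_le_sum) auto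
qed

text \<open>The indices in \<open>X\<close> are exponent vectors with entries below
  \<open>N\<close>, stored as lists, and \<open>g\<close> forms the corresponding monomial in
  elements of \<open>P (Suc i) - P i\<close>. It matters that \<open>d\<close>, the sum of the
  degree bounds of these elements, is fixed before \<open>N\<close>.\<close>

lemma prime_chain_indep:
  fixes P :: "nat \<Rightarrow> 'k::field mpoly set"
  assumes "\<And>i. i \<le> n \<Longrightarrow> prime_ideal (P i)" "\<And>i. i < n \<Longrightarrow> P i \<subset> P (Suc i)"
  shows "\<exists>d. \<forall>N. \<exists>(X :: nat list set) g. finite X \<and> card X = N ^ n \<and>
    (\<forall>x\<in>X. degree_le (d * N) (g x)) \<and> indep_mod (P 0) X g"
  using assms
proof (induction n arbitrary: P)
  case 0
  have "indep_mod (P 0) {[] :: nat list} (\<lambda>_. 1)"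
    using 0(1)[of 0] Const_in_ideal[of "P 0"] by (auto simp: indep_mod_def prime_ideal_def)
  then have "\<forall>N. \<exists>(X :: nat list set) g. finite X \<and> card X = N ^ 0 \<and>
    (\<forall>x\<in>X. degree_le (0 * N) (g x)) \<and> indep_mod (P 0) X g"
    by (intro allI exI[of _ "{[]}"] exI[of _ "\<lambda>_. 1"]) (auto simp: degree_le_1)
  then show ?case by blast
next
  case (Suc n)
  obtain d where d: "\<And>N. \<exists>(X :: nat list set) g. finite X \<and> card X = N ^ n \<and>
    (\<forall>x\<in>X. degree_le (d * N) (g x)) \<and> indep_mod (P 1) X g"
    using Suc.IH[of "\<lambda>i. P (Suc i)"] Suc.prems by auto
  obtain f where f: "f \<in> P 1" "f \<notin> P 0" using Suc.prems(2)[of 0] by auto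
  obtain e where e: "degree_le e f" using degree_le_exists by blast
  have PQ: "prime_ideal (P 0)" "is_ideal (P 1)" "P 0 \<subseteq> P 1"
    using Suc.prems(1)[of 0] Suc.prems(1)[of 1] Suc.prems(2)[of 0] by (auto simp: prime_ideal_def)
  show ?case
  proof (intro exI[of _ "e + d"] allI)
    fix N
    obtain X and g :: "nat list \<Rightarrow> 'k mpoly" where X: "finite X" "card X = N ^ n"
      "\<And>x. x \<in> X \<Longrightarrow> degree_le (d * N) (g x)" "indep_mod (P 1) X g"
      using d[of N] by blast
    let ?h = "\<lambda>(k, xs). k # xs" and ?g = "\<lambda>l. f ^ hd l * g (tl l)"
    have inj: "inj_on ?h ({..<N} \<times> X)" by (auto simp: inj_on_def)
    have "indep_mod (P 0) ({..<N} \<times> X) (\<lambda>z. ?g (?h z))"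
      using indep_mod_powers[OF PQ f X(4), of N] by (simp add: case_prod_unfold)
    then have "indep_mod (P 0) (?h ` ({..<N} \<times> X)) ?g" by (rule indep_mod_reindex[OF inj])
    moreover have "card (?h ` ({..<N} \<times> X)) = N ^ Suc n"
      using X by (simp add: card_image[OF inj] card_cartesian_product)
    moreover have "degree_le ((e + d) * N) (?g x)" if "x \<in> ?h ` ({..<N} \<times> X)" for x
    proof -
      from that obtain k xs where x: "x = k # xs" "k < N" "xs \<in> X" by auto
      have "degree_le (k * e + d * N) (?g x)"
        using degree_le_mult[OF degree_le_power[OF e] X(3)[OF x(3)]] x(1) by simp
      moreover have "k * e + d * N \<le> (e + d) * N" using x(2) by (simp add: algebra_simps)
      ultimately show ?thesis by (rule degree_le_mono)
    qed
    moreover have "finite (?h ` ({..<N} \<times> X))" using X(1) by simp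
    ultimately have "finite (?h ` ({..<N} \<times> X)) \<and> card (?h ` ({..<N} \<times> X)) = N ^ Suc n \<and>
      (\<forall>x\<in>?h ` ({..<N} \<times> X). degree_le ((e + d) * N) (?g x)) \<and> indep_mod (P 0) (?h ` ({..<N} \<times> X)) ?g"
      by (intro conjI ballI)
    then show "\<exists>(X :: nat list set) g. finite X \<and> card X = N ^ Suc n \<and>
      (\<forall>x\<in>X. degree_le ((e + d) * N) (g x)) \<and> indep_mod (P 0) X g"
      by (intro exI[of _ "?h ` ({..<N} \<times> X)"] exI[of _ ?g])
  qed
qed

lemma diff_subst_in_ideal:
  assumes "is_ideal J" "\<And>v. Var v - s v \<in> J"
  shows "f - subst Const s f \<in> J"
proof (induction f rule: mpoly_ring_induct)
  case (add f g)
  then have "(f - subst Const s f) + (g - subst Const s g) \<in> J" using ideal_add[OF assms(1)] by blast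
  then show ?case by (simp add: substC_simps algebra_simps)
next
  case (mult f g)
  then show ?case using ideal_diff_mult[OF assms(1)] by (simp add: substC_simps)
qed (use assms ideal_zero in \<open>auto simp: substC_simps\<close>)

lemma lookup_Const_mult: "Poly_Mapping.lookup (Const c * f) m = c * Poly_Mapping.lookup f m"
  by (simp flip: mult_map_scale_conv_mult add: Poly_Mapping.map.rep_eq when_def)

text \<open>Picking \<open>f\<^sub>i \<in> P\<^sub>i\<^sub>+\<^sub>1 - P\<^sub>i\<close> along a chain of length \<open>n\<close> gives \<open>n\<close> elements that are algebraically
  independent modulo \<open>P\<^sub>0\<close>; the \<open>N^n\<close> monomials with exponents below \<open>N\<close> live in a space of dimension
  \<open>O(N^r)\<close> when all variables are multiples of \<open>r\<close> of them modulo \<open>P\<^sub>0\<close>.\<close>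

lemma prime_chain_length_le:
  fixes P :: "nat \<Rightarrow> 'k::field mpoly set" and \<pi> :: "var \<Rightarrow> var"
  assumes P: "\<And>i. i \<le> n \<Longrightarrow> prime_ideal (P i)" "\<And>i. i < n \<Longrightarrow> P i \<subset> P (Suc i)"
    and red: "\<And>v. Var v - Const (\<kappa> v) * Var (\<pi> v) \<in> P 0"
  shows "n \<le> card (range \<pi>)"
proof (rule ccontr)
  let ?r = "card (range \<pi>)"
  assume n: "\<not> n \<le> ?r"
  have I: "is_ideal (P 0)" using P(1)[of 0] by (auto simp: prime_ideal_def)
  obtain d where d: "\<And>N. \<exists>(X :: nat list set) g. finite X \<and> card X = N ^ n \<and>
    (\<forall>x\<in>X. degree_le (d * N) (g x)) \<and> indep_mod (P 0) X g"
    using prime_chain_indep[of n P, OF P] by blast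
  \<comment> \<open>With \<open>N\<close> beyond \<open>(d + 1) ^ r\<close>, where \<open>r\<close>
    is \<open>?r\<close>, one gets \<open>(d * N + 1) ^ r < N ^ (r + 1) \<le> N ^ n\<close>, so the
    independent monomials outnumber the exponents available to them.\<close>
  define N where "N = Suc (Suc d ^ ?r)"
  obtain X and g :: "nat list \<Rightarrow> 'k mpoly" where X: "finite X" "card X = N ^ n"
    "\<And>x. x \<in> X \<Longrightarrow> degree_le (d * N) (g x)" "indep_mod (P 0) X g"
    using d[of N] by blast
  define D where "D = d * N"
  \<comment> \<open>A box of exponents replaces the simplex of total degree at most
    \<open>D\<close>; it is larger, but \<open>(D + 1) ^ r\<close> bounds its size at once.\<close>
  define E where "E = {m :: var \<Rightarrow>\<^sub>0 nat. Poly_Mapping.keys m \<subseteq> range \<pi> \<and> (\<forall>v. Poly_Mapping.lookup m v \<le> D)}"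
  define s where "s v = Const (\<kappa> v) * Var (\<pi> v)" for v
  let ?F = "range \<pi> \<rightarrow>\<^sub>E {..D}"
  have fin: "finite ?F" by (intro finite_PiE) auto
  have inj: "inj_on (\<lambda>m. restrict (Poly_Mapping.lookup m) (range \<pi>)) E"
  proof (intro inj_onI poly_mapping_eqI)
    fix m m' v assume m: "m \<in> E" "m' \<in> E"
      "restrict (Poly_Mapping.lookup m) (range \<pi>) = restrict (Poly_Mapping.lookup m') (range \<pi>)"
    show "Poly_Mapping.lookup m v = Poly_Mapping.lookup m' v"
    proof (cases "v \<in> range \<pi>")
      case True
      then show ?thesis using fun_cong[OF m(3), of v] by simp
    next
      case False
      then have "v \<notin> Poly_Mapping.keys m" "v \<notin> Poly_Mapping.keys m'" using m(1,2) by (auto simp: E_def)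
      then show ?thesis by (simp add: in_keys_iff)
    qed
  qed
  have sub: "(\<lambda>m. restrict (Poly_Mapping.lookup m) (range \<pi>)) ` E \<subseteq> ?F"
    by (auto simp: E_def simp del: split_paired_All)
  have E: "finite E" "card E \<le> Suc D ^ ?r"
    using inj_on_finite[OF inj sub fin] card_inj_on_le[OF inj sub fin] by (simp_all add: card_PiE)
  have "Suc D \<le> Suc d * N" by (simp add: D_def N_def)
  then have "Suc D ^ ?r \<le> (Suc d * N) ^ ?r" by (intro power_mono) auto
  also have "\<dots> = Suc d ^ ?r * N ^ ?r" by (rule power_mult_distrib)
  also have "\<dots> < N * N ^ ?r" by (intro mult_strict_right_mono) (auto simp: N_def)
  also have "\<dots> = N ^ Suc ?r" by simp
  also have "\<dots> \<le> N ^ n" using n by (intro power_increasing) (auto simp: N_def)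
  finally have "card E < card X" using E(2) X(2) by simp
  then obtain c where c: "\<exists>x\<in>X. c x \<noteq> 0"
    "\<And>m. m \<in> E \<Longrightarrow> (\<Sum>x\<in>X. c x * Poly_Mapping.lookup (subst Const s (g x)) m) = 0"
    using homogeneous_system_nontrivial[OF E(1) X(1), of "\<lambda>x. Poly_Mapping.lookup (subst Const s (g x))"]
    by blast
  have keysE: "Poly_Mapping.keys (subst Const s f) \<subseteq> E" if f: "degree_le D f" for f
  proof -
    have "Poly_Mapping.keys (Const a * mon_eval s m) \<subseteq> E" if m: "m \<in> Poly_Mapping.keys f" for a m
    proof -
      let ?p = "\<Sum>v\<in>UNIV. Poly_Mapping.single (\<pi> v) (Poly_Mapping.lookup m v)"
      have "s v ^ k = Poly_Mapping.single (Poly_Mapping.single (\<pi> v) k) (\<kappa> v ^ k)" for v k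
        by (induction k) (simp_all add: s_def Var_def mult_single single_add[symmetric])
      moreover have "(\<Prod>v\<in>A. Poly_Mapping.single (e v) (b v)) = Poly_Mapping.single (\<Sum>v\<in>A. e v) (\<Prod>v\<in>A. b v)"
        if "finite A" for A :: "var set" and e :: "var \<Rightarrow> (var \<Rightarrow>\<^sub>0 nat)" and b :: "var \<Rightarrow> 'k"
        using that by induction (simp_all add: mult_single)
      ultimately have "Const a * mon_eval s m = Poly_Mapping.single ?p (a * (\<Prod>v\<in>UNIV. \<kappa> v ^ Poly_Mapping.lookup m v))"
        unfolding mon_eval_def by (simp add: mult_single)
      then have "Poly_Mapping.keys (Const a * mon_eval s m) \<subseteq> {?p}" by simp
      moreover have "?p \<in> E"
        unfolding E_def
      proof (intro CollectI conjI allI)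
        show "Poly_Mapping.keys ?p \<subseteq> range \<pi>"
        proof
          fix w assume "w \<in> Poly_Mapping.keys ?p"
          then have "(\<Sum>v\<in>UNIV. Poly_Mapping.lookup (Poly_Mapping.single (\<pi> v) (Poly_Mapping.lookup m v)) w) \<noteq> 0"
            by (simp add: in_keys_iff lookup_sum)
          then obtain v where "Poly_Mapping.lookup (Poly_Mapping.single (\<pi> v) (Poly_Mapping.lookup m v)) w \<noteq> 0"
            using sum.not_neutral_contains_not_neutral by blast
          then show "w \<in> range \<pi>" by (auto simp: lookup_single when_def split: if_splits)
        qed
        fix w
        have "Poly_Mapping.lookup ?p w \<le> (\<Sum>v\<in>UNIV. Poly_Mapping.lookup m v)"
          unfolding lookup_sum by (intro sum_mono) (simp add: lookup_single when_def)
        then show "Poly_Mapping.lookup ?p w \<le> D" using f m by (auto simp: degree_le_def)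
      qed
      ultimately show ?thesis by blast
    qed
    then show ?thesis
      unfolding subst_def using keys_sum[of "\<lambda>m. Const (Poly_Mapping.lookup f m) * mon_eval s m"] by blast
  qed
  let ?h = "\<Sum>x\<in>X. Const (c x) * g x"
  have "subst Const s ?h = 0"
  proof (rule poly_mapping_eqI)
    fix m
    have "Poly_Mapping.lookup (subst Const s ?h) m = (\<Sum>x\<in>X. c x * Poly_Mapping.lookup (subst Const s (g x)) m)"
      by (simp add: substC_simps lookup_sum lookup_Const_mult)
    also have "\<dots> = 0"
    proof (cases "m \<in> E")
      case False
      then have "Poly_Mapping.lookup (subst Const s (g x)) m = 0" if "x \<in> X" for x
        using keysE[of "g x"] X(3)[OF that] by (auto simp: D_def in_keys_iff)
      then show ?thesis by simp
    qed (rule c(2))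
    finally show "Poly_Mapping.lookup (subst Const s ?h) m = Poly_Mapping.lookup 0 m" by simp
  qed
  then have "?h \<in> P 0" using diff_subst_in_ideal[OF I, of s ?h] red by (simp add: s_def)
  then have "\<forall>x\<in>X. c x = 0" using X(4)[unfolded indep_mod_def, rule_format, of c] by blast
  then show False using c(1) by blast
qed

section \<open>Linear sections of the grid\<close>

text \<open>The ideal of an affine linear space, in the form used later: \<open>s\<close> defines an
  idempotent endomorphism whose kernel is the ideal generated by \<open>G\<close>.\<close>

definition flat :: "'k::comm_ring_1 mpoly set \<Rightarrow> bool" where
  "flat G \<longleftrightarrow> (\<exists>s. (\<forall>v. Var v - s v \<in> gen_ideal G) \<and> (\<forall>g\<in>G. subst Const s g = 0))"

lemma flat_kernel:
  assumes "\<And>v. Var v - s v \<in> gen_ideal G" "\<And>g. g \<in> G \<Longrightarrow> subst Const s g = 0"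
  shows "f \<in> gen_ideal G \<longleftrightarrow> subst Const s f = 0"
proof
  show "f \<in> gen_ideal G \<Longrightarrow> subst Const s f = 0"
    using ring_map.gen_ideal_kernel[OF ring_map_substC] assms(2) by metis
  assume "subst Const s f = 0"
  then show "f \<in> gen_ideal G"
    using diff_subst_in_ideal[OF is_ideal_gen_ideal, of s G f] assms(1) by simp
qed

text \<open>The kernel of a substitution into a domain is prime, and the zero \<open>p\<close> of
  \<open>G\<close> certifies that \<open>f\<close> lies outside it. Later regularity claims thus
  come down to choosing a point.\<close>

lemma flat_nzd_mod:
  fixes f :: "'k::idom mpoly"
  assumes "flat G" "\<And>g. g \<in> G \<Longrightarrow> eval g p = 0" "eval f p \<noteq> 0"
  shows "nzd_mod (gen_ideal G) f"
proof -
  obtain s where s: "\<And>v. Var v - s v \<in> gen_ideal G" "\<And>g. g \<in> G \<Longrightarrow> subst Const s g = 0"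
    using assms(1) by (auto simp: flat_def)
  have "f \<notin> gen_ideal G" using eval_gen_ideal_zero[OF assms(2)] assms(3) by blast
  then have "subst Const s f \<noteq> 0" using flat_kernel[OF s] by blast
  then have "subst Const s h = 0" if "f * h \<in> gen_ideal G" for h
    using that flat_kernel[OF s, of "f * h"] mpoly_mult_eq_0 by (auto simp: substC_simps)
  then show ?thesis using flat_kernel[OF s] by (auto simp: nzd_mod_def)
qed

text \<open>\<open>s\<close> parametrises zeros of \<open>G\<close>, so
  \<open>subst Const s f\<close> vanishes at every point and, the field being infinite, is
  zero.\<close>

lemma flat_vanishing:
  fixes f :: "'k::field_char_0 mpoly"
  assumes "flat G" "\<And>p. (\<And>g. g \<in> G \<Longrightarrow> eval g p = 0) \<Longrightarrow> eval f p = 0"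
  shows "f \<in> gen_ideal G"
proof -
  obtain s where s: "\<And>v. Var v - s v \<in> gen_ideal G" "\<And>g. g \<in> G \<Longrightarrow> subst Const s g = 0"
    using assms(1) by (auto simp: flat_def)
  have "subst Const s f = 0"
  proof (rule ccontr)
    assume "subst Const s f \<noteq> 0"
    then obtain p where p: "eval (subst Const s f) p \<noteq> 0" by (rule mpoly_nonzero_value)
    have "eval g (pt_of (\<lambda>v. eval (s v) p)) = 0" if "g \<in> G" for g
      using s(2)[OF that] eval_substC[of s g p] by (simp add: eval_simps)
    then show False using assms(2) p by (simp add: eval_substC)
  qed
  then show ?thesis using flat_kernel[OF s] by blast
qed

section \<open>Linear forms of points of one factor and affine slices\<close>

definition lin :: "fac \<Rightarrow> 'k \<times> 'k \<Rightarrow> 'k::comm_ring_1 mpoly" where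
  "lin i q = Const (snd q) * Var (i, False) - Const (fst q) * Var (i, True)"

text \<open>This is \<open>t\<^sub>i - \<tau>\<^sub>i\<close>; the coefficient one at
  \<open>Var (i, False)\<close> allows that variable to be eliminated.\<close>

definition slice :: "(fac \<Rightarrow> 'k) \<Rightarrow> (fac \<Rightarrow> 'k) \<Rightarrow> fac \<Rightarrow> 'k::comm_ring_1 mpoly" where
  "slice \<mu> \<tau> i = Var (i, False) + Const (\<mu> i) * Var (i, True) - Const (\<tau> i)"

lemma eval_lin: "eval (lin i q) p = snd q * fst (p i) - fst q * snd (p i)"
  by (simp add: lin_def eval_simps)

lemma eval_slice: "eval (slice \<mu> \<tau> i) p = fst (p i) + \<mu> i * snd (p i) - \<tau> i"
  by (simp add: slice_def eval_simps)

lemma trihom_lin: "trihom (\<lambda>j. if j = i then 1 else 0) (lin i q)"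
proof -
  have "trihom (\<lambda>j. if j = i then 1 else 0) (Const c * Var (i, b))" for c :: 'a and b
    using trihom_mult[OF trihom_Const[of c] trihom_Var[of i b]] by simp
  then show ?thesis
    unfolding lin_def diff_conv_add_uminus by (intro trihom_add trihom_uminus)
qed

text \<open>\<open>L i = Some q\<close> confines the \<open>i\<close>-th factor to the line through \<open>q\<close>, and \<open>i \<in> T\<close> cuts it with an affine
  line.\<close>

definition gens :: "(fac \<Rightarrow> ('k \<times> 'k) option) \<Rightarrow> (fac \<Rightarrow> 'k) \<Rightarrow> (fac \<Rightarrow> 'k) \<Rightarrow> fac set \<Rightarrow> 'k::comm_ring_1 mpoly set" where
  "gens L \<mu> \<tau> T = {lin i q | i q. L i = Some q} \<union> slice \<mu> \<tau> ` T"

lemma gens_upd: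
  assumes "L i = None"
  shows "gens (L(i \<mapsto> q)) \<mu> \<tau> T = insert (lin i q) (gens L \<mu> \<tau> T)"
proof -
  have "(L(i \<mapsto> q)) j = Some r \<longleftrightarrow> j = i \<and> r = q \<or> L j = Some r" for j r
    using assms by auto
  then show ?thesis unfolding gens_def by (simp only:) blast
qed

lemma gens_empty: "gens Map.empty \<mu> \<tau> T = slice \<mu> \<tau> ` T"
  by (auto simp: gens_def)

lemma flat_gens:
  fixes L :: "fac \<Rightarrow> ('k::field \<times> 'k) option"
  assumes L: "\<And>i q. L i = Some q \<Longrightarrow> q \<noteq> (0, 0)"
    and T: "\<And>i q. L i = Some q \<Longrightarrow> i \<in> T \<Longrightarrow> fst q + \<mu> i * snd q \<noteq> 0"
  shows "flat (gens L \<mu> \<tau> T)"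
proof -
  \<comment> \<open>The factors separate. A free factor keeps its variables, a slice alone
    eliminates \<open>Var (i, False)\<close>, a line alone expresses both variables through a
    nonzero coordinate, and line and slice together leave the single point
    \<open>\<tau> i / (fst q + \<mu> i * snd q)\<close> times \<open>q\<close>.\<close>
  define s where "s v = (case v of (i, b) \<Rightarrow> (case L i of
      None \<Rightarrow> if i \<in> T \<and> \<not> b then Const (\<tau> i) - Const (\<mu> i) * Var (i, True) else Var (i, b)
    | Some q \<Rightarrow> if i \<in> T then Const ((if b then snd q else fst q) * (\<tau> i / (fst q + \<mu> i * snd q)))
        else if fst q \<noteq> 0 then Const ((if b then snd q else fst q) / fst q) * Var (i, False)
        else Const (if b then 1 else 0) * Var (i, True)))" for v
  note I = is_ideal_gen_ideal[of "gens L \<mu> \<tau> T"]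
  have lin_in: "lin i q \<in> gen_ideal (gens L \<mu> \<tau> T)" if "L i = Some q" for i q
    using that unfolding gens_def by (intro in_gen_ideal UnI1) blast
  have slice_in: "slice \<mu> \<tau> i \<in> gen_ideal (gens L \<mu> \<tau> T)" if "i \<in> T" for i
    using that by (intro in_gen_ideal) (auto simp: gens_def)
  have "Var v - s v \<in> gen_ideal (gens L \<mu> \<tau> T)" for v
  proof -
    obtain i b where v: "v = (i, b)" by (cases v)
    show ?thesis
    proof (cases "L i")
      case None
      then have "Var v - s v = (if i \<in> T \<and> \<not> b then slice \<mu> \<tau> i else 0)"
        by (auto simp: s_def v slice_def algebra_simps)
      then show ?thesis using slice_in ideal_zero[OF I] by simp
    next
      case (Some q)
      obtain \<alpha> \<beta> where q: "q = (\<alpha>, \<beta>)" by (cases q)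
      have lq: "lin i q \<in> gen_ideal (gens L \<mu> \<tau> T)" using lin_in[OF Some] .
      show ?thesis
      proof (cases "i \<in> T")
        case True
        let ?e = "\<alpha> + \<mu> i * \<beta>"
        have e: "?e \<noteq> 0" using T[OF Some True] q by simp
        have c: "Const (1 / ?e) * (Const \<alpha> + Const (\<mu> i) * Const \<beta>) = 1"
          using e by (simp add: mult_single flip: single_add)
        \<comment> \<open>Cramer's rule for the system \<open>lin i q = 0\<close>,
          \<open>slice \<mu> \<tau> i = 0\<close>, whose determinant is \<open>?e\<close>.\<close>
        have "Var v - s v = Const (1 / ?e) * (if b then Const \<beta> * slice \<mu> \<tau> i - lin i q
            else Const \<alpha> * slice \<mu> \<tau> i + Const (\<mu> i) * lin i q)"
        proof (cases b)
          case True
          have "Const (1 / ?e) * (Const \<beta> * slice \<mu> \<tau> i - lin i q) =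
              (Const (1 / ?e) * (Const \<alpha> + Const (\<mu> i) * Const \<beta>)) * Var v
              - Const (1 / ?e) * (Const \<beta> * Const (\<tau> i))"
            by (simp only: v True slice_def lin_def q fst_conv snd_conv) (simp only: algebra_simps)
          also have "\<dots> = Var v - s v" unfolding c
            using \<open>i \<in> T\<close> Some True by (simp add: s_def v q mult_single)
          finally show ?thesis using True by simp
        next
          case False
          have "Const (1 / ?e) * (Const \<alpha> * slice \<mu> \<tau> i + Const (\<mu> i) * lin i q) =
              (Const (1 / ?e) * (Const \<alpha> + Const (\<mu> i) * Const \<beta>)) * Var v
              - Const (1 / ?e) * (Const \<alpha> * Const (\<tau> i))"
            using False by (simp only: v slice_def lin_def q fst_conv snd_conv) (simp add: algebra_simps)
          also have "\<dots> = Var v - s v" unfolding c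
            using \<open>i \<in> T\<close> Some False by (simp add: s_def v q mult_single)
          finally show ?thesis using False by simp
        qed
        then show ?thesis using lq slice_in[OF True] I
          by (auto intro!: ideal_mult ideal_diff ideal_add is_ideal_gen_ideal)
      next
        case False
        show ?thesis
        proof (cases "\<alpha> = 0")
          case True
          then have "\<beta> \<noteq> 0" using L[OF Some] q by auto
          then have "Const (1 / \<beta>) * Const \<beta> = 1" by (simp add: mult_single)
          then have "Var v - s v = (if b then 0 else Const (1 / \<beta>) * lin i q)"
            using Some False True by (auto simp: s_def v q lin_def mult.assoc[symmetric])
          then show ?thesis using lq ideal_zero[OF I] ideal_mult[OF I] by simp
        next
          case \<alpha>: False
          then have "Const (1 / \<alpha>) * Const \<alpha> = 1" "Const (1 / \<alpha>) * Const \<beta> = Const (\<beta> / \<alpha>)"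
            by (simp_all add: mult_single)
          then have "Var v - s v = (if b then - Const (1 / \<alpha>) * lin i q else 0)"
            using Some False \<alpha> by (auto simp: s_def v q lin_def right_diff_distrib mult.assoc[symmetric])
          then show ?thesis using lq ideal_zero[OF I] ideal_mult[OF I lq, of "- Const (1 / \<alpha>)"]
            by (simp split: if_split)
        qed
      qed
    qed
  qed
  moreover have "subst Const s g = 0" if "g \<in> gens L \<mu> \<tau> T" for g
  proof -
    from that consider i q where "g = lin i q" "L i = Some q" | i where "g = slice \<mu> \<tau> i" "i \<in> T"
      by (auto simp: gens_def)
    then show ?thesis
    proof cases
      case 1
      have sg: "subst Const s g = Const (snd q) * s (i, False) - Const (fst q) * s (i, True)"
        by (simp add: 1(1) lin_def substC_simps)
      show ?thesis
      proof (cases "i \<in> T \<or> fst q = 0")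
        case True
        then show ?thesis unfolding sg using 1(2) by (auto simp: s_def mult_single mult_ac)
      next
        case False
        then have "s (i, False) = Var (i, False)" "s (i, True) = Const (snd q / fst q) * Var (i, False)"
          using 1(2) by (auto simp: s_def)
        moreover have "Const (fst q) * Const (snd q / fst q) = Const (snd q)"
          using False by (simp add: mult_single)
        ultimately show ?thesis unfolding sg by (simp add: mult.assoc[symmetric])
      qed
    next
      case (2 i)
      show ?thesis
      proof (cases "L i")
        case None
        then show ?thesis using 2 by (simp add: slice_def substC_simps s_def)
      next
        case (Some q)
        let ?e = "fst q + \<mu> i * snd q"
        have e: "?e \<noteq> 0" using T[OF Some 2(2)] .
        have "subst Const s g = Const (fst q * (\<tau> i / ?e) + \<mu> i * (snd q * (\<tau> i / ?e)) - \<tau> i)"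
          using 2 Some by (simp add: slice_def substC_simps s_def mult_single single_add single_diff)
        also have "fst q * (\<tau> i / ?e) + \<mu> i * (snd q * (\<tau> i / ?e)) - \<tau> i = ?e * (\<tau> i / ?e) - \<tau> i"
          by (simp only: distrib_right mult.assoc)
        also have "\<dots> = 0" using e by simp
        finally show ?thesis by simp
      qed
    qed
  qed
  ultimately show ?thesis unfolding flat_def by (intro exI[of _ s] conjI allI ballI)
qed

section \<open>The grid spanned by three finite sets of points of the projective line\<close>

lemma fac_third:
  obtains k :: fac where "k \<noteq> i" "k \<noteq> j"
  by (cases i; cases j) (use fac.distinct in metis)+

locale grid =
  fixes B :: "fac \<Rightarrow> ('k::field_char_0 \<times> 'k) set" and \<mu> :: "fac \<Rightarrow> 'k"
  assumes fin: "finite (B i)"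
    and nonzero: "q \<in> B i \<Longrightarrow> q \<noteq> (0, 0)"
    and nonprop: "q \<in> B i \<Longrightarrow> r \<in> B i \<Longrightarrow> q \<noteq> r \<Longrightarrow> snd q * fst r \<noteq> fst q * snd r"
    and transversal: "q \<in> B i \<Longrightarrow> fst q + \<mu> i * snd q \<noteq> 0"
begin

definition F :: "fac \<Rightarrow> 'k mpoly" where
  "F i = (\<Prod>q\<in>B i. lin i q)"

text \<open>The zero set of \<open>gens L \<mu> \<tau> T\<close> is a product over the factors, so
  witness points can be assembled factor by factor.\<close>

definition on_locus :: "(fac \<Rightarrow> ('k \<times> 'k) option) \<Rightarrow> (fac \<Rightarrow> 'k) \<Rightarrow> fac set \<Rightarrow> fac \<Rightarrow> 'k \<times> 'k \<Rightarrow> bool" where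
  "on_locus L \<tau> T i x \<longleftrightarrow> (\<forall>q. L i = Some q \<longrightarrow> snd q * fst x = fst q * snd x) \<and>
     (i \<in> T \<longrightarrow> fst x + \<mu> i * snd x = \<tau> i)"

definition in_grid :: "(fac \<Rightarrow> ('k \<times> 'k) option) \<Rightarrow> bool" where
  "in_grid L \<longleftrightarrow> (\<forall>i q. L i = Some q \<longrightarrow> q \<in> B i)"

lemma in_grid_simps [simp]:
  "in_grid Map.empty" "q \<in> B i \<Longrightarrow> in_grid L \<Longrightarrow> in_grid (L(i \<mapsto> q))"
  by (auto simp: in_grid_def)

lemma in_gridD: "in_grid L \<Longrightarrow> L i = Some q \<Longrightarrow> q \<in> B i"
  unfolding in_grid_def by blast

text \<open>This multiple of \<open>q\<close> is the one point of its line where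
  \<open>t\<^sub>i\<close> takes the value \<open>t\<close>. The value \<open>\<tau> i\<close> gives
  a point of the slice, any other value a point off it.\<close>

lemma on_locus_line_slice:
  assumes "q \<in> B i" "L i = Some q"
  shows "on_locus L \<tau> T i ((t / (fst q + \<mu> i * snd q)) * fst q, (t / (fst q + \<mu> i * snd q)) * snd q) \<longleftrightarrow>
    (i \<in> T \<longrightarrow> t = \<tau> i)"
proof -
  have scale: "s * x + m * (s * y) = s * (x + m * y)" for s x m y :: 'k
    by (simp add: algebra_simps)
  have "t / (fst q + \<mu> i * snd q) * fst q + \<mu> i * (t / (fst q + \<mu> i * snd q) * snd q)
      = t / (fst q + \<mu> i * snd q) * (fst q + \<mu> i * snd q)" by (rule scale)
  also have "\<dots> = t" using transversal[OF assms(1)] by simp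
  finally show ?thesis using assms(2) by (simp add: on_locus_def)
qed

lemma on_locus_free: "L i = None \<Longrightarrow> on_locus L \<tau> T i (\<tau> i - \<mu> i * y, y)"
  by (simp add: on_locus_def)

lemma on_locus_exists:
  assumes "in_grid L"
  shows "\<exists>x. on_locus L \<tau> T i x"
proof (cases "L i")
  case None
  then show ?thesis using on_locus_free by blast
next
  case (Some q)
  then show ?thesis using on_locus_line_slice[of q i L \<tau> T "\<tau> i"] in_gridD[OF assms] by blast
qed

lemma flat_gens_grid: "in_grid L \<Longrightarrow> flat (gens L \<mu> \<tau> T)"
  by (rule flat_gens) (auto simp: in_grid_def dest: nonzero transversal)

lemma nzd_gens:
  assumes L: "in_grid L" and p: "\<And>i. on_locus L \<tau> T i (p i)" and f: "eval f p \<noteq> 0"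
  shows "nzd_mod (gen_ideal (gens L \<mu> \<tau> T)) f"
proof (rule flat_nzd_mod[OF flat_gens_grid[OF L] _ f])
  fix g assume "g \<in> gens L \<mu> \<tau> T"
  then consider i q where "g = lin i q" "L i = Some q" | i where "g = slice \<mu> \<tau> i" "i \<in> T"
    by (auto simp: gens_def)
  then show "eval g p = 0"
    by cases (use p in \<open>auto simp: on_locus_def eval_lin eval_slice\<close>)
qed

lemma nzd_gens_one_factor:
  assumes L: "in_grid L" and x: "on_locus L \<tau> T j x" and f: "\<And>p. p j = x \<Longrightarrow> eval f p \<noteq> 0"
  shows "nzd_mod (gen_ideal (gens L \<mu> \<tau> T)) f"
proof -
  obtain p where p: "on_locus L \<tau> T i (p i)" for i using on_locus_exists[OF L] by metis
  show ?thesis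
    by (rule nzd_gens[OF L, of \<tau> T "p(j := x)"]) (use p x f in auto)
qed

lemma nzd_lin:
  assumes "in_grid L" "L j = None" "r \<in> B j"
  shows "nzd_mod (gen_ideal (gens L \<mu> \<tau> T)) (lin j r)"
proof -
  \<comment> \<open>\<open>?y\<close> solves \<open>lin j r = 1\<close> on the affine line
    \<open>t\<^sub>j = \<tau>\<^sub>j\<close>.\<close>
  let ?e = "fst r + \<mu> j * snd r" and ?y = "(snd r * \<tau> j - 1) / (fst r + \<mu> j * snd r)"
  have "snd r * (\<tau> j - \<mu> j * ?y) - fst r * ?y = snd r * \<tau> j - ?e * ?y" by (simp only: algebra_simps)
  also have "?e * ?y = snd r * \<tau> j - 1" using transversal[OF assms(3)] by simp
  finally have "snd r * (\<tau> j - \<mu> j * ?y) - fst r * ?y = 1" by simp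
  then show ?thesis
    by (intro nzd_gens_one_factor[OF assms(1) on_locus_free[of L j \<tau> T ?y, OF assms(2)]]) (simp add: eval_lin)
qed

lemma nzd_lin_same_factor:
  assumes "in_grid L" "L j = Some q" "q \<in> B j" "r \<in> B j" "q \<noteq> r" "j \<notin> T"
  shows "nzd_mod (gen_ideal (gens L \<mu> \<tau> T)) (lin j r)"
  using nonprop[OF assms(4,3)] assms
  by (intro nzd_gens_one_factor[where x = q]) (auto simp: eval_lin on_locus_def)

lemma nzd_slice:
  assumes "in_grid L" "j \<notin> T"
  shows "nzd_mod (gen_ideal (gens L \<mu> \<tau> T)) (slice \<mu> \<tau> j)"
proof (cases "L j")
  case None
  then show ?thesis using assms
    by (intro nzd_gens_one_factor[where x = "(\<tau> j + 1, 0)"]) (auto simp: eval_slice on_locus_def)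
next
  case (Some q)
  then have q: "q \<in> B j" using in_gridD[OF assms(1)] by blast
  let ?s = "(\<tau> j + 1) / (fst q + \<mu> j * snd q)"
  have "s * x + m * (s * y) = s * (x + m * y)" for s x m y :: 'k
    by (simp add: algebra_simps)
  then have "?s * fst q + \<mu> j * (?s * snd q) = ?s * (fst q + \<mu> j * snd q)" .
  also have "\<dots> = \<tau> j + 1" using transversal[OF q] by simp
  finally show ?thesis
    by (intro nzd_gens_one_factor[OF assms(1), where x = "(?s * fst q, ?s * snd q)" and j = j])
      (use on_locus_line_slice[of q j L \<tau> T "\<tau> j + 1"] q Some assms in \<open>auto simp: eval_slice\<close>)
qed

text \<open>The sum treats all directions alike: on a fully sliced grid line two factors are single
  points, while \<open>Var (k, True)\<close> is a free parameter in the remaining factor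
  \<open>k\<close>. So \<open>trace c\<close> is nonconstant on every grid line, whatever its
  direction.\<close>

definition trace :: "'k \<Rightarrow> 'k mpoly" where
  "trace c = (\<Sum>i\<in>UNIV. Var (i, True)) - Const c"

lemma nzd_trace:
  assumes "in_grid L" "L j = None"
  shows "nzd_mod (gen_ideal (gens L \<mu> \<tau> T)) (trace c)"
proof -
  obtain p where p: "on_locus L \<tau> T i (p i)" for i using on_locus_exists[OF assms(1)] by metis
  \<comment> \<open>The free coordinate is set so that the coordinate sum becomes
    \<open>c + 1\<close>.\<close>
  define y where "y = c + 1 - (\<Sum>i\<in>UNIV - {j}. snd (p i))"
  let ?p = "p(j := (\<tau> j - \<mu> j * y, y))"
  have "(\<Sum>i\<in>UNIV. snd (?p i)) = y + (\<Sum>i\<in>UNIV - {j}. snd (p i))"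
    by (subst sum.remove[of _ j]) auto
  then have "eval (trace c) ?p = 1" by (simp add: trace_def eval_simps y_def)
  then show ?thesis
    using p on_locus_free[of L j \<tau> T y] assms by (intro nzd_gens[of L \<tau> T ?p]) auto
qed

text \<open>Splitting \<open>F i\<close> and \<open>F j\<close> into linear factors filters the
  quotient by quotients modulo flats. Each split requires the linear factors to be regular modulo
  the other generators, which holds because they come from different factors of the product.\<close>

lemma nzd_F_pair:
  assumes ij: "i \<noteq> j"
    and f: "\<And>q r. q \<in> B i \<Longrightarrow> r \<in> B j \<Longrightarrow> nzd_mod (gen_ideal (gens [i \<mapsto> q, j \<mapsto> r] \<mu> \<tau> T)) f"
  shows "nzd_mod (gen_ideal (insert (F i) (insert (F j) (slice \<mu> \<tau> ` T)))) f"
proof -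
  have one: "gens [k \<mapsto> q] \<mu> \<tau> T = insert (lin k q) (slice \<mu> \<tau> ` T)" for k q
    by (simp add: gens_upd gens_empty)
  have two: "gens [i \<mapsto> q, j \<mapsto> r] \<mu> \<tau> T = insert (lin j r) (insert (lin i q) (slice \<mu> \<tau> ` T))" for q r
    using ij by (simp add: gens_upd gens_empty)
  show ?thesis
    unfolding F_def[of i]
  proof (rule nzd_mod_insert_prod)
    fix q assume q: "q \<in> B i"
    show "nzd_mod (gen_ideal (insert (lin i q) (insert (F j) (slice \<mu> \<tau> ` T)))) f"
      unfolding F_def insert_commute[of "lin i q"]
    proof (rule nzd_mod_insert_prod)
      fix r assume r: "r \<in> B j"
      show "nzd_mod (gen_ideal (insert (lin j r) (insert (lin i q) (slice \<mu> \<tau> ` T)))) f"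
        using f[OF q r] by (simp add: two)
      show "nzd_mod (gen_ideal (insert (lin i q) (slice \<mu> \<tau> ` T))) (lin j r)"
        using nzd_lin[of "[i \<mapsto> q]" j r \<tau> T] q r ij by (simp add: one)
    qed
    show "nzd_mod (gen_ideal (insert (F j) (slice \<mu> \<tau> ` T))) (lin i q)"
      unfolding F_def
    proof (rule nzd_mod_insert_prod)
      fix r assume r: "r \<in> B j"
      show "nzd_mod (gen_ideal (insert (lin j r) (slice \<mu> \<tau> ` T))) (lin i q)"
        using nzd_lin[of "[j \<mapsto> r]" i q \<tau> T] q r ij by (simp add: one)
      show "nzd_mod (gen_ideal (slice \<mu> \<tau> ` T)) (lin j r)"
        using nzd_lin[of Map.empty j r \<tau> T] r by (simp add: gens_empty)
    qed
  qed
qed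

lemma nzd_F_third:
  assumes "i \<noteq> j" "k \<noteq> i" "k \<noteq> j"
  shows "nzd_mod (gen_ideal ({F i, F j} \<union> slice \<mu> \<tau> ` T)) (F k)"
proof -
  have "nzd_mod (gen_ideal (insert (F i) (insert (F j) (slice \<mu> \<tau> ` T)))) (lin k s)" if "s \<in> B k" for s
    using assms that by (intro nzd_F_pair nzd_lin) auto
  then have "nzd_mod (gen_ideal (insert (F i) (insert (F j) (slice \<mu> \<tau> ` T)))) (F k)"
    unfolding F_def[of k] by (rule nzd_mod_prod)
  then show ?thesis by simp
qed

definition pairs :: "'k mpoly set" where
  "pairs = {F F1 * F F2, F F1 * F F3, F F2 * F F3}"

lemma gen_ideal_pairs_slices:
  "gen_ideal (pairs \<union> slice \<mu> \<tau> ` T) =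
    gen_ideal ({F F1, F F2} \<union> slice \<mu> \<tau> ` T) \<inter> gen_ideal ({F F1, F F3} \<union> slice \<mu> \<tau> ` T) \<inter>
    gen_ideal ({F F2, F F3} \<union> slice \<mu> \<tau> ` T)"
  unfolding pairs_def by (intro gen_ideal_pairs_inter nzd_F_third) auto

lemma nzd_pairs_slices:
  assumes "\<And>i j q r. i \<noteq> j \<Longrightarrow> q \<in> B i \<Longrightarrow> r \<in> B j \<Longrightarrow>
    nzd_mod (gen_ideal (gens [i \<mapsto> q, j \<mapsto> r] \<mu> \<tau> T)) f"
  shows "nzd_mod (gen_ideal (pairs \<union> slice \<mu> \<tau> ` T)) f"
proof -
  have "nzd_mod (gen_ideal ({F i, F j} \<union> slice \<mu> \<tau> ` T)) f" if "i \<noteq> j" for i j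
    using nzd_F_pair[OF that assms[OF that]] by simp
  from this[of F1 F2] this[of F1 F3] this[of F2 F3] show ?thesis
    unfolding gen_ideal_pairs_slices by (simp add: nzd_mod_def)
qed

lemma regular_sequence_pairs:
  defines "fs \<equiv> \<lambda>\<tau> c. map (slice \<mu> \<tau>) [F1, F2, F3] @ [trace c]"
  assumes "k < 4"
  shows "nzd_mod (gen_ideal (pairs \<union> set (take k (fs \<tau> c)))) (fs \<tau> c ! k)"
proof -
  have sl: "nzd_mod (gen_ideal (pairs \<union> slice \<mu> \<tau> ` T)) (slice \<mu> \<tau> j)" if "j \<notin> T" for T j
    using that by (intro nzd_pairs_slices nzd_slice) auto
  have tr: "nzd_mod (gen_ideal (pairs \<union> slice \<mu> \<tau> ` T)) (trace c)" for T
  proof (rule nzd_pairs_slices)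
    fix i j :: fac and q r assume a: "i \<noteq> j" "q \<in> B i" "r \<in> B j"
    obtain l where "l \<noteq> i" "l \<noteq> j" by (rule fac_third)
    then show "nzd_mod (gen_ideal (gens [i \<mapsto> q, j \<mapsto> r] \<mu> \<tau> T)) (trace c)"
      using a by (intro nzd_trace[of _ l]) auto
  qed
  consider "k = 0" | "k = 1" | "k = 2" | "k = 3" using assms(2) by linarith
  then show ?thesis
    by cases (use sl[of F1 "{}"] sl[of F2 "{F1}"] sl[of F3 "{F1, F2}"] tr[of "{F1, F2, F3}"]
      in \<open>simp_all add: fs_def numeral_2_eq_2 numeral_3_eq_3\<close>)
qed

text \<open>The converse assembles one product at a time: \<open>F i\<close> modulo a fixed
  \<open>lin j r\<close>, then \<open>F j\<close> modulo \<open>F i\<close>. Forms of distinct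
  points of one factor are regular modulo one another.\<close>

lemma in_gen_ideal_F_pair:
  assumes ij: "i \<noteq> j"
  shows "x \<in> gen_ideal {F i, F j} \<longleftrightarrow> (\<forall>q\<in>B i. \<forall>r\<in>B j. x \<in> gen_ideal {lin i q, lin j r})"
proof
  assume "x \<in> gen_ideal {F i, F j}"
  moreover have F_in: "F k \<in> gen_ideal G" if "s \<in> B k" "lin k s \<in> G" for k s G
    unfolding F_def prod.remove[OF fin that(1)]
    by (rule ideal_mult2[OF is_ideal_gen_ideal in_gen_ideal[OF that(2)]])
  then have "F i \<in> gen_ideal {lin i q, lin j r} \<and> F j \<in> gen_ideal {lin i q, lin j r}"
    if "q \<in> B i" "r \<in> B j" for q r
    using that by blast
  ultimately show "\<forall>q\<in>B i. \<forall>r\<in>B j. x \<in> gen_ideal {lin i q, lin j r}"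
    using gen_ideal_least[OF is_ideal_gen_ideal, of "{F i, F j}"] by blast
next
  assume x: "\<forall>q\<in>B i. \<forall>r\<in>B j. x \<in> gen_ideal {lin i q, lin j r}"
  have one: "gens [k \<mapsto> q] \<mu> \<tau> {} = {lin k q}" for k q \<tau>
    by (simp add: gens_upd gens_empty)
  have two: "gens [i \<mapsto> q, j \<mapsto> r] \<mu> \<tau> {} = {lin j r, lin i q}" for q r \<tau>
    using ij by (simp add: gens_upd gens_empty)
  have xi: "x \<in> gen_ideal (insert (F i) {lin j r})" if r: "r \<in> B j" for r
    unfolding F_def
  proof (rule in_gen_ideal_insert_prod[OF fin])
    fix q q' assume q: "q \<in> B i" "q' \<in> B i" "q \<noteq> q'"
    then show "nzd_mod (gen_ideal (insert (lin i q) {lin j r})) (lin i q')"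
      using nzd_lin_same_factor[of "[i \<mapsto> q, j \<mapsto> r]" i q q' "{}" \<mu>] r ij
      by (simp add: two insert_commute)
  qed (use x r in auto)
  show "x \<in> gen_ideal {F i, F j}"
    unfolding insert_commute[of "F i"] F_def[of j]
  proof (rule in_gen_ideal_insert_prod[OF fin])
    fix r r' assume r: "r \<in> B j" "r' \<in> B j" "r \<noteq> r'"
    show "nzd_mod (gen_ideal (insert (lin j r) {F i})) (lin j r')"
      unfolding insert_commute[of "lin j r"] F_def
    proof (rule nzd_mod_insert_prod)
      fix q assume q: "q \<in> B i"
      then show "nzd_mod (gen_ideal (insert (lin i q) {lin j r})) (lin j r')"
        using nzd_lin_same_factor[of "[i \<mapsto> q, j \<mapsto> r]" j r r' "{}" \<mu>] r ij
        by (simp add: two insert_commute)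
      show "nzd_mod (gen_ideal {lin j r}) (lin i q)"
        using nzd_lin[of "[j \<mapsto> r]" i q \<mu> "{}"] q r ij by (simp add: one)
    qed
  qed (use xi in \<open>auto simp: insert_commute\<close>)
qed

text \<open>\<open>(lin i q, lin j r)\<close> is the ideal of one grid line, so the right-hand side
  is the ideal of the grid, described without \<open>C\<close>.\<close>

lemma gen_ideal_pairs:
  "gen_ideal pairs = {x. \<forall>i j. i \<noteq> j \<longrightarrow> (\<forall>q\<in>B i. \<forall>r\<in>B j. x \<in> gen_ideal {lin i q, lin j r})}"
proof -
  have "gen_ideal pairs = gen_ideal {F F1, F F2} \<inter> gen_ideal {F F1, F F3} \<inter> gen_ideal {F F2, F F3}"
    using gen_ideal_pairs_slices[of \<mu> "{}"] by simp
  also have "\<dots> = {x. \<forall>i j. i \<noteq> j \<longrightarrow> x \<in> gen_ideal {F i, F j}}"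
  proof (intro set_eqI iffI)
    fix x assume "x \<in> gen_ideal {F F1, F F2} \<inter> gen_ideal {F F1, F F3} \<inter> gen_ideal {F F2, F F3}"
    then have "x \<in> gen_ideal {F i, F j}" if "i \<noteq> j" for i j
      using that by (cases i; cases j) (auto simp: insert_commute)
    then show "x \<in> {x. \<forall>i j. i \<noteq> j \<longrightarrow> x \<in> gen_ideal {F i, F j}}" by blast
  qed auto
  finally show ?thesis by (auto simp: in_gen_ideal_F_pair)
qed

section \<open>The Hilbert--Burch resolution\<close>

lemma F_nonzero: "F i \<noteq> 0"
proof -
  have "nzd_mod (gen_ideal {}) (F i)"
    unfolding F_def using nzd_lin[of Map.empty i _ \<mu> "{}"]
    by (intro nzd_mod_prod) (simp add: gens_empty)
  then show ?thesis by (auto simp: nzd_mod_def dest: spec[of _ 1])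
qed

lemma nzd_F:
  assumes "i \<noteq> j"
  shows "nzd_mod (gen_ideal {F j}) (F i)"
  unfolding F_def[of i]
proof (rule nzd_mod_prod)
  fix q assume q: "q \<in> B i"
  have one: "gens [k \<mapsto> q] \<mu> \<tau> {} = {lin k q}" for k q \<tau>
    by (simp add: gens_upd gens_empty)
  show "nzd_mod (gen_ideal {F j}) (lin i q)"
    unfolding F_def
  proof (rule nzd_mod_insert_prod)
    fix r assume r: "r \<in> B j"
    show "nzd_mod (gen_ideal {lin j r}) (lin i q)"
      using nzd_lin[of "[j \<mapsto> r]" i q \<mu> "{}"] q r assms by (simp add: one)
    show "nzd_mod (gen_ideal {}) (lin j r)"
      using nzd_lin[of Map.empty j r \<mu> "{}"] r by (simp add: gens_empty)
  qed
qed

lemma trihom_F: "trihom (\<lambda>j. if j = i then card (B i) else 0) (F i)"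
proof -
  have "trihom (\<lambda>j. \<Sum>q\<in>B i. if j = i then 1 else 0) (F i)"
    unfolding F_def by (rule trihom_prod) (rule trihom_lin)
  moreover have "(\<lambda>j. \<Sum>q\<in>B i. if j = i then 1 else 0) = (\<lambda>j. if j = i then card (B i) else 0)"
    by auto
  ultimately show ?thesis by metis
qed

lemma has_min_resolution_pairs:
  assumes card: "a = card (B F1)" "b = card (B F2)" "c = card (B F3)" and pos: "\<And>i. B i \<noteq> {}"
  shows "has_min_resolution (gen_ideal pairs) a b c"
proof -
  define g where "g k = (\<Prod>i\<in>UNIV - {k}. F i)" for k
  have g: "g F1 = F F2 * F F3" "g F2 = F F1 * F F3" "g F3 = F F1 * F F2"
  proof -
    have "UNIV - {F1} = {F2, F3}" "UNIV - {F2} = {F1, F3}" "UNIV - {F3} = {F1, F2}"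
      by (auto simp: UNIV_fac)
    then show "g F1 = F F2 * F F3" "g F2 = F F1 * F F3" "g F3 = F F1 * F F2"
      by (simp_all add: g_def)
  qed
  \<comment> \<open>Since each \<open>F k * g k\<close> is the product of all three forms,
    differences of two of them are syzygies; the columns pair the rows F1 and F2 with the row
    F3.\<close>
  define m where "m k l = (case k of F1 \<Rightarrow> if l = 0 then F F1 else 0
    | F2 \<Rightarrow> if l = 0 then 0 else F F2 | F3 \<Rightarrow> - F F3)" for k and l :: nat
  have m2: "(\<Sum>l<2. m k l * v l) = m k 0 * v 0 + m k 1 * v 1" for k and v :: "nat \<Rightarrow> 'k mpoly"
    by (simp add: numeral_2_eq_2)
  have d: "deg3 a b c i = card (B i)" for i by (cases i) (simp_all add: deg3_def card)
  have deg_m: "(\<lambda>i. deg3 a b c i - sdeg a b c k i) = (\<lambda>j. if j = k then card (B k) else 0)" for k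
    by (auto simp: sdeg_def d)
  have m_trihom: "trihom (\<lambda>i. deg3 a b c i - sdeg a b c k i) (m k l)" for k l
    unfolding deg_m using trihom_F[of k] by (cases k) (auto simp: m_def trihom_0 trihom_uminus)
  have "Poly_Mapping.lookup (m k l) 0 = 0" for k l
  proof (rule ccontr)
    assume "Poly_Mapping.lookup (m k l) 0 \<noteq> 0"
    then have "tdeg 0 = (\<lambda>j. if j = k then card (B k) else 0)"
      using m_trihom[of k l] unfolding deg_m trihom_def by (auto simp: in_keys_iff)
    from fun_cong[OF this, of k] have "card (B k) = 0" by (simp add: tdeg_def)
    then show False using pos[of k] fin[of k] by simp
  qed
  moreover have "trihom (sdeg a b c k) (g k)" for k
  proof -
    have "trihom (\<lambda>j. \<Sum>i\<in>UNIV - {k}. if j = i then card (B i) else 0) (g k)"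
      unfolding g_def by (rule trihom_prod) (rule trihom_F)
    moreover have "(\<lambda>j. \<Sum>i\<in>UNIV - {k}. if j = i then card (B i) else 0) = sdeg a b c k"
      by (auto simp: sdeg_def d sum.delta')
    ultimately show ?thesis by simp
  qed
  moreover have "gen_ideal (range g) = gen_ideal pairs"
    by (simp add: UNIV_fac g pairs_def insert_commute)
  moreover have "(\<Sum>k\<in>UNIV. u k * g k) = 0 \<longleftrightarrow> (\<exists>v. \<forall>k. u k = (\<Sum>l<2. m k l * v l))" for u
  proof
    assume "\<exists>v. \<forall>k. u k = (\<Sum>l<2. m k l * v l)"
    then obtain v :: "nat \<Rightarrow> 'k mpoly" where "\<forall>k. u k = m k 0 * v 0 + m k 1 * v 1" unfolding m2 by (elim exE)
    then show "(\<Sum>k\<in>UNIV. u k * g k) = 0" by (simp add: sum_fac g m_def algebra_simps)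
  next
    assume "(\<Sum>k\<in>UNIV. u k * g k) = 0"
    then have s: "u F1 * (F F2 * F F3) + u F2 * (F F1 * F F3) + u F3 * (F F1 * F F2) = 0"
      by (simp add: sum_fac g)
    \<comment> \<open>The other two summands of the syzygy contain \<open>F k\<close>, and the two
      forms multiplying \<open>u k\<close> are regular modulo \<open>F k\<close>.\<close>
    have dvd: "\<exists>r. u k = r * F k"
      if "i \<noteq> k" "j \<noteq> k" "F i * (F j * u k) = t * F k" for i j k t
    proof -
      have "F i * (F j * u k) \<in> gen_ideal {F k}"
        unfolding that(3) by (auto simp: gen_ideal_insert)
      then have "u k \<in> gen_ideal {F k}" using nzd_F[OF that(1)] nzd_F[OF that(2)] nzd_modD by blast
      then show ?thesis by (auto simp: gen_ideal_insert)
    qed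
    have "F F2 * (F F3 * u F1) - (- u F2 * F F3 - u F3 * F F2) * F F1 = 0"
      "F F1 * (F F3 * u F2) - (- u F1 * F F3 - u F3 * F F1) * F F2 = 0"
      "F F1 * (F F2 * u F3) - (- u F1 * F F2 - u F2 * F F1) * F F3 = 0"
      using s by (simp_all add: algebra_simps)
    then have "F F2 * (F F3 * u F1) = (- u F2 * F F3 - u F3 * F F2) * F F1"
      "F F1 * (F F3 * u F2) = (- u F1 * F F3 - u F3 * F F1) * F F2"
      "F F1 * (F F2 * u F3) = (- u F1 * F F2 - u F2 * F F1) * F F3"
      by (simp_all only: right_minus_eq)
    then obtain r1 r2 r3 where r: "u F1 = r1 * F F1" "u F2 = r2 * F F2" "u F3 = r3 * F F3"
      using dvd[of F2 F1 F3] dvd[of F1 F2 F3] dvd[of F1 F3 F2] by (metis fac.distinct)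
    have "F F1 * (F F2 * (F F3 * (r1 + r2 + r3))) = 0" using s unfolding r by (simp add: algebra_simps)
    then have "r1 + r2 + r3 = 0" using F_nonzero mpoly_mult_eq_0 by blast
    then have r3: "r3 = - r1 - r2" by (simp add: eq_neg_iff_add_eq_0 algebra_simps)
    let ?v = "\<lambda>l :: nat. if l = 0 then r1 else r2"
    have "u k = (\<Sum>l<2. m k l * ?v l)" for k
      unfolding m2 by (cases k) (simp_all add: m_def r r3 algebra_simps)
    then show "\<exists>v. \<forall>k. u k = (\<Sum>l<2. m k l * v l)" by (intro exI[of _ ?v] allI)
  qed
  moreover have "v l = 0" if v: "\<And>k. (\<Sum>l<2. m k l * v l) = 0" "l < 2" for v and l :: nat
  proof -
    have "F F1 * v 0 = 0" "F F2 * v 1 = 0" using v(1)[of F1, unfolded m2] v(1)[of F2, unfolded m2] by (simp_all add: m_def)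
    then have "v 0 = 0" "v 1 = 0" using F_nonzero mpoly_mult_eq_0 by blast+
    then show ?thesis using \<open>l < 2\<close> by (auto simp: less_2_cases_iff)
  qed
  ultimately show ?thesis
    unfolding has_min_resolution_def using m_trihom by (intro exI[of _ g] exI[of _ m]) blast
qed

end

section \<open>Cohen--Macaulayness of the grid\<close>

lemma prime_ideal_prod:
  "prime_ideal P \<Longrightarrow> prod f S \<in> P \<Longrightarrow> \<exists>s\<in>S. f s \<in> P"
  by (induction S rule: infinite_finite_induct) (auto simp: prime_ideal_def)

text \<open>The surviving variable is one at which \<open>q\<close> has a nonzero coordinate; the
  conclusion has the shape that the bound on prime chains expects.\<close>

lemma lin_reduces_variables:
  fixes q :: "'k::field \<times> 'k"
  assumes "is_ideal P" "lin i q \<in> P" "q \<noteq> (0, 0)"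
  shows "\<exists>c (\<kappa> :: bool \<Rightarrow> 'k). \<forall>b. Var (i, b) - Const (\<kappa> b) * Var (i, c) \<in> P"
proof (cases "fst q = 0")
  case True
  then have "snd q \<noteq> 0" using assms(3) by (metis prod.collapse)
  then have "Const (1 / snd q) * Const (snd q) = 1" by (simp add: mult_single)
  then have "Var (i, b) - Const (if b then 1 else 0) * Var (i, True) =
      (if b then 0 else Const (1 / snd q) * lin i q)" for b
    using True by (auto simp: lin_def mult.assoc[symmetric])
  moreover have "(if b then 0 else Const (1 / snd q) * lin i q) \<in> P" for b
    using assms by (simp add: ideal_zero ideal_mult)
  ultimately show ?thesis
    by (intro exI[of _ True] exI[of _ "\<lambda>b. if b then 1 else 0"] allI) simp
next
  case False
  then have "Const (1 / fst q) * Const (fst q) = 1" "Const (1 / fst q) * Const (snd q) = Const (snd q / fst q)"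
    by (simp_all add: mult_single)
  then have "Var (i, b) - Const (if b then snd q / fst q else 1) * Var (i, False) =
      (if b then - (Const (1 / fst q) * lin i q) else 0)" for b
    by (auto simp: lin_def right_diff_distrib mult.assoc[symmetric])
  moreover have "(if b then - (Const (1 / fst q) * lin i q) else 0) \<in> P" for b
    using assms by (simp add: ideal_zero ideal_mult ideal_uminus)
  ultimately show ?thesis
    by (intro exI[of _ False] exI[of _ "\<lambda>b. if b then snd q / fst q else 1"] allI) simp
qed

context grid
begin

text \<open>A prime containing all pairwise products contains two of the \<open>F i\<close>, hence
  two linear forms from different factors. Each makes one of the six variables redundant, which
  leaves four.\<close>

lemma prime_chain_over_pairs_le:
  assumes P: "\<And>i. i \<le> n \<Longrightarrow> prime_ideal (P i)" "\<And>i. i < n \<Longrightarrow> P i \<subset> P (Suc i)"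
    and sub: "pairs \<subseteq> P 0"
  shows "n \<le> 4"
proof -
  have pr: "prime_ideal (P 0)" using P(1) by simp
  then have I: "is_ideal (P 0)" by (simp add: prime_ideal_def)
  have "F F1 \<in> P 0 \<or> F F2 \<in> P 0" "F F1 \<in> P 0 \<or> F F3 \<in> P 0" "F F2 \<in> P 0 \<or> F F3 \<in> P 0"
    using pr sub unfolding prime_ideal_def pairs_def by blast+
  then obtain i j where ij: "i \<noteq> j" "F i \<in> P 0" "F j \<in> P 0" by (metis fac.distinct)
  then obtain q r where "q \<in> B i" "lin i q \<in> P 0" "r \<in> B j" "lin j r \<in> P 0"
    using prime_ideal_prod[OF pr] unfolding F_def by meson
  then obtain c \<kappa> d \<kappa>' where
    c: "\<And>b. Var (i, b) - Const (\<kappa> b) * Var (i, c) \<in> P 0" and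
    d: "\<And>b. Var (j, b) - Const (\<kappa>' b) * Var (j, d) \<in> P 0"
    using lin_reduces_variables[OF I] nonzero by meson
  define \<pi> where "\<pi> v = (if fst v = i then (i, c) else if fst v = j then (j, d) else v)" for v :: var
  define \<rho> where "\<rho> v = (if fst v = i then \<kappa> (snd v) else if fst v = j then \<kappa>' (snd v) else 1)" for v :: var
  have "Var v - Const (\<rho> v) * Var (\<pi> v) \<in> P 0" for v
    using c[of "snd v"] d[of "snd v"] ideal_zero[OF I] by (cases v) (auto simp: \<rho>_def \<pi>_def)
  then have "n \<le> card (range \<pi>)" using prime_chain_length_le[of n P, OF P] by blast
  also have "\<dots> \<le> 4"
  proof -
    obtain k where k: "k \<noteq> i" "k \<noteq> j" by (rule fac_third)
    then have cover: "l = i \<or> l = j \<or> l = k" for l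
      using ij(1) by (cases i; cases j; cases k; cases l) auto
    have "range \<pi> \<subseteq> set [(i, c), (j, d), (k, False), (k, True)]"
    proof (rule image_subsetI)
      fix v :: var
      show "\<pi> v \<in> set [(i, c), (j, d), (k, False), (k, True)]"
        using cover[of "fst v"] k by (cases v) (auto simp: \<pi>_def)
    qed
    then have "card (range \<pi>) \<le> card (set [(i, c), (j, d), (k, False), (k, True)])"
      by (intro card_mono) auto
    also have "\<dots> \<le> 4" using card_length[of "[(i, c), (j, d), (k, False), (k, True)]"] by simp
    finally show ?thesis .
  qed
  finally show ?thesis .
qed

lemma cohen_macaulay_pairs:
  assumes "alg_closed TYPE('k)"
  shows "cohen_macaulay_quot (gen_ideal pairs)"
  unfolding cohen_macaulay_quot_def
proof (intro allI impI)
  fix M assume a: "maximal_ideal M \<and> gen_ideal pairs \<subseteq> M"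
  let ?I = "gen_ideal pairs"
  have M: "maximal_ideal M" "prime_ideal M" "is_ideal M" "?I \<subseteq> M"
    using a maximal_imp_prime_ideal[of M] by (auto simp: maximal_ideal_def)
  let ?chain = "\<lambda>n. \<exists>P :: nat \<Rightarrow> 'k mpoly set. (\<forall>i\<le>n. prime_ideal (P i) \<and> ?I \<subseteq> P i) \<and>
      (\<forall>i<n. P i \<subset> P (Suc i)) \<and> P n = M"
  let ?regular = "\<lambda>fs. set fs \<subseteq> M \<and> regular_seq_mod ?I fs"
  \<comment> \<open>Grade and height are suprema of sets of naturals, which have to be shown
    bounded; the bound on chains also bounds regular sequences, through the chains they
    produce.\<close>
  have le: "n \<le> 4" if "?chain n" for n
  proof -
    from that obtain P where P: "\<And>i. i \<le> n \<Longrightarrow> prime_ideal (P i)" "\<And>i. i < n \<Longrightarrow> P i \<subset> P (Suc i)"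
      "?I \<subseteq> P 0" by blast
    have "pairs \<subseteq> P 0" using P(3) gen_ideal_superset by blast
    with P show ?thesis by (intro prime_chain_over_pairs_le) auto
  qed
  have chain: "?chain (length fs)" if "?regular fs" for fs
    by (rule regular_sequence_imp_prime_chain[OF M(2) is_ideal_gen_ideal M(4)])
      (use that in \<open>simp_all add: regular_seq_mod_def nzd_mod_def\<close>)
  have residue: "\<exists>c. z - Const c \<in> M" for z
    by (rule maximal_ideal_residue[OF assms M(1), of z]) (rule exI)
  then have "\<forall>i. \<exists>t. (Var (i, False) + Const (\<mu> i) * Var (i, True)) - Const t \<in> M"
    by (intro allI)
  then obtain \<tau> where \<tau>: "\<forall>i. (Var (i, False) + Const (\<mu> i) * Var (i, True)) - Const (\<tau> i) \<in> M"
    by (rule choice[THEN exE])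
  obtain c where c: "(\<Sum>i\<in>UNIV. Var (i, True)) - Const c \<in> M"
    using residue by (rule exE)
  let ?fs = "map (slice \<mu> \<tau>) [F1, F2, F3] @ [trace c]"
  have fsM: "set ?fs \<subseteq> M" using \<tau> c by (simp add: slice_def trace_def)
  then have "gen_ideal (?I \<union> set ?fs) \<subseteq> M" using M by (intro gen_ideal_least) auto
  then have "1 \<notin> gen_ideal (?I \<union> set ?fs)" using M(2) by (auto simp: prime_ideal_def)
  moreover have "nzd_mod (gen_ideal (?I \<union> set (take k ?fs))) (?fs ! k)" if "k < 4" for k
    unfolding gen_ideal_Un_gen_ideal using regular_sequence_pairs[OF that] .
  ultimately have "?regular ?fs"
    using fsM unfolding regular_seq_mod_def nzd_mod_def by auto
  moreover have len: "length ?fs = 4" by simp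
  ultimately have four: "?regular ?fs" "?chain 4" using chain[of ?fs] unfolding len by blast+
  have "grade M ?I = 4"
    unfolding grade_def by (rule cSup_eq_maximum) (use four chain le in force)+
  moreover have "height_over M ?I = 4"
    unfolding height_over_def by (rule cSup_eq_maximum) (use four le in blast)+
  ultimately show "grade M ?I = height_over M ?I" by simp
qed

end

section \<open>Complete intersections of points are grids\<close>

text \<open>Scale the \<open>i\<close>-th factor of \<open>p\<close> by an indeterminate: a
  trihomogeneous \<open>h\<close> becomes \<open>eval h p\<close> times the power given by its
  \<open>i\<close>-th degree. This kills \<open>G\<close>, and a nonzero monomial of degree
  \<open>d i\<close> is a multiple of one of degree \<open>e i\<close> only if the latter is not
  larger.\<close>

lemma trihom_degree_le:
  fixes f :: "'k::idom mpoly"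
  assumes f: "trihom d f" "eval f p \<noteq> 0" and g: "trihom e g" and mem: "f \<in> gen_ideal (insert g G)"
    and G: "\<And>h. h \<in> G \<Longrightarrow> \<exists>d. trihom d h" "\<And>h. h \<in> G \<Longrightarrow> eval h p = 0"
  shows "e i \<le> d i"
proof -
  define s where "s v = monom (coord p v) (if fst v = i then 1 else 0)" for v
  let ?\<phi> = "subst (\<lambda>c. [:c:]) s"
  interpret \<phi>: ring_map ?\<phi> by (rule ring_map.ring_map_subst[OF ring_map_pCons])
  have \<phi>: "?\<phi> h = monom (eval h p) (n i)" if "trihom n h" for h n
  proof -
    have "mon_eval s m = monom (mon_eval (coord p) m) (n i)" if "m \<in> Poly_Mapping.keys h" for m
    proof -
      have "(\<Prod>v\<in>A. s v ^ Poly_Mapping.lookup m v) = monom (\<Prod>v\<in>A. coord p v ^ Poly_Mapping.lookup m v)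
          (\<Sum>v\<in>A. if fst v = i then Poly_Mapping.lookup m v else 0)" if "finite A" for A
        using that by induction (auto simp: s_def monom_power mult_monom)
      moreover have "(\<Sum>v\<in>UNIV. if fst v = i then Poly_Mapping.lookup m v else 0) = tdeg m i"
      proof -
        have "(\<Sum>v\<in>UNIV. if fst v = i then Poly_Mapping.lookup m v else 0) =
            (\<Sum>v\<in>{(i, False), (i, True)}. Poly_Mapping.lookup m v)"
          by (rule sum.mono_neutral_cong_right) auto
        then show ?thesis by (simp add: tdeg_def)
      qed
      moreover have "tdeg m = n" using \<open>trihom n h\<close> that by (auto simp: trihom_def)
      ultimately show ?thesis by (simp add: mon_eval_def)
    qed
    then have "?\<phi> h = (\<Sum>m\<in>Poly_Mapping.keys h. monom (Poly_Mapping.lookup h m * mon_eval (coord p) m) (n i))"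
      unfolding subst_def by (intro sum.cong) (auto simp: smult_monom)
    then show ?thesis by (simp add: eval_subst subst_def monom_sum)
  qed
  obtain r where r: "f - r * g \<in> gen_ideal G" using mem by (auto simp: gen_ideal_insert)
  have "?\<phi> h = 0" if "h \<in> G" for h using G[OF that] \<phi> by force
  then have "?\<phi> (f - r * g) = 0" using r by (rule \<phi>.gen_ideal_kernel)
  then have eq: "monom (eval f p) (d i) = ?\<phi> r * monom (eval g p) (e i)"
    using \<phi>[OF f(1)] \<phi>[OF g] by (simp add: \<phi>.map_diff \<phi>.map_mult)
  have "?\<phi> r \<noteq> 0" "eval g p \<noteq> 0" using eq f(2) by auto
  then show ?thesis using arg_cong[OF eq, of degree] f(2) by (simp add: degree_mult_eq degree_monom_eq)
qed

text \<open>A canonical representative of a point of the projective line, so that equality of points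
  becomes equality of vectors and points can be counted.\<close>

definition normalize_pt :: "'k::field \<times> 'k \<Rightarrow> 'k \<times> 'k" where
  "normalize_pt q = (if fst q = 0 then (0, 1) else (1, snd q / fst q))"

lemma normalize_pt_scale:
  assumes "q \<noteq> (0, 0)"
  obtains r where "r \<noteq> 0" "q = (r * fst (normalize_pt q), r * snd (normalize_pt q))"
proof (cases "fst q = 0")
  case True
  then show ?thesis using assms that[of "snd q"] by (cases q) (auto simp: normalize_pt_def)
next
  case False
  then show ?thesis using that[of "fst q"] by (cases q) (auto simp: normalize_pt_def)
qed

lemma normalize_pt_nonprop:
  "snd (normalize_pt q) * fst (normalize_pt r) = fst (normalize_pt q) * snd (normalize_pt r) \<longleftrightarrow>
    normalize_pt q = normalize_pt r"
  by (auto simp: normalize_pt_def)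

lemma normalize_pt_nonzero: "normalize_pt q \<noteq> (0, 0)"
  by (simp add: normalize_pt_def)

lemma lin_scale: "lin i (r * x, r * y) = Const r * lin i (x, y)"
  by (simp add: lin_def mult_single right_diff_distrib flip: mult.assoc)

lemma lin_in_normalize:
  fixes q :: "'k::field \<times> 'k"
  assumes "q \<noteq> (0, 0)"
  shows "lin i q \<in> gen_ideal (insert (lin i (normalize_pt q)) G)"
    and "lin i (normalize_pt q) \<in> gen_ideal (insert (lin i q) G)"
proof -
  obtain r where r: "r \<noteq> 0" "q = (r * fst (normalize_pt q), r * snd (normalize_pt q))"
    using normalize_pt_scale[OF assms] .
  have l: "lin i q = Const r * lin i (normalize_pt q)"
    by (subst r(2)) (simp add: lin_scale)
  have "Const (1 / r) * lin i q = (Const (1 / r) * Const r) * lin i (normalize_pt q)"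
    unfolding l by (simp only: mult.assoc)
  then have l': "lin i (normalize_pt q) = Const (1 / r) * lin i q" using r(1) by (simp add: mult_single)
  show "lin i q \<in> gen_ideal (insert (lin i (normalize_pt q)) G)"
    unfolding l by (intro ideal_mult is_ideal_gen_ideal in_gen_ideal) simp
  have "Const (1 / r) * lin i q \<in> gen_ideal (insert (lin i q) G)"
    by (intro ideal_mult is_ideal_gen_ideal in_gen_ideal) simp
  then show "lin i (normalize_pt q) \<in> gen_ideal (insert (lin i q) G)" unfolding l' .
qed

lemma gen_ideal_normalize:
  fixes q r :: "'k::field \<times> 'k"
  assumes "q \<noteq> (0, 0)" "r \<noteq> (0, 0)"
  shows "gen_ideal {lin i q, lin j r} = gen_ideal {lin i (normalize_pt q), lin j (normalize_pt r)}"
proof (rule gen_ideal_eqI)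
  show "{lin i q, lin j r} \<subseteq> gen_ideal {lin i (normalize_pt q), lin j (normalize_pt r)}"
    using lin_in_normalize(1)[OF assms(1)] lin_in_normalize(1)[OF assms(2)]
    by (auto simp: insert_commute[of "lin i (normalize_pt q)" "lin j (normalize_pt r)"])
      (metis insert_commute)
  show "{lin i (normalize_pt q), lin j (normalize_pt r)} \<subseteq> gen_ideal {lin i q, lin j r}"
    using lin_in_normalize(2)[OF assms(1), of i "{lin j r}"] lin_in_normalize(2)[OF assms(2), of j "{lin i q}"]
    by (auto simp: insert_commute[of "lin j r"])
qed

text \<open>The zero set of the two forms is larger than \<open>line_through p k\<close>: it also
  has points with zero \<open>k\<close>-th vector and points whose other vectors are multiples of
  those of \<open>p\<close>. Multiplying \<open>f\<close> by a variable of factor \<open>k\<close>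
  handles the former, trihomogeneity the latter; the variable then cancels because it is regular
  modulo the flat.\<close>

lemma vanishing_ideal_line:
  fixes p :: "'k::field_char_0 pt"
  assumes p: "valid_pt p" and ijk: "i \<noteq> j" "k \<noteq> i" "k \<noteq> j"
  shows "vanishing_ideal (line_through p k) = gen_ideal {lin i (p i), lin j (p j)}"
proof -
  define L where "L = [i \<mapsto> p i, j \<mapsto> p j]"
  have UN: "l = i \<or> l = j \<or> l = k" for l using ijk by (cases i; cases j; cases k; cases l) auto
  have g: "gens L (\<lambda>_. 0) (\<lambda>_. 0) {} = {lin i (p i), lin j (p j)}"
    unfolding L_def using ijk by (simp add: gens_upd gens_empty insert_commute)
  have flat: "flat {lin i (p i), lin j (p j)}"
    unfolding g[symmetric] using p by (intro flat_gens) (auto simp: L_def valid_pt_def split: if_splits)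
  show ?thesis
    unfolding vanishing_ideal_def
  proof (intro equalityI gen_ideal_least is_ideal_gen_ideal subsetI)
    fix f assume "f \<in> {f. (\<exists>d. trihom d f) \<and> (\<forall>q\<in>line_through p k. eval f q = 0)}"
    then obtain d where f: "trihom d f" "\<And>q. q \<in> line_through p k \<Longrightarrow> eval f q = 0" by auto
    have "Var (k, b) * f \<in> gen_ideal {lin i (p i), lin j (p j)}" for b
    proof (rule flat_vanishing[OF flat])
      fix q assume q: "\<And>g. g \<in> {lin i (p i), lin j (p j)} \<Longrightarrow> eval g q = 0"
      show "eval (Var (k, b) * f) q = 0"
      proof (cases "q k = (0, 0)")
        case True
        then show ?thesis by (simp add: eval_simps coord_def)
      next
        case False
        have "\<exists>r. q l = (r * fst (p l), r * snd (p l))" if "l \<noteq> k" for l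
        proof -
          have e: "snd (p l) * fst (q l) = fst (p l) * snd (q l)"
            using q[of "lin l (p l)"] UN[of l] that by (auto simp: eval_lin)
          have ne: "p l \<noteq> (0, 0)" using p by (simp add: valid_pt_def)
          show ?thesis
          proof (cases "fst (p l) = 0")
            case True
            then have "snd (p l) \<noteq> 0" using ne by (metis prod.collapse)
            then show ?thesis using e True
              by (intro exI[of _ "snd (q l) / snd (p l)"]) (auto simp: prod_eq_iff)
          next
            case False
            then show ?thesis using e
              by (intro exI[of _ "fst (q l) / fst (p l)"]) (auto simp: prod_eq_iff field_simps)
          qed
        qed
        then obtain r where r: "\<And>l. l \<noteq> k \<Longrightarrow> q l = (r l * fst (p l), r l * snd (p l))" by metis
        have "p(k := q k) \<in> line_through p k" using p False by (auto simp: line_through_def valid_pt_def)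
        then have "eval f (p(k := q k)) = 0" by (rule f(2))
        moreover have "eval f q = (\<Prod>l\<in>UNIV. (r(k := 1)) l ^ d l) * eval f (p(k := q k))"
          by (rule trihom_eval_scale[OF f(1)]) (use r in auto)
        ultimately show ?thesis by (simp add: eval_simps)
      qed
    qed
    moreover have "nzd_mod (gen_ideal {lin i (p i), lin j (p j)}) (Var (k, False))"
      by (rule flat_nzd_mod[OF flat, of "p(k := (1, 0))"]) (use ijk in \<open>auto simp: eval_lin coord_def\<close>)
    ultimately show "f \<in> gen_ideal {lin i (p i), lin j (p j)}" using nzd_modD by blast
  next
    fix f assume f: "f \<in> {lin i (p i), lin j (p j)}"
    show "f \<in> gen_ideal {f. (\<exists>d. trihom d f) \<and> (\<forall>q\<in>line_through p k. eval f q = 0)}"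
    proof (intro in_gen_ideal CollectI conjI ballI)
      show "\<exists>d. trihom d f" using f trihom_lin by blast
      show "eval f q = 0" if "q \<in> line_through p k" for q
        using that f ijk by (auto simp: line_through_def eval_lin)
    qed
  qed
qed

lemma trihom_0_const: "trihom (\<lambda>_. 0) f \<Longrightarrow> f = Const (Poly_Mapping.lookup f 0)"
proof (rule poly_mapping_eqI)
  fix m assume f: "trihom (\<lambda>_. 0) f"
  have "m = 0" if "m \<in> Poly_Mapping.keys f"
  proof (rule poly_mapping_eqI)
    fix v :: var
    have "tdeg m (fst v) = 0" using f that by (auto simp: trihom_def)
    then show "Poly_Mapping.lookup m v = Poly_Mapping.lookup 0 v"
      by (cases v; cases "snd v") (auto simp: tdeg_def)
  qed
  then show "Poly_Mapping.lookup f m = Poly_Mapping.lookup (Const (Poly_Mapping.lookup f 0)) m"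
    by (cases "m = 0") (auto simp: lookup_single in_keys_iff)
qed

text \<open>Regularity is used through two consequences: a zero generator would put 1 into the ideal
  of its predecessors, and a nonzero constant generator would make the whole ideal the unit
  ideal.\<close>

lemma complete_intersection_obtain:
  fixes C :: "'k::field pt set"
  assumes "complete_intersection C a b c"
  obtains G where
    "\<And>i. trihom (\<lambda>j. if j = i then deg3 a b c i else 0) (G i)" "\<And>i. G i \<noteq> 0"
    "\<And>i. deg3 a b c i > 0" "vanishing_ideal C = gen_ideal (range G)"
proof -
  obtain G1 G2 G3 where G: "trihom (deg3 a 0 0) G1" "trihom (deg3 0 b 0) G2" "trihom (deg3 0 0 c) G3"
    "regular_seq_mod {0} [G1, G2, G3]" "vanishing_ideal C = gen_ideal {G1, G2, G3}"
    using assms by (auto simp: complete_intersection_def)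
  define G where "G i = (case i of F1 \<Rightarrow> G1 | F2 \<Rightarrow> G2 | F3 \<Rightarrow> G3)" for i
  have "deg3 a 0 0 = (\<lambda>j. if j = F1 then a else 0)" "deg3 0 b 0 = (\<lambda>j. if j = F2 then b else 0)"
    "deg3 0 0 c = (\<lambda>j. if j = F3 then c else 0)"
    by (auto simp: deg3_def split: fac.split)
  then have tri: "trihom (\<lambda>j. if j = i then deg3 a b c i else 0) (G i)" for i
    using G(1-3) by (cases i) (simp_all add: G_def deg3_def cong: if_cong)
  have rng: "range G = {G1, G2, G3}" by (simp add: UNIV_fac G_def)
  have "1 \<notin> gen_ideal ({0} \<union> set [G1, G2, G3])" using G(4) unfolding regular_seq_mod_def by blast
  then have one: "1 \<notin> gen_ideal {G1, G2, G3}" unfolding insert_is_Un[symmetric] by simp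
  have nz: "G i \<noteq> 0" for i
  proof
    assume "G i = 0"
    define k where "k = (if i = F1 then 0 else if i = F2 then 1 else 2 :: nat)"
    have k: "k < 3" "[G1, G2, G3] ! k = 0"
      using \<open>G i = 0\<close> by (cases i; simp add: k_def G_def)+
    have "[G1, G2, G3] ! k * 1 \<in> gen_ideal ({0} \<union> set (take k [G1, G2, G3]))"
      unfolding k(2) using ideal_zero[OF is_ideal_gen_ideal] by simp
    moreover have "k < length [G1, G2, G3]" using k(1) by simp
    ultimately have "1 \<in> gen_ideal ({0} \<union> set (take k [G1, G2, G3]))"
      using G(4) unfolding regular_seq_mod_def by blast
    moreover have "gen_ideal ({0} \<union> set (take k [G1, G2, G3])) \<subseteq> gen_ideal ({0} \<union> set [G1, G2, G3])"
      by (intro gen_ideal_mono Un_mono set_take_subset order_refl)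
    ultimately show False using \<open>1 \<notin> gen_ideal ({0} \<union> set [G1, G2, G3])\<close> by blast
  qed
  have pos: "deg3 a b c i > 0" for i
  proof (rule ccontr)
    assume "\<not> deg3 a b c i > 0"
    then have "(\<lambda>j. if j = i then deg3 a b c i else 0) = (\<lambda>_. 0)" by auto
    then have "trihom (\<lambda>_. 0) (G i)" using tri[of i] by metis
    then obtain x where x: "G i = Const x" using trihom_0_const by metis
    moreover have "G i \<in> gen_ideal (range G)" by (intro in_gen_ideal) simp
    ultimately have "x = 0" using Const_in_ideal[OF is_ideal_gen_ideal] one rng by metis
    then show False using x nz[of i] by simp
  qed
  show thesis using that[OF tri nz pos] G(5) rng by simp
qed

theorem theorem5p6:
  fixes C :: "'k::field_char_0 pt set" and a b c :: nat
  assumes "alg_closed TYPE('k)"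
    and "complete_intersection C a b c"
  shows "cohen_macaulay_quot (grid_ideal C) \<and> has_min_resolution (grid_ideal C) a b c"
proof -
  have finC: "finite C" and valid: "\<And>p. p \<in> C \<Longrightarrow> valid_pt p"
    using assms(2) by (auto simp: complete_intersection_def)
  then have nz: "p i \<noteq> (0, 0)" if "p \<in> C" for p i using that by (simp add: valid_pt_def)
  obtain G where G: "\<And>i. trihom (\<lambda>j. if j = i then deg3 a b c i else 0) (G i)" "\<And>i. G i \<noteq> 0"
    "\<And>i. deg3 a b c i > 0" "vanishing_ideal C = gen_ideal (range G)"
    using complete_intersection_obtain[OF assms(2)] by blast
  define B where "B i = (\<lambda>p. normalize_pt (p i)) ` C" for i
  \<comment> \<open>Each \<open>q\<close> excludes at most one value of \<open>m\<close>: a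
    normalised \<open>q\<close> with \<open>snd q = 0\<close> is \<open>(1, 0)\<close> and excludes
    none. The field is infinite.\<close>
  have "\<exists>m. \<forall>q\<in>B i. fst q + m * snd q \<noteq> 0" for i
  proof -
    have "finite ((\<lambda>q. - fst q / snd q) ` B i)" using finC by (simp add: B_def)
    then obtain m where m: "m \<notin> (\<lambda>q. - fst q / snd q) ` B i"
      using ex_new_if_finite[OF infinite_UNIV_char_0] by blast
    have "fst q + m * snd q \<noteq> 0" if q: "q \<in> B i" for q
    proof
      assume e: "fst q + m * snd q = 0"
      show False
      proof (cases "snd q = 0")
        case True
        then show False using e q by (auto simp: B_def normalize_pt_def split: if_splits)
      next
        case False
        then have "m = - fst q / snd q" using e by (simp add: field_simps eq_neg_iff_add_eq_0)
        then show False using m q by blast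
      qed
    qed
    then show ?thesis by blast
  qed
  then obtain \<mu> where \<mu>: "\<And>i q. q \<in> B i \<Longrightarrow> fst q + \<mu> i * snd q \<noteq> 0" by metis
  have rng: "\<exists>p. q = normalize_pt p" if "q \<in> B i" for q i
    using that unfolding B_def by blast
  interpret grid B \<mu>
  proof
    show "finite (B i)" for i using finC by (simp add: B_def)
    show "q \<noteq> (0, 0)" if "q \<in> B i" for q i using rng[OF that] normalize_pt_nonzero by metis
    show "snd q * fst r \<noteq> fst q * snd r" if "q \<in> B i" "r \<in> B i" "q \<noteq> r" for q r i
      using rng[OF that(1)] rng[OF that(2)] that(3) normalize_pt_nonprop by metis
  qed (rule \<mu>)
  have van: "eval (G i) p = 0" if "p \<in> C" for i p
  proof -
    have "G i \<in> vanishing_ideal C" unfolding G(4) by (intro in_gen_ideal) simp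
    then show ?thesis unfolding vanishing_ideal_def
      by (rule eval_gen_ideal_zero[rotated]) (use that in auto)
  qed
  \<comment> \<open>\<open>G i\<close> has degree zero in the other factors, so its vanishing on
    \<open>C\<close> passes to every multiple of a normalised \<open>i\<close>-th coordinate,
    whatever stands elsewhere.\<close>
  have vanB: "eval (G i) y = 0" if y: "y i = (r * fst q, r * snd q)" "q \<in> B i" for i y r q
  proof -
    obtain p where p: "p \<in> C" "q = normalize_pt (p i)" using y(2) by (auto simp: B_def)
    obtain t where t: "t \<noteq> 0" "p i = (t * fst q, t * snd q)"
      using normalize_pt_scale[OF nz[OF p(1), of i]] p(2) by metis
    have "eval (G i) y = (\<Prod>j\<in>UNIV. (r / t) ^ (if j = i then deg3 a b c i else 0)) * eval (G i) p"
      by (rule trihom_eval_scale[OF G(1)]) (use y t in auto)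
    then show ?thesis using van[OF p(1)] by simp
  qed
  have card: "card (B i) = deg3 a b c i" for i
  proof (rule antisym)
    have line: "gens [i \<mapsto> q] \<mu> \<mu> {} = {lin i q}" for q by (simp add: gens_upd gens_empty)
    \<comment> \<open>\<open>G i\<close> vanishes wherever one of the forms \<open>lin i q\<close>
      does, so it is a multiple of their product.\<close>
    have "G i \<in> gen_ideal (insert (F i) {})"
      unfolding F_def
    proof (rule in_gen_ideal_insert_prod[OF fin])
      fix q q' assume q: "q \<in> B i" "q' \<in> B i" "q \<noteq> q'"
      then show "nzd_mod (gen_ideal {lin i q}) (lin i q')"
        using nzd_lin_same_factor[of "[i \<mapsto> q]" i q q' "{}" \<mu>] by (simp add: line)
    next
      fix q assume q: "q \<in> B i"
      have "flat {lin i q}" using flat_gens_grid[of "[i \<mapsto> q]" \<mu> "{}"] q by (simp add: line)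
      then show "G i \<in> gen_ideal {lin i q}"
      proof (rule flat_vanishing)
        fix y assume "\<And>g. g \<in> {lin i q} \<Longrightarrow> eval g y = 0"
        then have e: "snd q * fst (y i) = fst q * snd (y i)" by (simp add: eval_lin)
        have "q = (0, 1) \<or> fst q = 1" using q by (auto simp: B_def normalize_pt_def)
        then have "\<exists>r. y i = (r * fst q, r * snd q)"
          using e by (cases "y i"; cases q) (auto simp: mult.commute)
        then show "eval (G i) y = 0" using vanB q by blast
      qed
    qed
    moreover obtain p where "eval (G i) p \<noteq> 0" using mpoly_nonzero_value[OF G(2)] by blast
    ultimately show "card (B i) \<le> deg3 a b c i"
      using trihom_degree_le[OF G(1)[of i] _ trihom_F[of i], of p "{}" i] by simp
  next
    have "F i \<in> vanishing_ideal C"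
      unfolding vanishing_ideal_def
    proof (intro in_gen_ideal CollectI conjI ballI)
      show "\<exists>d. trihom d (F i)" using trihom_F by blast
      fix p assume p: "p \<in> C"
      have "lin i (normalize_pt (p i)) \<in> gen_ideal {lin i (p i)}"
        using lin_in_normalize(2)[OF nz[OF p, of i], of i "{}"] .
      then have "eval (lin i (normalize_pt (p i))) p = 0"
        by (rule eval_gen_ideal_zero[rotated]) (auto simp: eval_lin)
      moreover have "normalize_pt (p i) \<in> B i" using p by (auto simp: B_def)
      ultimately show "eval (F i) p = 0"
        using fin by (auto simp: F_def eval_simps B_def)
    qed
    moreover have "range G = insert (G i) (G ` (UNIV - {i}))" by auto
    ultimately have mem: "F i \<in> gen_ideal (insert (G i) (G ` (UNIV - {i})))" using G(4) by simp
    obtain p where p: "eval (F i) p \<noteq> 0" using mpoly_nonzero_value[OF F_nonzero] by blast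
    \<comment> \<open>Zero vectors in the other factors kill every \<open>G j\<close> with
      \<open>j \<noteq> i\<close>, whose degree is positive, and leave the value of
      \<open>F i\<close> unchanged. This reduces the degree comparison to \<open>F i\<close> and
      \<open>G i\<close>.\<close>
    define p' where "p' = (\<lambda>j. if j = i then p i else (0, 0))"
    have "eval (F i) p' = eval (F i) p" by (simp add: F_def eval_simps eval_lin p'_def)
    moreover have "eval (G j) p' = 0" if "j \<noteq> i" for j
    proof -
      have "eval (G j) p' = (\<Prod>l\<in>UNIV. 0 ^ (if l = j then deg3 a b c j else 0)) * eval (G j) p'"
        by (rule trihom_eval_scale[OF G(1)]) (use that in \<open>auto simp: p'_def\<close>)
      also have "(\<Prod>l\<in>UNIV. 0 ^ (if l = j then deg3 a b c j else 0)) = (0 :: 'k)"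
        using G(3)[of j] by (intro prod_zero) (auto intro!: bexI[of _ j])
      finally show ?thesis by simp
    qed
    ultimately show "deg3 a b c i \<le> card (B i)"
      using trihom_degree_le[OF trihom_F[of i] _ G(1)[of i] mem, of p' i] p G(1) by force
  qed
  have B_ne: "B i \<noteq> {}" for i using card[of i] G(3)[of i] by auto
  have prod: "\<exists>p\<in>C. \<forall>i. normalize_pt (p i) = y i" if y: "\<And>i. y i \<in> B i" for y
  proof (rule ccontr)
    assume "\<not> ?thesis"
    then obtain k where k: "\<And>p. p \<in> C \<Longrightarrow> normalize_pt (p (k p)) \<noteq> y (k p)" by metis
    \<comment> \<open>In factor \<open>k p\<close> the points \<open>p\<close> and \<open>y\<close>
      differ, so the corresponding linear form vanishes at \<open>p\<close> but not at
      \<open>y\<close>.\<close>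
    define f where "f = (\<Prod>p\<in>C. lin (k p) (normalize_pt (p (k p))))"
    have "f \<in> vanishing_ideal C"
      unfolding vanishing_ideal_def
    proof (intro in_gen_ideal CollectI conjI ballI)
      show "\<exists>d. trihom d f" unfolding f_def by (rule exI, rule trihom_prod, rule trihom_lin)
      fix p assume p: "p \<in> C"
      have "lin (k p) (normalize_pt (p (k p))) \<in> gen_ideal {lin (k p) (p (k p))}"
        using lin_in_normalize(2)[OF nz[OF p, of "k p"], of "k p" "{}"] .
      then have "eval (lin (k p) (normalize_pt (p (k p)))) p = 0"
        by (rule eval_gen_ideal_zero[rotated]) (auto simp: eval_lin)
      then show "eval f p = 0" using finC p by (auto simp: f_def eval_simps)
    qed
    then have "eval f y = 0" unfolding G(4)
      by (rule eval_gen_ideal_zero[rotated]) (use y vanB[of y _ 1] in auto)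
    then obtain p where p: "p \<in> C" "eval (lin (k p) (normalize_pt (p (k p)))) y = 0"
      using finC by (auto simp: f_def eval_simps)
    moreover obtain p' where "y (k p) = normalize_pt (p' (k p))" using y[of "k p"] by (auto simp: B_def)
    ultimately show False using k[OF p(1)] normalize_pt_nonprop[of "p (k p)" "p' (k p)"] by (simp add: eval_lin)
  qed
  have "grid_ideal C = gen_ideal pairs"
  proof (intro set_eqI iffI)
    fix x assume x: "x \<in> grid_ideal C"
    have "x \<in> gen_ideal {lin i q, lin j r}" if ij: "i \<noteq> j" "q \<in> B i" "r \<in> B j" for i j q r
    proof -
      obtain k where k: "k \<noteq> i" "k \<noteq> j" by (rule fac_third)
      \<comment> \<open>Any third coordinate \<open>s\<close> completes \<open>q\<close> and
        \<open>r\<close> to a point of the product; the point of \<open>C\<close> over it lies on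
        the line in question.\<close>
      obtain s where "s \<in> B k" using B_ne by blast
      define y where "y = (\<lambda>l. if l = i then q else if l = j then r else s)"
      have "l = i \<or> l = j \<or> l = k" for l using ij(1) k by (cases i; cases j; cases k; cases l) auto
      then have "y l \<in> B l" for l using ij \<open>s \<in> B k\<close> by (auto simp: y_def)
      then obtain p where p: "p \<in> C" "\<And>l. normalize_pt (p l) = y l" using prod by blast
      have "x \<in> vanishing_ideal (line_through p k)" using x p(1) by (auto simp: grid_ideal_def)
      then have "x \<in> gen_ideal {lin i (p i), lin j (p j)}"
        using vanishing_ideal_line[OF valid[OF p(1)] ij(1) k] by simp
      then show ?thesis using p ij(1) gen_ideal_normalize[OF nz[OF p(1)] nz[OF p(1)], of i i j j]
        by (simp add: y_def)
    qed
    then show "x \<in> gen_ideal pairs" by (simp add: gen_ideal_pairs)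
  next
    fix x assume x: "x \<in> gen_ideal pairs"
    have "x \<in> vanishing_ideal (line_through p k)" if p: "p \<in> C" for p k
    proof -
      obtain i where i: "i \<noteq> k" by (metis fac.distinct(1))
      obtain j where j: "j \<noteq> i" "j \<noteq> k" by (rule fac_third)
      have "normalize_pt (p i) \<in> B i" "normalize_pt (p j) \<in> B j" using p by (auto simp: B_def)
      then have "x \<in> gen_ideal {lin i (p i), lin j (p j)}"
        using x j(1) gen_ideal_normalize[OF nz[OF p] nz[OF p], of i i j j] by (simp add: gen_ideal_pairs)
      then show ?thesis using vanishing_ideal_line[OF valid[OF p], of i j k] i j by simp
    qed
    then show "x \<in> grid_ideal C" by (auto simp: grid_ideal_def)
  qed
  moreover have "has_min_resolution (gen_ideal pairs) a b c"
    using card[of F1] card[of F2] card[of F3] B_ne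
    by (intro has_min_resolution_pairs) (auto simp: deg3_def)
  ultimately show ?thesis using cohen_macaulay_pairs[OF assms(1)] by simp
qed

end
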